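(* Let $\mu\in(\tfrac12,1]$, let $A\in\mathbb{R}^{m\times n}$ have i.i.d. standard normal entries, and let $\tilde x\in[0,1]^n$ be box-constrained $k$-sparse with $\tilde x_1=\dots=\tilde x_{\mu(n-k)}=0$, $\tilde x_{\mu(n-k)+1}=\dots=\tilde x_{n-k}=1$, and the remaining $k$ entries in $(0,1)$ at arbitrary but fixed positions; let $y=A\tilde x$. Let $k,m,n\to\infty$ with $\beta=k/n$ fixed, and let $\alpha_w$ be determined by $$\frac{(2\mu-1)(1-\beta)\sqrt{\frac{1}{2\pi}}\,e^{-\left(\operatorname{erfinv}\left(\frac{1+\beta-2\alpha_w}{(2\mu-1)(1-\beta)}\right)\right)^2}}{\alpha_w\sqrt2\,\operatorname{erfinv}\left(\frac{1+\beta-2\alpha_w}{(2\mu-1)(1-\beta)}\right)}=1.$$ Then: (1) if $m/n=\alpha>\alpha_w$, with overwhelming probability $\tilde x$ is the unique solution of the box $\ell_1$ program; (2) if $m/n=\alpha<\alpha_w$, with overwhelming probability $\tilde x$ is not the unique solution of the box $\ell_1$ program.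
   Context: Box $\ell_1$ program: minimize $\|x\|_1$ over $x\in\mathbb{R}^n$ subject to $Ax=y$, $0\le x_i\le1$ for all $i$. A vector in $[0,1]^n$ is box-constrained $k$-sparse if at most $k$ of its entries lie outside $\{0,1\}$. "With overwhelming probability" means with probability at least $1-e^{-cn}$ for some constant $c>0$ and all large $n$. $\operatorname{erfinv}$ is the inverse of $\operatorname{erf}(t)=\frac2{\sqrt\pi}\int_0^te^{-s^2}ds$. *)

theory Defs
  imports "HOL-Probability.Probability"
begin

text \<open>Error function and its inverse (on (-1,1), where erf is a bijection from the reals).\<close>
definition erf :: "real \<Rightarrow> real" where
  "erf t = 2 / sqrt pi * interval_lebesgue_integral lborel (ereal 0) (ereal t) (\<lambda>s. exp (- (s\<^sup>2)))"

definition erfinv :: "real \<Rightarrow> real" where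
  "erfinv y = (THE t. erf t = y)"

text \<open>Vectors in R^n are functions nat => real restricted to indices < n;
  an m x n matrix is a function (nat \<times> nat) => real restricted to {..<m} \<times> {..<n}.\<close>
definition matvec :: "nat \<Rightarrow> ((nat \<times> nat) \<Rightarrow> real) \<Rightarrow> (nat \<Rightarrow> real) \<Rightarrow> nat \<Rightarrow> real" where
  "matvec n A x i = (\<Sum>j<n. A (i, j) * x j)"

definition l1norm :: "nat \<Rightarrow> (nat \<Rightarrow> real) \<Rightarrow> real" where
  "l1norm n x = (\<Sum>i<n. \<bar>x i\<bar>)"

definition box_feasible :: "nat \<Rightarrow> nat \<Rightarrow> ((nat \<times> nat) \<Rightarrow> real) \<Rightarrow> (nat \<Rightarrow> real) \<Rightarrow> (nat \<Rightarrow> real) \<Rightarrow> bool" where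
  "box_feasible m n A y x \<longleftrightarrow> (\<forall>i<n. 0 \<le> x i \<and> x i \<le> 1) \<and> (\<forall>i<m. matvec n A x i = y i)"

definition box_l1_unique_solution :: "nat \<Rightarrow> nat \<Rightarrow> ((nat \<times> nat) \<Rightarrow> real) \<Rightarrow> (nat \<Rightarrow> real) \<Rightarrow> (nat \<Rightarrow> real) \<Rightarrow> bool" where
  "box_l1_unique_solution m n A y x \<longleftrightarrow> box_feasible m n A y x \<and>
     (\<forall>z. box_feasible m n A y z \<and> (\<exists>i<n. z i \<noteq> x i) \<longrightarrow> l1norm n x < l1norm n z)"

definition gaussian_matrix :: "nat \<Rightarrow> nat \<Rightarrow> ((nat \<times> nat) \<Rightarrow> real) measure" where
  "gaussian_matrix m n = PiM ({..<m} \<times> {..<n}) (\<lambda>_. density lborel std_normal_density)"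

definition unique_event :: "nat \<Rightarrow> nat \<Rightarrow> (nat \<Rightarrow> real) \<Rightarrow> ((nat \<times> nat) \<Rightarrow> real) set" where
  "unique_event m n x = {A \<in> space (gaussian_matrix m n). box_l1_unique_solution m n A (matvec n A x) x}"

end

theory Submission
  imports Defs "HOL-Real_Asymp.Real_Asymp"
begin

text \<open>The vector is the unique solution iff the kernel of the matrix meets its descent cone only in 0. By Gordon's
  comparison inequality for the Gaussian processes \<open>u \<bullet> A w + \<gamma>\<close> and \<open>g \<bullet> u + h \<bullet> w\<close>, this is decided, up to exponentially
  small probabilities, by comparing the norm of the \<open>m\<close>-dimensional Gaussian vector \<open>g\<close> with the norm of the projection of
  the \<open>n\<close>-dimensional Gaussian vector \<open>h\<close> onto the descent cone. If the kernel misses the cone, then some \<open>u\<close> has a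
  nonpositive inner product with the whole image of the cone, so the same inequality with the roles of \<open>u\<close> and \<open>w\<close> exchanged
  applies. For the Lagrange multiplier \<open>t\<close> of the constraint on the sum, the projection acts coordinatewise by
  truncation at \<open>t\<close>, so its squared norm divided by \<open>n\<close> concentrates around its mean. The optimal multiplier is \<open>sqrt 2\<close>
  times the value of \<open>erfinv\<close> in the equation for \<open>\<alpha>w\<close>, and the mean for it is \<open>\<alpha>w\<close>.\<close>

section \<open>Gaussian product measures and integration by parts\<close>

text \<open>The equation for \<alpha>w is a stationarity condition. Let \<open>mean_soft t\<close>
  be the limiting mean of the truncated coordinates and \<open>active_fraction t\<close> the
  limiting fraction of nonzero ones. The limiting squared norm per coordinate has derivative
  \<open>- 2 * mean_soft t\<close> in \<open>t\<close>, so it is minimal where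
  \<open>mean_soft\<close> vanishes, and its value there is \<open>active_fraction t\<close>. The
  comparison bounds from above the probability that some point of one set has a small form against
  all points of another. So each half bounds an existence event: a kernel vector in the cone, or a
  unit vector \<open>u\<close> separating the image. That existential ranges over an infinite set
  and is reached through ever finer nets; the other set is one finite net, whose error is a small
  multiple of \<open>sqrt n\<close>. For failure the optimal multiplier itself is unsuitable: its
  truncated vector has limiting mean sum 0, so concentration cannot place it in the cone. A slightly
  larger multiplier makes the sum negative and, by continuity, changes the other quantities
  little.\<close>

definition std_normal :: "real measure" where
  "std_normal = density lborel std_normal_density"

lemma sets_std_normal [simp, measurable_cong]: "sets std_normal = sets borel"
  by (simp add: std_normal_def)

lemma space_std_normal [simp]: "space std_normal = UNIV"
  by (simp add: std_normal_def)

abbreviation std_gauss :: "'i set \<Rightarrow> ('i \<Rightarrow> real) measure" where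
  "std_gauss I \<equiv> PiM I (\<lambda>_. std_normal)"

lemma prob_space_std_normal: "prob_space std_normal"
  unfolding std_normal_def by (rule prob_space_normal_density) simp

lemma product_sigma_finite_std_normal: "product_sigma_finite (\<lambda>_. std_normal)"
  by (intro product_sigma_finite.intro prob_space_imp_sigma_finite prob_space_std_normal)

lemma prob_space_std_gauss: "prob_space (std_gauss I)"
  by (intro prob_space_PiM prob_space_std_normal)

lemma measurable_std_gauss_component:
  "i \<in> I \<Longrightarrow> (\<lambda>\<omega>. \<omega> i) \<in> borel_measurable (std_gauss I)"
  using measurable_component_singleton[of i I "\<lambda>_. std_normal"]
  by (simp add: measurable_def)

lemma std_normal_integrable_iff:
  fixes f :: "real \<Rightarrow> real"
  assumes "f \<in> borel_measurable borel"
  shows "integrable std_normal f \<longleftrightarrow> integrable lborel (\<lambda>x. std_normal_density x * f x)"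
  using integrable_density[of f lborel std_normal_density] assms
  by (simp only: measurable_lborel1 measurable_lborel2 real_scaleR_def AE_I2[OF normal_density_nonneg] borel_measurable_normal_density std_normal_def)

lemma std_normal_integral:
  fixes f :: "real \<Rightarrow> real"
  assumes "f \<in> borel_measurable borel"
  shows "integral\<^sup>L std_normal f = (LINT x|lborel. std_normal_density x * f x)"
  using integral_density[of f lborel std_normal_density] assms
  by (simp only: measurable_lborel1 measurable_lborel2 real_scaleR_def AE_I2[OF normal_density_nonneg] borel_measurable_normal_density std_normal_def)

lemma std_normal_integrable_power: "integrable std_normal (\<lambda>x. x ^ k)"
  using integrable_std_normal_moment[of k] by (subst std_normal_integrable_iff) auto

lemma std_normal_integrable_abs: "integrable std_normal (\<lambda>x. \<bar>x\<bar>)"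
  using integrable_std_normal_moment_abs[of 1] by (subst std_normal_integrable_iff) auto

lemma std_normal_integrable_id: "integrable std_normal (\<lambda>x. x)"
  using std_normal_integrable_power[of 1] by simp

lemma std_normal_mean: "(LINT x|std_normal. x) = 0"
  using integral_std_normal_moment_odd[of 0] by (subst std_normal_integral) auto

lemma std_normal_second_moment: "(LINT x|std_normal. x\<^sup>2) = 1"
  using integral_std_normal_moment_even[of 1] by (subst std_normal_integral) auto

lemma std_normal_density_has_derivative:
  "(std_normal_density has_real_derivative - x * std_normal_density x) (at x)"
proof -
  have "((\<lambda>x. c * exp (- x\<^sup>2 / 2)) has_real_derivative - x * (c * exp (- x\<^sup>2 / 2))) (at x)" for c :: real
    by (auto intro!: derivative_eq_intros)
  from this[of "1 / sqrt (2 * pi)"] show ?thesis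
    by (simp only: std_normal_density_def[abs_def])
qed

lemma std_normal_density_tendsto_at_top: "(std_normal_density \<longlongrightarrow> 0) at_top"
proof -
  have "((\<lambda>x::real. exp (- x\<^sup>2 / 2)) \<longlongrightarrow> 0) at_top"
    by real_asymp
  from tendsto_mult_left[OF this, of "1 / sqrt (2 * pi)"] show ?thesis
    unfolding std_normal_density_def by simp
qed

lemma std_normal_density_tendsto_at_bot: "(std_normal_density \<longlongrightarrow> 0) at_bot"
proof -
  have "((\<lambda>x::real. exp (- x\<^sup>2 / 2)) \<longlongrightarrow> 0) at_bot"
    by real_asymp
  from tendsto_mult_left[OF this, of "1 / sqrt (2 * pi)"] show ?thesis
    unfolding std_normal_density_def by simp
qed

lemma integral_whole_line_FTC:
  fixes F f :: "real \<Rightarrow> real"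
  assumes F: "\<And>x. (F has_real_derivative f x) (at x)"
    and f: "\<And>x. isCont f x" and int: "integrable lborel f"
    and bot: "(F \<longlongrightarrow> a) at_bot" and top: "(F \<longlongrightarrow> b) at_top"
  shows "(LINT x|lborel. f x) = b - a"
proof -
  have "(LBINT x=-\<infinity>..\<infinity>. f x) = b - a"
    by (rule interval_integral_FTC_integrable)
       (use assms in \<open>auto simp: ereal_tendsto_simps has_real_derivative_iff_has_vector_derivative
          set_integrable_def\<close>)
  then show ?thesis
    by (simp add: interval_lebesgue_integral_def set_lebesgue_integral_def)
qed

text \<open>The density times \<open>f\<close> has as derivative the density times
  \<open>f' x - x * f x\<close>, and it vanishes at both infinities because \<open>f\<close> is
  bounded. Integrating over the line gives the identity.\<close>

lemma stein_identity_real: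
  fixes f f' :: "real \<Rightarrow> real"
  assumes f: "\<And>x. (f has_real_derivative f' x) (at x)" and f': "\<And>x. isCont f' x"
    and b: "\<And>x. \<bar>f x\<bar> \<le> K" "\<And>x. \<bar>f' x\<bar> \<le> K"
  shows "(LINT x|std_normal. x * f x) = (LINT x|std_normal. f' x)"
proof -
  interpret prob_space std_normal by (rule prob_space_std_normal)
  have cf: "isCont f x" for x using f DERIV_isCont by blast
  have [measurable]: "f \<in> borel_measurable borel" "f' \<in> borel_measurable borel"
    by (intro borel_measurable_continuous_onI continuous_at_imp_continuous_on ballI cf f')+
  have i1: "integrable std_normal (\<lambda>x. x * f x)"
  proof (rule Bochner_Integration.integrable_bound)
    show "integrable std_normal (\<lambda>x. K * \<bar>x\<bar>)"
      by (intro integrable_mult_right std_normal_integrable_abs)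
    show "AE x in std_normal. norm (x * f x) \<le> norm (K * \<bar>x\<bar>)"
    proof (rule AE_I2)
      fix x show "norm (x * f x) \<le> norm (K * \<bar>x\<bar>)"
        using mult_right_mono[OF order_trans[OF b(1) abs_ge_self], of "\<bar>x\<bar>" x] by (simp add: abs_mult mult.commute)
    qed
  qed measurable
  have i2: "integrable std_normal f'"
    by (rule integrable_const_bound[where B=K]) (simp add: b, measurable)
  let ?h = "\<lambda>x. std_normal_density x * f' x - std_normal_density x * (x * f x)"
  have i1': "integrable lborel (\<lambda>x. std_normal_density x * (x * f x))"
    using i1 by (subst (asm) std_normal_integrable_iff) simp_all
  have i2': "integrable lborel (\<lambda>x. std_normal_density x * f' x)"
    using i2 by (subst (asm) std_normal_integrable_iff) simp_all
  have lim: "((\<lambda>x. std_normal_density x * f x) \<longlongrightarrow> 0) F" if "(std_normal_density \<longlongrightarrow> 0) F" for F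
  proof (rule Lim_null_comparison[where g="\<lambda>x. K * std_normal_density x"])
    show "\<forall>\<^sub>F x in F. norm (std_normal_density x * f x) \<le> K * std_normal_density x"
      using mult_right_mono[OF b(1) normal_density_nonneg]
      by (intro always_eventually allI) (simp add: abs_mult mult.commute)
    show "((\<lambda>x. K * std_normal_density x) \<longlongrightarrow> 0) F"
      using tendsto_mult_left[OF that, of K] by simp
  qed
  have "(LINT x|lborel. ?h x) = 0 - 0"
  proof (rule integral_whole_line_FTC)
    show "((\<lambda>x. std_normal_density x * f x) has_real_derivative ?h x) (at x)" for x
      by (rule derivative_eq_intros std_normal_density_has_derivative f refl)+ (simp add: algebra_simps)
    show "isCont ?h x" for x
      using DERIV_isCont[OF std_normal_density_has_derivative] cf f' by (intro continuous_intros) auto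
  qed (use i1' i2' lim std_normal_density_tendsto_at_top std_normal_density_tendsto_at_bot in auto)
  then show ?thesis using i1' i2' by (simp add: std_normal_integral)
qed

lemma std_gauss_component:
  assumes "i \<in> I"
  shows "distr (std_gauss I) std_normal (\<lambda>\<omega>. \<omega> i) = std_normal"
  using distr_PiM_component[of I "\<lambda>_. std_normal" i] assms prob_space_std_normal by simp

lemma std_gauss_integrable_component:
  fixes g :: "real \<Rightarrow> real"
  assumes "i \<in> I" and g: "integrable std_normal g"
  shows "integrable (std_gauss I) (\<lambda>\<omega>. g (\<omega> i))"
  using g integrable_distr_eq[of "\<lambda>\<omega>. \<omega> i" "std_gauss I" std_normal g]
    measurable_component_singleton[OF assms(1), of "\<lambda>_. std_normal"]
  by (simp add: std_gauss_component[OF assms(1)] borel_measurable_integrable)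

text \<open>Fubini isolates coordinate \<open>i\<close>, and the one-dimensional identity applies
  for each value of the remaining coordinates.\<close>

lemma stein_identity_std_gauss:
  fixes f f' :: "('i \<Rightarrow> real) \<Rightarrow> real"
  assumes I: "finite I" "i \<in> I"
    and m: "f \<in> borel_measurable (std_gauss I)" "f' \<in> borel_measurable (std_gauss I)"
    and f: "\<And>\<omega> x. ((\<lambda>x. f (fun_upd \<omega> i x)) has_real_derivative f' (fun_upd \<omega> i x)) (at x)"
    and f': "\<And>\<omega> x. isCont (\<lambda>x. f' (fun_upd \<omega> i x)) x"
    and b: "\<And>\<omega>. \<bar>f \<omega>\<bar> \<le> K" "\<And>\<omega>. \<bar>f' \<omega>\<bar> \<le> K"
  shows "integrable (std_gauss I) (\<lambda>\<omega>. \<omega> i * f \<omega>)" "integrable (std_gauss I) f'"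
    "(LINT \<omega>|std_gauss I. \<omega> i * f \<omega>) = (LINT \<omega>|std_gauss I. f' \<omega>)"
proof -
  interpret product_sigma_finite "\<lambda>_::'i. std_normal" by (rule product_sigma_finite_std_normal)
  interpret N: prob_space std_normal by (rule prob_space_std_normal)
  interpret P: prob_space "std_gauss I" by (rule prob_space_std_gauss)
  have ii: "integrable (std_gauss I) (\<lambda>\<omega>. \<bar>\<omega> i\<bar>)"
    by (rule std_gauss_integrable_component[OF I(2) std_normal_integrable_abs])
  show 1: "integrable (std_gauss I) (\<lambda>\<omega>. \<omega> i * f \<omega>)"
  proof (rule Bochner_Integration.integrable_bound[where f="\<lambda>\<omega>. K * \<bar>\<omega> i\<bar>"])
    show "AE x in std_gauss I. norm (x i * f x) \<le> norm (K * \<bar>x i\<bar>)"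
    proof (rule AE_I2)
      fix x show "norm (x i * f x) \<le> norm (K * \<bar>x i\<bar>)"
        using mult_right_mono[OF order_trans[OF b(1) abs_ge_self], of "\<bar>x i\<bar>" x] by (simp add: abs_mult mult.commute)
    qed
  qed (use ii m I in auto)
  show 2: "integrable (std_gauss I) f'"
    by (rule P.integrable_const_bound[where B=K]) (use b m in auto)
  define J where "J = I - {i}"
  have J: "I = insert i J" "finite J" "i \<notin> J" using I by (auto simp: J_def)
  show "(LINT \<omega>|std_gauss I. \<omega> i * f \<omega>) = (LINT \<omega>|std_gauss I. f' \<omega>)"
    using 1 2 unfolding J(1)
    by (simp add: product_integral_insert[OF J(2,3)] stein_identity_real[OF f f' b(1) b(2)])
qed

text \<open>By the mean value inequality \<open>w\<close> dominates every difference quotient, so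
  dominated convergence applies along each sequence of increments tending to 0.\<close>

lemma has_real_derivative_integral:
  fixes f f' :: "real \<Rightarrow> 'a \<Rightarrow> real"
  assumes f: "\<And>s \<omega>. ((\<lambda>s. f s \<omega>) has_real_derivative f' s \<omega>) (at s)"
    and int: "\<And>s. integrable M (f s)"
    and meas: "f' t \<in> borel_measurable M"
    and b: "\<And>s \<omega>. \<bar>f' s \<omega>\<bar> \<le> w \<omega>" and w: "integrable M w"
  shows "((\<lambda>s. LINT \<omega>|M. f s \<omega>) has_real_derivative (LINT \<omega>|M. f' t \<omega>)) (at t)"
  unfolding DERIV_def tendsto_at_iff_sequentially
proof (intro allI impI)
  fix h :: "nat \<Rightarrow> real" assume h0: "\<forall>i. h i \<in> UNIV - {0}" and h: "h \<longlonglongrightarrow> 0"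
  have [measurable]: "f s \<in> borel_measurable M" for s using int by (rule borel_measurable_integrable)
  let ?q = "\<lambda>n \<omega>. (f (t + h n) \<omega> - f t \<omega>) / h n"
  have "(\<lambda>n. LINT \<omega>|M. ?q n \<omega>) \<longlonglongrightarrow> (LINT \<omega>|M. f' t \<omega>)"
  proof (rule integral_dominated_convergence[where w=w])
    show "AE \<omega> in M. (\<lambda>n. ?q n \<omega>) \<longlonglongrightarrow> f' t \<omega>"
    proof (rule AE_I2)
      fix \<omega>
      have "(\<lambda>h. (f (t + h) \<omega> - f t \<omega>) / h) \<midarrow>0\<rightarrow> f' t \<omega>"
        using f[of \<omega> t] unfolding DERIV_def .
      then show "(\<lambda>n. ?q n \<omega>) \<longlonglongrightarrow> f' t \<omega>"
        using h0 h unfolding tendsto_at_iff_sequentially by (auto simp: o_def)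
    qed
    show "AE \<omega> in M. norm (?q n \<omega>) \<le> w \<omega>" for n
    proof (rule AE_I2)
      fix \<omega>
      have "norm (f (t + h n) \<omega> - f t \<omega>) \<le> w \<omega> * norm (t + h n - t)"
        by (rule field_differentiable_bound[where S=UNIV])
           (use f b in \<open>auto intro: has_field_derivative_at_within\<close>)
      then show "norm (?q n \<omega>) \<le> w \<omega>" using h0 by (simp add: divide_le_eq)
    qed
  qed (use meas w in measurable)
  moreover have "(LINT \<omega>|M. ?q n \<omega>) = ((LINT \<omega>|M. f (t + h n) \<omega>) - (LINT \<omega>|M. f t \<omega>)) / h n" for n
    using int by simp
  ultimately show "((\<lambda>h. ((LINT \<omega>|M. f (t + h) \<omega>) - (LINT \<omega>|M. f t \<omega>)) / h) \<circ> h) \<longlonglongrightarrow> (LINT \<omega>|M. f' t \<omega>)"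
    by (simp only: o_def)
qed

lemma integral_nonpos:
  fixes f :: "'a \<Rightarrow> real"
  assumes "\<And>x. f x \<le> 0"
  shows "integral\<^sup>L M f \<le> 0"
  using Bochner_Integration.integral_nonneg[of M "\<lambda>x. - f x"] assms by simp

text \<open>The left-hand side is reached from the right-hand side along \<open>cos t\<close> times the first family plus \<open>sin t\<close>
  times the second. By Stein's identity the derivative of the expectation is \<open>sin t * cos t\<close> times the expectation of the
  sum of the terms in the last hypothesis.\<close>

lemma gaussian_interpolation:
  fixes c d :: "'v \<Rightarrow> 'k \<Rightarrow> real" and F :: "('v \<Rightarrow> real) \<Rightarrow> real"
    and F1 :: "'v \<Rightarrow> ('v \<Rightarrow> real) \<Rightarrow> real" and F2 :: "'v \<Rightarrow> 'v \<Rightarrow> ('v \<Rightarrow> real) \<Rightarrow> real"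
  assumes K: "finite K" and V: "finite V"
    and disj: "\<And>u v k. k \<in> K \<Longrightarrow> u \<in> V \<Longrightarrow> v \<in> V \<Longrightarrow> c u k * d v k = 0"
    and chain: "\<And>z z' t. (\<And>v. v \<in> V \<Longrightarrow> ((\<lambda>s. z s v) has_real_derivative z' v) (at t)) \<Longrightarrow>
        ((\<lambda>s. F (z s)) has_real_derivative (\<Sum>v\<in>V. F1 v (z t) * z' v)) (at t)"
    and chain1: "\<And>u z z' t. u \<in> V \<Longrightarrow> (\<And>v. v \<in> V \<Longrightarrow> ((\<lambda>s. z s v) has_real_derivative z' v) (at t)) \<Longrightarrow>
        ((\<lambda>s. F1 u (z s)) has_real_derivative (\<Sum>v\<in>V. F2 u v (z t) * z' v)) (at t)"
    and cont2: "\<And>u v z t. u \<in> V \<Longrightarrow> v \<in> V \<Longrightarrow> (\<And>w. w \<in> V \<Longrightarrow> isCont (\<lambda>s. z s w) t) \<Longrightarrow>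
        isCont (\<lambda>s::real. F2 u v (z s)) t"
    and meas: "\<And>z. (\<And>v. v \<in> V \<Longrightarrow> z v \<in> borel_measurable (std_gauss K)) \<Longrightarrow>
        (\<lambda>\<omega>. F (\<lambda>v. z v \<omega>)) \<in> borel_measurable (std_gauss K)"
      "\<And>u z. u \<in> V \<Longrightarrow> (\<And>v. v \<in> V \<Longrightarrow> z v \<in> borel_measurable (std_gauss K)) \<Longrightarrow>
        (\<lambda>\<omega>. F1 u (\<lambda>v. z v \<omega>)) \<in> borel_measurable (std_gauss K)"
      "\<And>u u' z. u \<in> V \<Longrightarrow> u' \<in> V \<Longrightarrow> (\<And>v. v \<in> V \<Longrightarrow> z v \<in> borel_measurable (std_gauss K)) \<Longrightarrow>
        (\<lambda>\<omega>. F2 u u' (\<lambda>v. z v \<omega>)) \<in> borel_measurable (std_gauss K)"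
    and b: "\<And>z. \<bar>F z\<bar> \<le> B" "\<And>u z. u \<in> V \<Longrightarrow> \<bar>F1 u z\<bar> \<le> B" "\<And>u v z. u \<in> V \<Longrightarrow> v \<in> V \<Longrightarrow> \<bar>F2 u v z\<bar> \<le> B"
    and sgn: "\<And>u v z. u \<in> V \<Longrightarrow> v \<in> V \<Longrightarrow>
        F2 u v z * ((\<Sum>k\<in>K. d u k * d v k) - (\<Sum>k\<in>K. c u k * c v k)) \<le> 0"
  shows "(LINT \<omega>|std_gauss K. F (\<lambda>v. \<Sum>k\<in>K. d v k * \<omega> k)) \<le> (LINT \<omega>|std_gauss K. F (\<lambda>v. \<Sum>k\<in>K. c v k * \<omega> k))"
proof -
  let ?M = "std_gauss K"
  interpret P: prob_space "?M" by (rule prob_space_std_gauss)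
  \<comment> \<open>\<open>a' t\<close> is the derivative of \<open>a t\<close>, so
    \<open>Z'\<close> is the velocity of the path \<open>Z\<close> joining the two families.\<close>
  define a where "a t v k = cos t * c v k + sin t * d v k" for t v k
  define a' where "a' t v k = cos t * d v k - sin t * c v k" for t v k
  define Z where "Z t \<omega> v = (\<Sum>k\<in>K. a t v k * \<omega> k)" for t \<omega> v
  define Z' where "Z' t \<omega> v = (\<Sum>k\<in>K. a' t v k * \<omega> k)" for t \<omega> v
  define H where "H t = (LINT \<omega>|?M. F (Z t \<omega>))" for t
  define D where "D t \<omega> = (\<Sum>v\<in>V. F1 v (Z t \<omega>) * Z' t \<omega> v)" for t \<omega>
  have B0: "0 \<le> B" using b(1)[of undefined] by linarith
  have mk: "(\<lambda>\<omega>. \<omega> k) \<in> borel_measurable ?M" if "k \<in> K" for k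
    using that by (rule measurable_std_gauss_component)
  have mZ: "(\<lambda>\<omega>. Z t \<omega> v) \<in> borel_measurable ?M" for t v
    unfolding Z_def by (intro borel_measurable_sum borel_measurable_times borel_measurable_const mk)
  have mZ': "(\<lambda>\<omega>. Z' t \<omega> v) \<in> borel_measurable ?M" for t v
    unfolding Z'_def by (intro borel_measurable_sum borel_measurable_times borel_measurable_const mk)
  have mF: "(\<lambda>\<omega>. F (Z t \<omega>)) \<in> borel_measurable ?M" for t
    using meas(1)[of "\<lambda>v \<omega>. Z t \<omega> v"] mZ by simp
  have mF1: "(\<lambda>\<omega>. F1 u (Z t \<omega>)) \<in> borel_measurable ?M" if "u \<in> V" for u t
    using meas(2)[of u "\<lambda>v \<omega>. Z t \<omega> v"] mZ that by simp
  have mF2: "(\<lambda>\<omega>. F2 u v (Z t \<omega>)) \<in> borel_measurable ?M" if "u \<in> V" "v \<in> V" for u v t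
    using meas(3)[of u v "\<lambda>v \<omega>. Z t \<omega> v"] mZ that by simp
  have dZ: "((\<lambda>s. Z s \<omega> v) has_real_derivative Z' t \<omega> v) (at t)" for \<omega> v t
    unfolding Z_def Z'_def a_def a'_def
    by (auto intro!: derivative_eq_intros sum.cong simp: algebra_simps)
  have a'_le: "\<bar>a' t v k\<bar> \<le> \<bar>c v k\<bar> + \<bar>d v k\<bar>" for t v k
  proof -
    have "\<bar>cos t * d v k\<bar> \<le> \<bar>d v k\<bar>" "\<bar>sin t * c v k\<bar> \<le> \<bar>c v k\<bar>"
      by (auto simp: abs_mult intro!: mult_left_le_one_le)
    then show ?thesis unfolding a'_def by linarith
  qed
  \<comment> \<open>A majorant of \<open>D t\<close> that does not depend on \<open>t\<close>, as
    needed for differentiating under the integral.\<close>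
  define W where "W \<omega> = (\<Sum>v\<in>V. B * (\<Sum>k\<in>K. (\<bar>c v k\<bar> + \<bar>d v k\<bar>) * \<bar>\<omega> k\<bar>))" for \<omega>
  have W: "integrable ?M W"
    unfolding W_def by (intro Bochner_Integration.integrable_sum integrable_mult_right
        std_gauss_integrable_component std_normal_integrable_abs)
  have DW: "\<bar>D t \<omega>\<bar> \<le> W \<omega>" for t \<omega>
    unfolding D_def W_def
  proof (rule order_trans[OF sum_abs], rule sum_mono)
    fix v assume v: "v \<in> V"
    have "\<bar>Z' t \<omega> v\<bar> \<le> (\<Sum>k\<in>K. (\<bar>c v k\<bar> + \<bar>d v k\<bar>) * \<bar>\<omega> k\<bar>)"
      unfolding Z'_def
      by (rule order_trans[OF sum_abs], rule sum_mono) (auto simp: abs_mult intro!: mult_right_mono a'_le)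
    then show "\<bar>F1 v (Z t \<omega>) * Z' t \<omega> v\<bar> \<le> B * (\<Sum>k\<in>K. (\<bar>c v k\<bar> + \<bar>d v k\<bar>) * \<bar>\<omega> k\<bar>)"
      unfolding abs_mult by (intro mult_mono b v B0) auto
  qed
  have H': "(H has_real_derivative (LINT \<omega>|?M. D t \<omega>)) (at t)" for t
    unfolding H_def
  proof (rule has_real_derivative_integral[where w=W])
    show "((\<lambda>s. F (Z s \<omega>)) has_real_derivative D s \<omega>) (at s)" for s \<omega>
      unfolding D_def by (rule chain) (rule dZ)
    show "integrable ?M (\<lambda>\<omega>. F (Z s \<omega>))" for s
      by (rule P.integrable_const_bound[where B=B]) (use b mF in auto)
    show "D t \<in> borel_measurable ?M"
      unfolding D_def[abs_def] by (intro borel_measurable_sum borel_measurable_times mF1 mZ')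
  qed (use DW W in auto)
  have stein: "integrable ?M (\<lambda>\<omega>. \<omega> k * F1 v (Z t \<omega>))"
     "integrable ?M (\<lambda>\<omega>. \<Sum>u\<in>V. F2 v u (Z t \<omega>) * a t u k)"
     "(LINT \<omega>|?M. \<omega> k * F1 v (Z t \<omega>)) = (LINT \<omega>|?M. (\<Sum>u\<in>V. F2 v u (Z t \<omega>) * a t u k))"
    if v: "v \<in> V" and k: "k \<in> K" for v k t
  proof -
    have Zu: "Z t (fun_upd \<omega> k x) u = a t u k * x + (\<Sum>j\<in>K-{k}. a t u j * \<omega> j)" for \<omega> x u
      unfolding Z_def by (subst sum.remove[OF K k]) (auto intro!: sum.cong)
    have dZu: "((\<lambda>x. Z t (fun_upd \<omega> k x) u) has_real_derivative a t u k) (at x)" for \<omega> x u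
      unfolding Zu by (auto intro!: derivative_eq_intros)
    let ?B = "B * (1 + (\<Sum>u\<in>V. \<bar>a t u k\<bar>))"
    have B1: "B \<le> ?B" using B0 by (simp add: algebra_simps sum_nonneg)
    have B2: "\<bar>\<Sum>u\<in>V. F2 v u (Z t \<omega>) * a t u k\<bar> \<le> ?B" for \<omega>
    proof -
      have "\<bar>\<Sum>u\<in>V. F2 v u (Z t \<omega>) * a t u k\<bar> \<le> (\<Sum>u\<in>V. B * \<bar>a t u k\<bar>)"
        by (rule order_trans[OF sum_abs], rule sum_mono) (auto simp: abs_mult intro!: mult_right_mono b v)
      then show ?thesis using B0 by (simp add: algebra_simps sum_distrib_left)
    qed
    note st = stein_identity_std_gauss[OF K k, of "\<lambda>\<omega>. F1 v (Z t \<omega>)" "\<lambda>\<omega>. \<Sum>u\<in>V. F2 v u (Z t \<omega>) * a t u k" ?B]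
    have m: "(\<lambda>\<omega>. \<Sum>u\<in>V. F2 v u (Z t \<omega>) * a t u k) \<in> borel_measurable ?M"
      by (intro borel_measurable_sum borel_measurable_times borel_measurable_const mF2 v)
    have d: "((\<lambda>x. F1 v (Z t (fun_upd \<omega> k x))) has_real_derivative
        (\<Sum>u\<in>V. F2 v u (Z t (fun_upd \<omega> k x)) * a t u k)) (at x)" for \<omega> x
      by (rule chain1[OF v]) (rule dZu)
    have ct: "isCont (\<lambda>x. \<Sum>u\<in>V. F2 v u (Z t (fun_upd \<omega> k x)) * a t u k) x" for \<omega> x
      by (intro continuous_intros cont2 v) (use dZu DERIV_isCont in blast)+
    show "integrable ?M (\<lambda>\<omega>. \<omega> k * F1 v (Z t \<omega>))"
     "integrable ?M (\<lambda>\<omega>. \<Sum>u\<in>V. F2 v u (Z t \<omega>) * a t u k)"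
     "(LINT \<omega>|?M. \<omega> k * F1 v (Z t \<omega>)) = (LINT \<omega>|?M. (\<Sum>u\<in>V. F2 v u (Z t \<omega>) * a t u k))"
      by (rule st[OF mF1[OF v] m d ct order_trans[OF b(2)[OF v] B1] B2])+
  qed
  \<comment> \<open>By \<open>disj\<close> the two families use disjoint coordinates, so the cross
    terms vanish. Velocity and position are then correlated only through the difference of the two
    covariances.\<close>
  have cov: "(\<Sum>k\<in>K. a' t v k * a t u k) =
      sin t * cos t * ((\<Sum>k\<in>K. d v k * d u k) - (\<Sum>k\<in>K. c v k * c u k))" if "u \<in> V" "v \<in> V" for u v t
  proof -
    have "a' t v k * a t u k = sin t * cos t * (d v k * d u k - c v k * c u k)" if "k \<in> K" for k
    proof -
      have "a' t v k * a t u k = sin t * cos t * (d v k * d u k - c v k * c u k)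
          + (cos t)\<^sup>2 * (c u k * d v k) - (sin t)\<^sup>2 * (c v k * d u k)"
        unfolding a_def a'_def by (simp add: algebra_simps power2_eq_square)
      also have "c u k * d v k = 0" by (rule disj[OF that \<open>u \<in> V\<close> \<open>v \<in> V\<close>])
      also have "c v k * d u k = 0" by (rule disj[OF that \<open>v \<in> V\<close> \<open>u \<in> V\<close>])
      finally show ?thesis by simp
    qed
    then have "(\<Sum>k\<in>K. a' t v k * a t u k) = (\<Sum>k\<in>K. sin t * cos t * (d v k * d u k - c v k * c u k))"
      by (rule sum.cong[OF refl])
    then show ?thesis by (simp only: sum_distrib_left[symmetric] sum_subtractf)
  qed
  have D_le: "(LINT \<omega>|?M. D t \<omega>) \<le> 0" if t: "0 \<le> t" "t \<le> pi/2" for t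
  proof -
    have "D t \<omega> = (\<Sum>v\<in>V. \<Sum>k\<in>K. a' t v k * (\<omega> k * F1 v (Z t \<omega>)))" for \<omega>
      unfolding D_def Z'_def by (simp add: sum_distrib_left algebra_simps)
    then have "(LINT \<omega>|?M. D t \<omega>) =
        (\<Sum>v\<in>V. \<Sum>k\<in>K. a' t v k * (LINT \<omega>|?M. \<omega> k * F1 v (Z t \<omega>)))"
      by (simp add: stein)
    also have "\<dots> = (\<Sum>v\<in>V. \<Sum>k\<in>K. a' t v k * (LINT \<omega>|?M. (\<Sum>u\<in>V. F2 v u (Z t \<omega>) * a t u k)))"
      by (intro sum.cong refl) (simp add: stein(3))
    also have "\<dots> = (LINT \<omega>|?M. (\<Sum>v\<in>V. \<Sum>k\<in>K. a' t v k * (\<Sum>u\<in>V. F2 v u (Z t \<omega>) * a t u k)))"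
      by (simp add: stein)
    also have "\<dots> = (LINT \<omega>|?M. (\<Sum>v\<in>V. \<Sum>u\<in>V. F2 v u (Z t \<omega>) * (\<Sum>k\<in>K. a' t v k * a t u k)))"
      unfolding sum_distrib_left by (subst sum.swap[of _ K]) (simp add: mult_ac)
    also have "\<dots> \<le> 0"
    proof (rule integral_nonpos, intro sum_nonpos)
      fix \<omega> u v assume "u \<in> V" "v \<in> V"
      then have "F2 v u (Z t \<omega>) * (\<Sum>k\<in>K. a' t v k * a t u k) =
          (sin t * cos t) * (F2 v u (Z t \<omega>) * ((\<Sum>k\<in>K. d v k * d u k) - (\<Sum>k\<in>K. c v k * c u k)))"
        by (simp add: cov)
      moreover have "0 \<le> sin t" "0 \<le> cos t" using t by (auto intro!: sin_ge_zero cos_ge_zero)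
      ultimately show "F2 v u (Z t \<omega>) * (\<Sum>k\<in>K. a' t v k * a t u k) \<le> 0"
        using sgn[OF \<open>v \<in> V\<close> \<open>u \<in> V\<close>, of "Z t \<omega>"] by (simp only: mult_nonneg_nonpos mult_nonneg_nonneg)
    qed
    finally show ?thesis .
  qed
  have "H (pi/2) \<le> H 0"
    by (rule DERIV_nonpos_imp_nonincreasing) (use H' D_le in auto)
  then show ?thesis by (simp add: H_def Z_def[abs_def] a_def)
qed

section \<open>Gordon's comparison inequality\<close>

text \<open>For large \<open>M\<close>, \<open>N\<close> and a steep sigmoid \<open>g\<close> the integrand approximates the indicator of
  the event that every \<open>p\<close> has a positive entry \<open>(p, q)\<close>. Its mixed second derivatives are nonnegative for
  distinct \<open>p\<close>; for equal \<open>p\<close> their sign is irrelevant because the covariances agree.\<close>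

lemma gordon_comparison_smooth:
  fixes c d :: "'p \<times> 'q \<Rightarrow> 'k \<Rightarrow> real" and g g' g'' :: "real \<Rightarrow> real"
  assumes fin: "finite K" "finite P" "finite Q"
    and disj: "\<And>u v k. k \<in> K \<Longrightarrow> c u k * d v k = 0"
    and cov_eq: "\<And>p q q'. p \<in> P \<Longrightarrow> q \<in> Q \<Longrightarrow> q' \<in> Q \<Longrightarrow>
        (\<Sum>k\<in>K. d (p,q) k * d (p,q') k) = (\<Sum>k\<in>K. c (p,q) k * c (p,q') k)"
    and cov_le: "\<And>p p' q q'. p \<in> P \<Longrightarrow> p' \<in> P \<Longrightarrow> q \<in> Q \<Longrightarrow> q' \<in> Q \<Longrightarrow>
        (\<Sum>k\<in>K. d (p,q) k * d (p',q') k) \<le> (\<Sum>k\<in>K. c (p,q) k * c (p',q') k)"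
    and g: "\<And>x. (g has_real_derivative g' x) (at x)" and g': "\<And>x. (g' has_real_derivative g'' x) (at x)"
    and g'': "\<And>x. isCont g'' x"
    and gb: "\<And>x. 0 \<le> g x" "\<And>x. 0 \<le> g' x" "\<And>x. g' x \<le> B" "\<And>x. \<bar>g'' x\<bar> \<le> B"
    and MN: "0 \<le> M" "0 \<le> N"
  shows "(LINT \<omega>|std_gauss K. exp (- M * (\<Sum>p\<in>P. exp (- N * (\<Sum>q\<in>Q. g (\<Sum>k\<in>K. d (p,q) k * \<omega> k))))))
       \<le> (LINT \<omega>|std_gauss K. exp (- M * (\<Sum>p\<in>P. exp (- N * (\<Sum>q\<in>Q. g (\<Sum>k\<in>K. c (p,q) k * \<omega> k))))))"
proof -
  let ?M = "std_gauss K"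
  define E where "E p z = exp (- N * (\<Sum>q\<in>Q. g (z (p,q))))" for p and z :: "'p \<times> 'q \<Rightarrow> real"
  define F where "F z = exp (- M * (\<Sum>p\<in>P. E p z))" for z
  define F1 where "F1 v z = F z * (M * N * (E (fst v) z * g' (z v)))" for v z
  \<comment> \<open>The three summands come from differentiating, in \<open>F1 u\<close>, the factor
    \<open>F\<close>, the factor \<open>E\<close> of the row \<open>fst u\<close>, and
    \<open>g'\<close>. For different rows only the first survives, a product of nonnegative
    factors.\<close>
  define F2 where "F2 u v z = F z * (M * N * (E (fst v) z * g' (z v))) * (M * N * (E (fst u) z * g' (z u)))
     - (if fst u = fst v then F z * (M * N * (N * E (fst u) z * g' (z v) * g' (z u))) else 0)
     + (if u = v then F z * (M * N * (E (fst u) z * g'' (z u))) else 0)" for u v z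
  have B0: "0 \<le> B" using gb(2,3)[of 0] by linarith
  have E0: "0 \<le> E p z" "E p z \<le> 1" for p z
    unfolding E_def using MN gb by (auto intro!: mult_nonneg_nonneg sum_nonneg)
  have F0: "0 \<le> F z" "F z \<le> 1" for z
    unfolding F_def using MN E0 by (auto intro!: mult_nonneg_nonneg sum_nonneg)
  have g'b: "\<bar>g' x\<bar> \<le> B" for x using gb(2,3)[of x] by simp
  have mle: "\<bar>a * b\<bar> \<le> b'" if "0 \<le> a" "a \<le> 1" "\<bar>b\<bar> \<le> b'" for a b b' :: real
    using mult_mono[of a 1 "\<bar>b\<bar>" b'] that by (simp add: abs_mult)
  have Egb: "\<bar>M * N * (E p z * g' x)\<bar> \<le> M * N * B" for p z x
    using mle[OF E0 g'b] MN by (auto simp: abs_mult intro!: mult_mono mult_nonneg_nonneg)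
  have Egb'': "\<bar>M * N * (E p z * g'' x)\<bar> \<le> M * N * B" for p z x
    using mle[OF E0 gb(4)] MN by (auto simp: abs_mult intro!: mult_mono mult_nonneg_nonneg)
  have Egg: "\<bar>M * N * (N * E p z * g' y * g' x)\<bar> \<le> M * N * (N * B * B)" for p z x y
  proof -
    have "\<bar>E p z * g' y\<bar> \<le> B" by (rule mle[OF E0 g'b])
    then show ?thesis using MN B0 g'b E0
      unfolding abs_mult by (intro mult_mono mult_nonneg_nonneg) (auto intro: order_trans[OF mult_left_le])
  qed
  \<comment> \<open>A common bound: the summand 1 serves \<open>F\<close>, the others serve
    \<open>F1\<close> and the three summands of \<open>F2\<close>.\<close>
  define BB where "BB = 1 + M * N * B + (M * N * B) * (M * N * B) + M * N * (N * B * B)"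
  have BBpos: "0 \<le> M * N * B" "0 \<le> (M * N * B) * (M * N * B)" "0 \<le> M * N * (N * B * B)"
    using MN B0 by auto
  have b1: "\<bar>F1 v z\<bar> \<le> BB" for v z
  proof -
    have "\<bar>F1 v z\<bar> \<le> M * N * B" unfolding F1_def by (rule mle[OF F0 Egb])
    then show ?thesis using BBpos unfolding BB_def by linarith
  qed
  have b2: "\<bar>F2 u v z\<bar> \<le> BB" for u v z
  proof -
    have 1: "\<bar>F z * (M * N * (E (fst v) z * g' (z v))) * (M * N * (E (fst u) z * g' (z u)))\<bar> \<le> (M * N * B) * (M * N * B)"
      unfolding abs_mult[of "F z * _"] by (intro mult_mono mle[OF F0 Egb] Egb BBpos abs_ge_zero)
    have 2: "\<bar>if fst u = fst v then F z * (M * N * (N * E (fst u) z * g' (z v) * g' (z u))) else 0\<bar> \<le> M * N * (N * B * B)"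
      using mle[OF F0 Egg] BBpos by auto
    have 3: "\<bar>if u = v then F z * (M * N * (E (fst u) z * g'' (z u))) else 0\<bar> \<le> M * N * B"
      using mle[OF F0 Egb''] BBpos by auto
    show ?thesis using 1 2 3 unfolding F2_def BB_def by linarith
  qed
  have gc: "isCont g x" "isCont g' x" for x using g g' DERIV_isCont by blast+
  have mg: "g \<in> borel_measurable borel" "g' \<in> borel_measurable borel" "g'' \<in> borel_measurable borel"
    using gc g'' by (auto intro!: borel_measurable_continuous_onI continuous_at_imp_continuous_on)
  have dE: "((\<lambda>s. E p (z s)) has_real_derivative (\<Sum>q\<in>Q. - (N * E p (z t) * g' (z t (p,q))) * z' (p,q))) (at t)"
    if p: "p \<in> P" and z: "\<And>v. v \<in> P \<times> Q \<Longrightarrow> ((\<lambda>s. z s v) has_real_derivative z' v) (at t)"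
    for z z' t p
  proof -
    have "((\<lambda>s. g (z s (p,q))) has_real_derivative g' (z t (p,q)) * z' (p,q)) (at t)" if "q \<in> Q" for q
      by (rule DERIV_chain2[OF g z]) (use p that in auto)
    then have "((\<lambda>s. E p (z s)) has_real_derivative E p (z t) * (- N * (\<Sum>q\<in>Q. g' (z t (p,q)) * z' (p,q)))) (at t)"
      unfolding E_def by (intro DERIV_fun_exp DERIV_cmult DERIV_sum)
    then show ?thesis by (simp add: sum_distrib_left sum_negf algebra_simps)
  qed
  have dF: "((\<lambda>s. F (z s)) has_real_derivative (\<Sum>v\<in>P\<times>Q. F1 v (z t) * z' v)) (at t)"
    if z: "\<And>v. v \<in> P \<times> Q \<Longrightarrow> ((\<lambda>s. z s v) has_real_derivative z' v) (at t)" for z z' t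
  proof -
    have "((\<lambda>s. F (z s)) has_real_derivative
       F (z t) * (- M * (\<Sum>p\<in>P. \<Sum>q\<in>Q. - (N * E p (z t) * g' (z t (p,q))) * z' (p,q)))) (at t)"
      unfolding F_def by (intro DERIV_fun_exp DERIV_cmult DERIV_sum dE z)
    moreover have "F (z t) * (- M * (\<Sum>p\<in>P. \<Sum>q\<in>Q. - (N * E p (z t) * g' (z t (p,q))) * z' (p,q)))
        = (\<Sum>v\<in>P\<times>Q. F1 v (z t) * z' v)"
      unfolding sum.cartesian_product sum_distrib_left
      by (intro sum.cong refl) (auto simp: F1_def)
    ultimately show ?thesis by simp
  qed
  have dF1: "((\<lambda>s. F1 u (z s)) has_real_derivative (\<Sum>v\<in>P\<times>Q. F2 u v (z t) * z' v)) (at t)"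
    if u: "u \<in> P \<times> Q" and z: "\<And>v. v \<in> P \<times> Q \<Longrightarrow> ((\<lambda>s. z s v) has_real_derivative z' v) (at t)" for u z z' t
  proof -
    obtain p q where pq: "u = (p,q)" "p \<in> P" "q \<in> Q" using u by auto
    have cart: "(\<Sum>v\<in>P\<times>Q. h v) = (\<Sum>p'\<in>P. \<Sum>q'\<in>Q. h (p',q'))" for h :: "'p \<times> 'q \<Rightarrow> real"
      by (simp add: sum.cartesian_product split_def)
    let ?T = "M * N * (E p (z t) * g' (z t u))"
    let ?dE = "\<Sum>q\<in>Q. - (N * E p (z t) * g' (z t (p,q))) * z' (p,q)"
    have "((\<lambda>s. F (z s) * (M * N * (E p (z s) * g' (z s u)))) has_real_derivative
        (\<Sum>v\<in>P\<times>Q. F1 v (z t) * z' v) * ?T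
        + F (z t) * (M * N * (?dE * g' (z t u) + E p (z t) * (g'' (z t u) * z' u)))) (at t)"
      by (rule derivative_eq_intros dF dE[OF pq(2)] DERIV_chain2[OF g'] z u refl | assumption)+ (simp add: algebra_simps)
    moreover have "(\<Sum>v\<in>P\<times>Q. F2 u v (z t) * z' v) = (\<Sum>v\<in>P\<times>Q. F1 v (z t) * z' v) * ?T
        + F (z t) * (M * N * (?dE * g' (z t u) + E p (z t) * (g'' (z t u) * z' u)))"
    proof -
      have "(\<Sum>v\<in>P\<times>Q. F2 u v (z t) * z' v) = (\<Sum>v\<in>P\<times>Q. F1 v (z t) * z' v * ?T)
        - (\<Sum>v\<in>P\<times>Q. if p = fst v then F (z t) * (M * N * (N * E p (z t) * g' (z t v) * g' (z t u))) * z' v else 0)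
        + (\<Sum>v\<in>P\<times>Q. if u = v then F (z t) * (M * N * (E p (z t) * g'' (z t u))) * z' v else 0)"
        unfolding sum_subtractf[symmetric] sum.distrib[symmetric]
        by (intro sum.cong refl) (auto simp: F2_def F1_def pq algebra_simps)
      also have "(\<Sum>v\<in>P\<times>Q. if u = v then F (z t) * (M * N * (E p (z t) * g'' (z t u))) * z' v else 0) =
          F (z t) * (M * N * (E p (z t) * g'' (z t u))) * z' u"
        using u fin by (subst sum.delta') auto
      also have "(\<Sum>v\<in>P\<times>Q. if p = fst v then F (z t) * (M * N * (N * E p (z t) * g' (z t v) * g' (z t u))) * z' v else 0)
         = (\<Sum>p'\<in>P. if p = p' then \<Sum>q'\<in>Q. F (z t) * (M * N * (N * E p (z t) * g' (z t (p',q')) * g' (z t u))) * z' (p',q') else 0)"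
        unfolding cart by (intro sum.cong refl) auto
      also have "\<dots> = (\<Sum>q'\<in>Q. F (z t) * (M * N * (N * E p (z t) * g' (z t (p,q')) * g' (z t u))) * z' (p,q'))"
        using pq fin by (subst sum.delta') auto
      finally show ?thesis
        by (simp add: sum_distrib_left sum_distrib_right sum_negf algebra_simps)
    qed
    ultimately show ?thesis by (simp add: F1_def pq)
  qed
  have "(LINT \<omega>|?M. F (\<lambda>v. \<Sum>k\<in>K. d v k * \<omega> k)) \<le> (LINT \<omega>|?M. F (\<lambda>v. \<Sum>k\<in>K. c v k * \<omega> k))"
  proof (rule gaussian_interpolation[where V="P\<times>Q" and ?F1.0=F1 and ?F2.0=F2 and B=BB])
    show "\<bar>F z\<bar> \<le> BB" for z using F0[of z] BBpos unfolding BB_def by linarith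
    have cE: "isCont (\<lambda>s. E p (z s)) t" if "p \<in> P" "\<And>w. w \<in> P \<times> Q \<Longrightarrow> isCont (\<lambda>s. z s w) t"
      for p t and z :: "real \<Rightarrow> 'p \<times> 'q \<Rightarrow> real"
      unfolding E_def using that by (intro continuous_intros isCont_o2[OF _ gc(1)]) auto
    show "isCont (\<lambda>s. F2 u v (z s)) t"
      if u: "u \<in> P \<times> Q" and v: "v \<in> P \<times> Q" and w: "\<And>w. w \<in> P \<times> Q \<Longrightarrow> isCont (\<lambda>s. z s w) t"
      for u v t and z :: "real \<Rightarrow> 'p \<times> 'q \<Rightarrow> real"
    proof -
      have cF: "isCont (\<lambda>s. F (z s)) t"
        unfolding F_def by (intro continuous_intros cE w)
      note [continuous_intros] = cF cE[OF _ w] isCont_o2[OF _ gc(2)] isCont_o2[OF _ g'']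
      have "fst u \<in> P" "fst v \<in> P" using u v by auto
      then show ?thesis
        unfolding F2_def using u v w
        by (cases "fst u = fst v"; cases "u = v") (auto intro!: continuous_intros)
    qed
    have mE: "(\<lambda>\<omega>. E p (\<lambda>v. z v \<omega>)) \<in> borel_measurable ?M"
      if "p \<in> P" and z: "\<And>v. v \<in> P \<times> Q \<Longrightarrow> z v \<in> borel_measurable ?M" for p z
      unfolding E_def using that
      by (intro borel_measurable_exp[THEN measurable_compose[rotated]] borel_measurable_times borel_measurable_const
          borel_measurable_sum measurable_compose[OF _ mg(1)] z) auto
    show mF: "(\<lambda>\<omega>. F (\<lambda>v. z v \<omega>)) \<in> borel_measurable ?M"
      if z: "\<And>v. v \<in> P \<times> Q \<Longrightarrow> z v \<in> borel_measurable ?M" for z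
      unfolding F_def
      by (intro borel_measurable_exp[THEN measurable_compose[rotated]] borel_measurable_times borel_measurable_const
          borel_measurable_sum mE z)
    show "(\<lambda>\<omega>. F1 u (\<lambda>v. z v \<omega>)) \<in> borel_measurable ?M"
      if u: "u \<in> P \<times> Q" and z: "\<And>v. v \<in> P \<times> Q \<Longrightarrow> z v \<in> borel_measurable ?M" for u z
      unfolding F1_def
      by (intro borel_measurable_times borel_measurable_const mE mF measurable_compose[OF _ mg(2)] z)
        (use u in auto)
    show "(\<lambda>\<omega>. F2 u u' (\<lambda>v. z v \<omega>)) \<in> borel_measurable ?M"
      if u: "u \<in> P \<times> Q" "u' \<in> P \<times> Q" and z: "\<And>v. v \<in> P \<times> Q \<Longrightarrow> z v \<in> borel_measurable ?M" for u u' z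
    proof -
      have "fst u \<in> P" "fst u' \<in> P" using u by auto
      note [measurable] = mE[OF this(1) z] mE[OF this(2) z] mF[OF z] measurable_compose[OF z mg(2)]
         measurable_compose[OF z mg(3)]
      show ?thesis unfolding F2_def using u by measurable
    qed
    show "F2 u v z * ((\<Sum>k\<in>K. d u k * d v k) - (\<Sum>k\<in>K. c u k * c v k)) \<le> 0"
      if u: "u \<in> P \<times> Q" "v \<in> P \<times> Q" for u v z
    proof (cases "fst u = fst v")
      case True
      then show ?thesis using cov_eq u by (cases u; cases v) simp
    next
      case False
      then have "F2 u v z = F z * (M * N * (E (fst v) z * g' (z v))) * (M * N * (E (fst u) z * g' (z u)))"
        unfolding F2_def by auto
      then have "0 \<le> F2 u v z" using F0 E0 MN gb by simp
      moreover have "(\<Sum>k\<in>K. d u k * d v k) - (\<Sum>k\<in>K. c u k * c v k) \<le> 0"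
        using cov_le u by (cases u; cases v) simp
      ultimately show ?thesis by (rule mult_nonneg_nonpos)
    qed
  qed (use fin disj dF dF1 b1 b2 in auto)
  then show ?thesis unfolding F_def E_def .
qed

section \<open>From smooth functions to probabilities of events\<close>

definition logistic :: "real \<Rightarrow> real" where
  "logistic x = 1 / (1 + exp (- x))"

lemma logistic_bounds: "0 < logistic x" "logistic x < 1"
  by (auto simp: logistic_def divide_simps add_pos_pos)

lemma logistic_mono: "x \<le> y \<Longrightarrow> logistic x \<le> logistic y"
  by (auto simp: logistic_def intro!: divide_left_mono add_pos_pos mult_pos_pos)

lemma logistic_has_derivative:
  "(logistic has_real_derivative logistic x * (1 - logistic x)) (at x)"
proof -
  have "1 + exp (- x) \<noteq> 0" by (smt (verit) exp_gt_zero)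
  then show ?thesis
    unfolding logistic_def by (auto intro!: derivative_eq_intros simp: field_simps)
qed

text \<open>The smooth inequality is used with \<open>g x = logistic (n * x)\<close> and
  \<open>M = N = n\<close>, and \<open>n\<close> tends to infinity. On the event of the left side
  the integrand for \<open>c\<close> is at most \<open>r n\<close>, which tends to 0; off the event
  of the right side the integrand for \<open>d\<close> is at least \<open>s n\<close>, which tends
  to 1. The margin \<delta> keeps the entries away from the jump of the limiting step at 0.\<close>

lemma gordon_comparison:
  fixes c d :: "'p \<times> 'q \<Rightarrow> 'k \<Rightarrow> real"
  assumes fin: "finite K" "finite P" "finite Q"
    and disj: "\<And>u v k. k \<in> K \<Longrightarrow> c u k * d v k = 0"
    and cov_eq: "\<And>p q q'. p \<in> P \<Longrightarrow> q \<in> Q \<Longrightarrow> q' \<in> Q \<Longrightarrow>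
        (\<Sum>k\<in>K. d (p,q) k * d (p,q') k) = (\<Sum>k\<in>K. c (p,q) k * c (p,q') k)"
    and cov_le: "\<And>p p' q q'. p \<in> P \<Longrightarrow> p' \<in> P \<Longrightarrow> q \<in> Q \<Longrightarrow> q' \<in> Q \<Longrightarrow>
        (\<Sum>k\<in>K. d (p,q) k * d (p',q') k) \<le> (\<Sum>k\<in>K. c (p,q) k * c (p',q') k)"
    and \<delta>: "0 < \<delta>"
  shows "measure (std_gauss K) {\<omega> \<in> space (std_gauss K). \<exists>p\<in>P. \<forall>q\<in>Q. (\<Sum>k\<in>K. c (p,q) k * \<omega> k) \<le> - \<delta>}
       \<le> measure (std_gauss K) {\<omega> \<in> space (std_gauss K). \<exists>p\<in>P. \<forall>q\<in>Q. (\<Sum>k\<in>K. d (p,q) k * \<omega> k) < \<delta>}"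
    (is "measure _ ?A \<le> measure _ ?B")
proof -
  let ?M = "std_gauss K"
  interpret P: prob_space "?M" by (rule prob_space_std_gauss)
  have mk: "(\<lambda>\<omega>. \<omega> k) \<in> borel_measurable ?M" if "k \<in> K" for k
    using that by (rule measurable_std_gauss_component)
  have mX [measurable]: "(\<lambda>\<omega>. \<Sum>k\<in>K. a v k * \<omega> k) \<in> borel_measurable ?M" for v and a :: "'p \<times> 'q \<Rightarrow> 'k \<Rightarrow> real"
    by (intro borel_measurable_sum borel_measurable_times borel_measurable_const mk)
  have ml [measurable]: "logistic \<in> borel_measurable borel"
    unfolding logistic_def[abs_def] by measurable
  have mA: "?A \<in> sets ?M" and mB: "?B \<in> sets ?M"
    using fin by measurable
  define r s where "r n = exp (- real n * exp (- real n * (real (card Q) * logistic (- real n * \<delta>))))"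
    and "s n = exp (- real n * (real (card P) * exp (- real n * logistic (real n * \<delta>))))" for n :: nat
  have ineq: "s n * (1 - measure ?M ?B) \<le> r n + (1 - measure ?M ?A)" for n
  proof -
    define \<Phi> where "\<Phi> a \<omega> = exp (- real n * (\<Sum>p\<in>P. exp (- real n * (\<Sum>q\<in>Q. logistic (real n * (\<Sum>k\<in>K. a (p,q) k * \<omega> k))))))"
      for a :: "'p \<times> 'q \<Rightarrow> 'k \<Rightarrow> real" and \<omega>
    have \<Phi>1: "0 \<le> \<Phi> a \<omega>" "\<Phi> a \<omega> \<le> 1" for a \<omega>
      unfolding \<Phi>_def by (auto intro!: mult_nonneg_nonneg sum_nonneg)
    have m\<Phi>: "\<Phi> a \<in> borel_measurable ?M" for a
      unfolding \<Phi>_def[abs_def] by measurable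
    have i\<Phi>: "integrable ?M (\<Phi> a)" for a
      by (rule P.integrable_const_bound[where B=1]) (use \<Phi>1 m\<Phi> in auto)
    have "(LINT \<omega>|?M. \<Phi> d \<omega>) \<le> (LINT \<omega>|?M. \<Phi> c \<omega>)"
      unfolding \<Phi>_def
    \<comment> \<open>The scaled sigmoid has first derivative at most \<open>n\<close> and second
      derivative at most \<open>n * n\<close> in absolute value; the sum bounds both.\<close>
    proof (rule gordon_comparison_smooth[where c=c and d=d and B="real n * real n + real n"
          and g = "\<lambda>x. logistic (real n * x)", OF fin disj cov_eq cov_le])
      let ?l = "\<lambda>x. logistic (real n * x)"
      show dl: "(?l has_real_derivative real n * (?l x * (1 - ?l x))) (at x)" for x
        using DERIV_chain2[of logistic _ "\<lambda>x. real n * x" x "real n" UNIV, OF logistic_has_derivative DERIV_cmult_Id]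
        by (simp add: mult_ac)
      show "((\<lambda>x. real n * (?l x * (1 - ?l x))) has_real_derivative
          real n * (real n * (?l x * (1 - ?l x)) * (1 - 2 * ?l x))) (at x)" for x
        by (rule derivative_eq_intros dl refl)+ (simp add: algebra_simps)
      have cl: "isCont ?l x" for x by (rule DERIV_isCont[OF dl])
      show "isCont (\<lambda>x. real n * (real n * (?l x * (1 - ?l x)) * (1 - 2 * ?l x))) x" for x
        by (intro continuous_intros cl)
      fix x
      have l: "0 \<le> ?l x" "?l x \<le> 1" using logistic_bounds[of "real n * x"] by auto
      show "0 \<le> ?l x" by (rule l)
      have l2: "0 \<le> ?l x * (1 - ?l x)" "?l x * (1 - ?l x) \<le> 1"
        using l by (auto intro: mult_le_one)
      then show "0 \<le> real n * (?l x * (1 - ?l x))" by simp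
      have "real n * (?l x * (1 - ?l x)) \<le> real n * 1" using l2 by (intro mult_left_mono) auto
      then show "real n * (?l x * (1 - ?l x)) \<le> real n * real n + real n"
        using zero_le_square[of "real n"] by linarith
      have "\<bar>?l x * (1 - ?l x)\<bar> * \<bar>1 - 2 * ?l x\<bar> \<le> 1" using l l2 by (intro mult_le_one) auto
      then have "real n * real n * (\<bar>?l x * (1 - ?l x)\<bar> * \<bar>1 - 2 * ?l x\<bar>) \<le> real n * real n * 1"
        by (intro mult_left_mono) auto
      then show "\<bar>real n * (real n * (?l x * (1 - ?l x)) * (1 - 2 * ?l x))\<bar> \<le> real n * real n + real n"
        by (simp add: abs_mult mult.assoc)
    qed auto
    moreover have "(LINT \<omega>|?M. \<Phi> c \<omega>) \<le> r n + (1 - measure ?M ?A)"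
    proof -
      have "\<Phi> c \<omega> \<le> r n + indicator (space ?M - ?A) \<omega>" if \<omega>: "\<omega> \<in> space ?M" for \<omega>
      proof (cases "\<omega> \<in> ?A")
        case True
        then obtain p where p: "p \<in> P" "\<And>q. q \<in> Q \<Longrightarrow> (\<Sum>k\<in>K. c (p,q) k * \<omega> k) \<le> - \<delta>" by auto
        have "(\<Sum>q\<in>Q. logistic (real n * (\<Sum>k\<in>K. c (p,q) k * \<omega> k))) \<le> (\<Sum>q\<in>Q. logistic (- real n * \<delta>))"
          by (intro sum_mono logistic_mono) (use p mult_left_mono[of _ "- \<delta>" "real n"] in auto)
        then have "exp (- real n * (real (card Q) * logistic (- real n * \<delta>)))
          \<le> exp (- real n * (\<Sum>q\<in>Q. logistic (real n * (\<Sum>k\<in>K. c (p,q) k * \<omega> k))))"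
          by (auto intro!: mult_left_mono)
        also have "\<dots> \<le> (\<Sum>p\<in>P. exp (- real n * (\<Sum>q\<in>Q. logistic (real n * (\<Sum>k\<in>K. c (p,q) k * \<omega> k)))))"
          by (rule member_le_sum) (use p fin in auto)
        finally have "\<Phi> c \<omega> \<le> r n" unfolding \<Phi>_def r_def by (auto intro!: mult_left_mono)
        then show ?thesis by (auto simp: indicator_def)
      next
        case False
        have "0 \<le> r n" unfolding r_def by simp
        then show ?thesis using False \<omega> \<Phi>1[of c \<omega>] by (auto simp: indicator_def)
      qed
      then have "(LINT \<omega>|?M. \<Phi> c \<omega>) \<le> (LINT \<omega>|?M. r n + indicator (space ?M - ?A) \<omega>)"
        by (intro integral_mono i\<Phi> Bochner_Integration.integrable_add P.integrable_const integrable_real_indicator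
            sets.compl_sets mA)
           (auto simp: P.emeasure_eq_measure)
      also have "\<dots> = r n + measure ?M (space ?M - ?A)"
        using mA by (subst Bochner_Integration.integral_add) (auto simp: P.emeasure_eq_measure P.prob_space)
      finally show ?thesis using P.prob_compl[OF mA] by simp
    qed
    moreover have "s n * (1 - measure ?M ?B) \<le> (LINT \<omega>|?M. \<Phi> d \<omega>)"
    proof -
      have "s n * indicator (space ?M - ?B) \<omega> \<le> \<Phi> d \<omega>" if \<omega>: "\<omega> \<in> space ?M" for \<omega>
      proof (cases "\<omega> \<in> ?B")
        case False
        have "exp (- real n * (\<Sum>q\<in>Q. logistic (real n * (\<Sum>k\<in>K. d (p,q) k * \<omega> k)))) \<le> exp (- real n * logistic (real n * \<delta>))"
          if p: "p \<in> P" for p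
        proof -
          obtain q where q: "q \<in> Q" "\<delta> \<le> (\<Sum>k\<in>K. d (p,q) k * \<omega> k)" using False \<omega> p by (auto simp: not_less)
          have "logistic (real n * \<delta>) \<le> logistic (real n * (\<Sum>k\<in>K. d (p,q) k * \<omega> k))"
            by (intro logistic_mono mult_left_mono q) auto
          also have "\<dots> \<le> (\<Sum>q\<in>Q. logistic (real n * (\<Sum>k\<in>K. d (p,q) k * \<omega> k)))"
            by (rule member_le_sum[of q Q "\<lambda>q. logistic (real n * (\<Sum>k\<in>K. d (p,q) k * \<omega> k))"])
               (use q fin logistic_bounds in \<open>auto intro: less_imp_le\<close>)
          finally show ?thesis by (auto intro!: mult_left_mono)
        qed
        then have "(\<Sum>p\<in>P. exp (- real n * (\<Sum>q\<in>Q. logistic (real n * (\<Sum>k\<in>K. d (p,q) k * \<omega> k)))))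
            \<le> (\<Sum>p\<in>P. exp (- real n * logistic (real n * \<delta>)))"
          by (rule sum_mono)
        then have "s n \<le> \<Phi> d \<omega>" unfolding s_def \<Phi>_def by (auto intro!: mult_left_mono)
        then show ?thesis using \<Phi>1(1)[of d \<omega>] by (auto simp: indicator_def)
      qed (use \<Phi>1 in auto)
      then have "(LINT \<omega>|?M. s n * indicator (space ?M - ?B) \<omega>) \<le> (LINT \<omega>|?M. \<Phi> d \<omega>)"
        by (intro integral_mono i\<Phi> integrable_mult_right integrable_real_indicator sets.compl_sets mB)
           (auto simp: P.emeasure_eq_measure)
      moreover have "(LINT \<omega>|?M. s n * indicator (space ?M - ?B) \<omega>) = s n * measure ?M (space ?M - ?B)"
        by (simp add: Int_absorb2 Diff_subset)
      ultimately show ?thesis by (simp only: P.prob_compl[OF mB])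
    qed
    ultimately show ?thesis by linarith
  qed
  \<comment> \<open>The sigmoid decays exponentially at \<open>- n * \<delta>\<close> and tends to 1
    at \<open>n * \<delta>\<close>. The first limit sends the inner exponential of
    \<open>r n\<close> to 1, so the factor \<open>n\<close> drives the outer exponent to minus
    infinity; the second sends the exponent of \<open>s n\<close> to 0.\<close>
  have lim1: "(\<lambda>n::nat. real n * logistic (- real n * \<delta>)) \<longlonglongrightarrow> 0"
    unfolding logistic_def using \<delta> by real_asymp
  have lim2: "(\<lambda>n::nat. real n * exp (- real n * logistic (real n * \<delta>))) \<longlonglongrightarrow> 0"
    unfolding logistic_def using \<delta> by real_asymp
  have "(\<lambda>n. exp (- real (card Q) * (real n * logistic (- real n * \<delta>)))) \<longlonglongrightarrow> exp (- real (card Q) * 0)"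
    by (intro tendsto_intros lim1)
  then have "filterlim (\<lambda>n. exp (- real (card Q) * (real n * logistic (- real n * \<delta>))) * real n) at_top sequentially"
    by (rule filterlim_tendsto_pos_mult_at_top) (auto intro: filterlim_real_sequentially)
  then have "r \<longlonglongrightarrow> 0"
    unfolding r_def[abs_def] by (intro filterlim_compose[OF exp_at_bot])
      (simp add: filterlim_uminus_at_bot mult_ac)
  then have "(\<lambda>n. r n + (1 - measure ?M ?A)) \<longlonglongrightarrow> 0 + (1 - measure ?M ?A)"
    by (intro tendsto_intros)
  moreover have "(\<lambda>n. exp (- real (card P) * (real n * exp (- real n * logistic (real n * \<delta>))))) \<longlonglongrightarrow> exp (- real (card P) * 0)"
    by (intro tendsto_intros lim2)
  then have "s \<longlonglongrightarrow> 1" by (simp add: s_def[abs_def] mult_ac)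
  then have "(\<lambda>n. s n * (1 - measure ?M ?B)) \<longlonglongrightarrow> 1 * (1 - measure ?M ?B)"
    by (intro tendsto_intros)
  ultimately have "1 * (1 - measure ?M ?B) \<le> 0 + (1 - measure ?M ?A)"
    by (rule tendsto_le[OF trivial_limit_sequentially]) (simp add: ineq)
  then show ?thesis by simp
qed

section \<open>Transport between Gaussian product spaces and the auxiliary Gaussian
  coordinate\<close>

lemma measurable_std_gauss_reindex:
  assumes "f \<in> I \<rightarrow> K"
  shows "(\<lambda>\<omega>. \<lambda>i\<in>I. \<omega> (f i)) \<in> measurable (std_gauss K) (std_gauss I)"
  by (rule measurable_restrict) (use assms in \<open>auto intro!: measurable_component_singleton\<close>)

text \<open>An injective relabelling of coordinates carries a Gaussian product to a Gaussian
  product. It serves to restrict to one summand of a disjoint sum of index sets and to transpose a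
  matrix.\<close>

lemma measure_std_gauss_reindex:
  assumes f: "inj_on f I" "f \<in> I \<rightarrow> K" and S: "S \<in> sets (std_gauss I)"
  shows "measure (std_gauss K) {\<omega> \<in> space (std_gauss K). (\<lambda>i\<in>I. \<omega> (f i)) \<in> S} = measure (std_gauss I) S"
proof -
  have "distr (std_gauss K) (std_gauss I) (\<lambda>\<omega>. \<lambda>i\<in>I. \<omega> (f i)) = std_gauss I"
    using distr_PiM_reindex[of K "\<lambda>_. std_normal" f I] f prob_space_std_normal by simp
  then have "measure (std_gauss I) S = measure (distr (std_gauss K) (std_gauss I) (\<lambda>\<omega>. \<lambda>i\<in>I. \<omega> (f i))) S"
    by simp
  also have "\<dots> = measure (std_gauss K) ((\<lambda>\<omega>. \<lambda>i\<in>I. \<omega> (f i)) -` S \<inter> space (std_gauss K))"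
    by (rule measure_distr[OF measurable_std_gauss_reindex[OF f(2)] S])
  finally show ?thesis by (simp add: vimage_def Int_def conj_commute)
qed

lemma measurable_std_gauss_linear:
  "(\<lambda>\<omega>. \<Sum>k\<in>K. a k * \<omega> k) \<in> borel_measurable (std_gauss K)"
  by (intro borel_measurable_sum borel_measurable_times borel_measurable_const measurable_std_gauss_component)

text \<open>Extending the coefficients by 0 to the disjoint sum of the index sets realizes both
  families independently on one space; each event depends on one summand only, so its probability is
  unchanged.\<close>

lemma gordon_comparison_two_spaces:
  fixes c :: "'p \<times> 'q \<Rightarrow> 'k \<Rightarrow> real" and d :: "'p \<times> 'q \<Rightarrow> 'l \<Rightarrow> real"
  assumes fin: "finite K" "finite L" "finite P" "finite Q"
    and cov_eq: "\<And>p q q'. p \<in> P \<Longrightarrow> q \<in> Q \<Longrightarrow> q' \<in> Q \<Longrightarrow>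
        (\<Sum>k\<in>L. d (p,q) k * d (p,q') k) = (\<Sum>k\<in>K. c (p,q) k * c (p,q') k)"
    and cov_le: "\<And>p p' q q'. p \<in> P \<Longrightarrow> p' \<in> P \<Longrightarrow> q \<in> Q \<Longrightarrow> q' \<in> Q \<Longrightarrow>
        (\<Sum>k\<in>L. d (p,q) k * d (p',q') k) \<le> (\<Sum>k\<in>K. c (p,q) k * c (p',q') k)"
    and \<delta>: "0 < \<delta>"
  shows "measure (std_gauss K) {\<omega> \<in> space (std_gauss K). \<exists>p\<in>P. \<forall>q\<in>Q. (\<Sum>k\<in>K. c (p,q) k * \<omega> k) \<le> - \<delta>}
       \<le> measure (std_gauss L) {\<omega> \<in> space (std_gauss L). \<exists>p\<in>P. \<forall>q\<in>Q. (\<Sum>k\<in>L. d (p,q) k * \<omega> k) < \<delta>}"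
    (is "measure _ ?A \<le> measure _ ?B")
proof -
  let ?N = "K <+> L"
  let ?M = "std_gauss ?N"
  define c' :: "'p \<times> 'q \<Rightarrow> 'k + 'l \<Rightarrow> real" where "c' v = case_sum (c v) (\<lambda>_. 0)" for v
  define d' :: "'p \<times> 'q \<Rightarrow> 'k + 'l \<Rightarrow> real" where "d' v = case_sum (\<lambda>_. 0) (d v)" for v
  note [measurable] = measurable_std_gauss_linear
  have mA: "?A \<in> sets (std_gauss K)" and mB: "?B \<in> sets (std_gauss L)"
    using fin by measurable
  have "measure ?M {\<omega> \<in> space ?M. \<exists>p\<in>P. \<forall>q\<in>Q. (\<Sum>k\<in>?N. c' (p,q) k * \<omega> k) \<le> - \<delta>}
       \<le> measure ?M {\<omega> \<in> space ?M. \<exists>p\<in>P. \<forall>q\<in>Q. (\<Sum>k\<in>?N. d' (p,q) k * \<omega> k) < \<delta>}"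
    by (rule gordon_comparison)
       (use fin \<delta> cov_eq cov_le in \<open>auto simp: sum.Plus c'_def d'_def split: sum.split\<close>)
  moreover have "{\<omega> \<in> space ?M. \<exists>p\<in>P. \<forall>q\<in>Q. (\<Sum>k\<in>?N. c' (p,q) k * \<omega> k) \<le> - \<delta>}
    = {\<omega> \<in> space ?M. (\<lambda>i\<in>K. \<omega> (Inl i)) \<in> ?A}"
    using fin by (auto simp: sum.Plus c'_def space_PiM)
  moreover have "{\<omega> \<in> space ?M. \<exists>p\<in>P. \<forall>q\<in>Q. (\<Sum>k\<in>?N. d' (p,q) k * \<omega> k) < \<delta>}
    = {\<omega> \<in> space ?M. (\<lambda>i\<in>L. \<omega> (Inr i)) \<in> ?B}"
    using fin by (auto simp: sum.Plus d'_def space_PiM)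
  moreover have "measure ?M {\<omega> \<in> space ?M. (\<lambda>i\<in>K. \<omega> (Inl i)) \<in> ?A} = measure (std_gauss K) ?A"
    by (rule measure_std_gauss_reindex) (use mA in auto)
  moreover have "measure ?M {\<omega> \<in> space ?M. (\<lambda>i\<in>L. \<omega> (Inr i)) \<in> ?B} = measure (std_gauss L) ?B"
    by (rule measure_std_gauss_reindex) (use mB in auto)
  ultimately show ?thesis by simp
qed

text \<open>Fubini in the added coordinate. It will be applied to the matrix entries and the
  auxiliary Gaussian.\<close>

lemma std_gauss_insert_independent:
  assumes I: "finite I" "i \<notin> I" and S: "S \<in> sets (std_gauss I)" and T: "T \<in> sets borel"
  shows "measure (std_gauss (insert i I)) {\<omega> \<in> space (std_gauss (insert i I)). restrict \<omega> I \<in> S \<and> \<omega> i \<in> T}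
    = measure (std_gauss I) S * measure std_normal T"
proof -
  interpret product_sigma_finite "\<lambda>_::'a. std_normal" by (rule product_sigma_finite_std_normal)
  interpret N: prob_space std_normal by (rule prob_space_std_normal)
  interpret P: prob_space "std_gauss I" by (rule prob_space_std_gauss)
  interpret P': prob_space "std_gauss (insert i I)" by (rule prob_space_std_gauss)
  let ?E = "{\<omega> \<in> space (std_gauss (insert i I)). restrict \<omega> I \<in> S \<and> \<omega> i \<in> T}"
  have [measurable]: "(\<lambda>\<omega>. restrict \<omega> I) \<in> measurable (std_gauss (insert i I)) (std_gauss I)"
    by (rule measurable_restrict_subset) auto
  have [measurable]: "(\<lambda>\<omega>. \<omega> i) \<in> borel_measurable (std_gauss (insert i I))"
    by (rule measurable_std_gauss_component) simp
  note [measurable] = S T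
  have mE: "?E \<in> sets (std_gauss (insert i I))" by measurable
  have "emeasure (std_gauss (insert i I)) ?E = (\<integral>\<^sup>+\<omega>. indicator ?E \<omega> \<partial>std_gauss (insert i I))"
    using mE by simp
  also have "\<dots> = (\<integral>\<^sup>+x. (\<integral>\<^sup>+y. indicator ?E (fun_upd x i y) \<partial>std_normal) \<partial>std_gauss I)"
    by (rule product_nn_integral_insert[OF I]) (use mE in measurable)
  also have "\<dots> = (\<integral>\<^sup>+x. (\<integral>\<^sup>+y. indicator S x * indicator T y \<partial>std_normal) \<partial>std_gauss I)"
  proof (intro nn_integral_cong)
    fix x y assume x: "x \<in> space (std_gauss I)"
    have "restrict (fun_upd x i y) I = x"
      using x I by (auto simp: space_PiM PiE_def extensional_def restrict_def fun_eq_iff)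
    moreover have "fun_upd x i y \<in> space (std_gauss (insert i I))"
      using x by (auto simp: space_PiM PiE_def extensional_def)
    ultimately show "indicator ?E (fun_upd x i y) = (indicator S x * indicator T y :: ennreal)"
      by (auto simp: indicator_def)
  qed
  also have "\<dots> = (\<integral>\<^sup>+x. indicator S x * emeasure std_normal T \<partial>std_gauss I)"
    using T by (intro nn_integral_cong nn_integral_cmult_indicator) simp
  also have "\<dots> = emeasure (std_gauss I) S * emeasure std_normal T"
    using S by (simp add: nn_integral_multc)
  finally show ?thesis
    by (simp add: P.emeasure_eq_measure P'.emeasure_eq_measure N.emeasure_eq_measure flip: ennreal_mult)
qed

text \<open>Such a tail probability is the factor lost when the auxiliary Gaussian is removed. It is
  independent of all dimensions, so its positivity suffices for exponential rates.\<close>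

lemma std_normal_lower_tail_pos: "0 < measure std_normal {..a}"
proof -
  interpret N: prob_space std_normal by (rule prob_space_std_normal)
  have "emeasure std_normal {..a} \<noteq> 0"
  proof
    assume "emeasure std_normal {..a} = 0"
    then have "AE x in lborel. x \<in> {..a} \<longrightarrow> std_normal_density x = 0"
      by (simp add: std_normal_def emeasure_density nn_integral_0_iff_AE)
         (auto simp: indicator_def normal_density_nonneg elim!: eventually_mono split: if_splits)
    then have "AE x in lborel. x \<notin> {..a}"
      by (rule eventually_mono) (use normal_density_pos[of 1] in \<open>auto simp: less_le\<close>)
    then have "emeasure lborel {..a} = 0"
      by (subst (asm) AE_iff_measurable[of "{..a}"]) auto
    moreover have "emeasure lborel {a - 1..a} \<le> emeasure lborel {..a}"
      by (rule emeasure_mono) auto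
    ultimately show False by simp
  qed
  then show ?thesis by (simp add: N.emeasure_eq_measure zero_less_measure_iff)
qed

text \<open>The coordinate \<open>None\<close> carries an auxiliary Gaussian that is added to the bilinear form: with it, the
  covariances of the two sides differ by a product of two nonnegative factors \<open>1 - p \<bullet> p'\<close> and \<open>1 - q \<bullet> q'\<close>.\<close>

lemma gordon_bilinear_finite:
  fixes P :: "('i \<Rightarrow> real) set" and Q :: "('j \<Rightarrow> real) set"
  assumes fin: "finite I" "finite J" "finite P" "finite Q"
    and P: "\<And>p. p \<in> P \<Longrightarrow> (\<Sum>i\<in>I. (p i)\<^sup>2) = 1"
    and Q: "\<And>q. q \<in> Q \<Longrightarrow> (\<Sum>j\<in>J. (q j)\<^sup>2) = 1"
  shows "measure (std_gauss (I\<times>J)) {A \<in> space (std_gauss (I\<times>J)). \<exists>p\<in>P. \<forall>q\<in>Q. (\<Sum>(i,j)\<in>I\<times>J. p i * q j * A (i,j)) \<le> 1}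
     * measure std_normal {..-2}
   \<le> measure (std_gauss (I <+> J)) {\<omega> \<in> space (std_gauss (I <+> J)). \<exists>p\<in>P. \<forall>q\<in>Q.
        (\<Sum>i\<in>I. p i * \<omega> (Inl i)) + (\<Sum>j\<in>J. q j * \<omega> (Inr j)) < 1}"
    (is "measure _ ?A * _ \<le> measure _ ?B")
proof -
  let ?M = "std_gauss (I\<times>J)"
  let ?K = "insert None (Some ` (I\<times>J))" and ?L = "I <+> J"
  define c where "c v = case_option 1 (\<lambda>(i,j). fst v i * snd v j)" for v :: "('i \<Rightarrow> real) \<times> ('j \<Rightarrow> real)"
  define d where "d v = case_sum (fst v) (snd v)" for v :: "('i \<Rightarrow> real) \<times> ('j \<Rightarrow> real)"
  have sumK: "(\<Sum>k\<in>?K. h k) = h None + (\<Sum>(i,j)\<in>I\<times>J. h (Some (i,j)))" for h :: "('i \<times> 'j) option \<Rightarrow> real"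
    using fin by (subst sum.insert) (auto simp: sum.reindex split_def)
  have cs: "\<bar>\<Sum>i\<in>X. a i * b i\<bar> \<le> 1" if "(\<Sum>i\<in>X. (a i)\<^sup>2) = 1" "(\<Sum>i\<in>X. (b i)\<^sup>2) = 1" for X :: "'x set" and a b :: "'x \<Rightarrow> real"
  proof -
    have "\<bar>\<Sum>i\<in>X. a i * b i\<bar> \<le> (\<Sum>i\<in>X. \<bar>a i\<bar> * \<bar>b i\<bar>)"
      by (rule order_trans[OF sum_abs]) (simp add: abs_mult)
    also have "\<dots> \<le> L2_set a X * L2_set b X" by (rule L2_set_mult_ineq)
    finally show ?thesis using that by (simp add: L2_set_def)
  qed
  have cc: "(\<Sum>k\<in>?K. c (p,q) k * c (p',q') k) = 1 + (\<Sum>i\<in>I. p i * p' i) * (\<Sum>j\<in>J. q j * q' j)" for p p' q q'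
    unfolding sumK by (simp add: c_def sum_product sum.cartesian_product mult_ac)
  have dd: "(\<Sum>k\<in>?L. d (p,q) k * d (p',q') k) = (\<Sum>i\<in>I. p i * p' i) + (\<Sum>j\<in>J. q j * q' j)" for p p' q q'
    using fin by (simp add: d_def sum.Plus)
  have "measure (std_gauss ?K) {\<omega> \<in> space (std_gauss ?K). \<exists>p\<in>P. \<forall>q\<in>Q. (\<Sum>k\<in>?K. c (p,q) k * \<omega> k) \<le> - 1}
      \<le> measure (std_gauss ?L) {\<omega> \<in> space (std_gauss ?L). \<exists>p\<in>P. \<forall>q\<in>Q. (\<Sum>k\<in>?L. d (p,q) k * \<omega> k) < 1}"
  proof (rule gordon_comparison_two_spaces)
    fix p p' q q' assume *: "p \<in> P" "p' \<in> P" "q \<in> Q" "q' \<in> Q"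
    have "0 \<le> (1 - (\<Sum>i\<in>I. p i * p' i)) * (1 - (\<Sum>j\<in>J. q j * q' j))"
      using cs[of p I p'] cs[of q J q'] * P Q by (intro mult_nonneg_nonneg) (auto simp: abs_le_iff)
    then show "(\<Sum>k\<in>?L. d (p,q) k * d (p',q') k) \<le> (\<Sum>k\<in>?K. c (p,q) k * c (p',q') k)"
      unfolding cc dd by (simp add: algebra_simps)
  next
    fix p q q' assume "p \<in> P"
    then have "(\<Sum>i\<in>I. p i * p i) = 1" using P by (simp add: power2_eq_square)
    then show "(\<Sum>k\<in>?L. d (p,q) k * d (p,q') k) = (\<Sum>k\<in>?K. c (p,q) k * c (p,q') k)"
      unfolding cc dd by simp
  qed (use fin in auto)
  also have "{\<omega> \<in> space (std_gauss ?L). \<exists>p\<in>P. \<forall>q\<in>Q. (\<Sum>k\<in>?L. d (p,q) k * \<omega> k) < 1} = ?B"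
    using fin by (simp add: d_def sum.Plus)
  finally have 1: "measure (std_gauss ?K) {\<omega> \<in> space (std_gauss ?K). \<exists>p\<in>P. \<forall>q\<in>Q. (\<Sum>k\<in>?K. c (p,q) k * \<omega> k) \<le> - 1}
      \<le> measure (std_gauss ?L) ?B" .
  \<comment> \<open>Where the bilinear form is at most 1 and the independent auxiliary coordinate is
    at most -2, their sum is at most -1. This is the origin of the level -2 and of the margin
    1.\<close>
  let ?S = "{\<omega> \<in> space (std_gauss (Some ` (I\<times>J))). (\<lambda>ij\<in>I\<times>J. \<omega> (Some ij)) \<in> ?A}"
  have [measurable]: "(\<lambda>A. \<Sum>(i,j)\<in>I\<times>J. p i * q j * A (i,j)) \<in> borel_measurable ?M" for p q
    using measurable_std_gauss_linear[of "\<lambda>(i,j). p i * q j" "I\<times>J"] by (simp add: split_def)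
  have mA: "?A \<in> sets ?M" using fin by measurable
  have [measurable]: "(\<lambda>\<omega>. \<lambda>ij\<in>I\<times>J. \<omega> (Some ij)) \<in> measurable (std_gauss (Some ` (I\<times>J))) ?M"
    by (rule measurable_std_gauss_reindex) auto
  have mS: "?S \<in> sets (std_gauss (Some ` (I\<times>J)))" using mA by measurable
  have "measure ?M ?A * measure std_normal {..-2} = measure (std_gauss (Some ` (I\<times>J))) ?S * measure std_normal {..-2}"
    by (subst measure_std_gauss_reindex) (use mA in auto)
  also have "\<dots> = measure (std_gauss ?K) {\<omega> \<in> space (std_gauss ?K). restrict \<omega> (Some ` (I\<times>J)) \<in> ?S \<and> \<omega> None \<in> {..-2}}"
    by (rule std_gauss_insert_independent[symmetric]) (use fin mS in auto)
  also have "\<dots> \<le> measure (std_gauss ?K) {\<omega> \<in> space (std_gauss ?K). \<exists>p\<in>P. \<forall>q\<in>Q. (\<Sum>k\<in>?K. c (p,q) k * \<omega> k) \<le> - 1}"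
  proof (rule finite_measure.finite_measure_mono)
    show "finite_measure (std_gauss ?K)" using prob_space_std_gauss by (rule prob_space.finite_measure)
    show "{\<omega> \<in> space (std_gauss ?K). \<exists>p\<in>P. \<forall>q\<in>Q. (\<Sum>k\<in>?K. c (p,q) k * \<omega> k) \<le> - 1} \<in> sets (std_gauss ?K)"
      using fin measurable_std_gauss_linear[of _ ?K] by measurable
    show "{\<omega> \<in> space (std_gauss ?K). restrict \<omega> (Some ` (I\<times>J)) \<in> ?S \<and> \<omega> None \<in> {..-2}} \<subseteq>
       {\<omega> \<in> space (std_gauss ?K). \<exists>p\<in>P. \<forall>q\<in>Q. (\<Sum>k\<in>?K. c (p,q) k * \<omega> k) \<le> - 1}"
    proof
      fix \<omega> assume \<omega>: "\<omega> \<in> {\<omega> \<in> space (std_gauss ?K). restrict \<omega> (Some ` (I\<times>J)) \<in> ?S \<and> \<omega> None \<in> {..-2}}"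
      then obtain p where p: "p \<in> P" "\<And>q. q \<in> Q \<Longrightarrow> (\<Sum>(i,j)\<in>I\<times>J. p i * q j * \<omega> (Some (i,j))) \<le> 1"
        by (auto simp: split_def cong: sum.cong)
      have "(\<Sum>k\<in>?K. c (p,q) k * \<omega> k) \<le> - 1" if "q \<in> Q" for q
        using p(2)[OF that] \<omega> unfolding sumK by (simp add: c_def)
      then show "\<omega> \<in> {\<omega> \<in> space (std_gauss ?K). \<exists>p\<in>P. \<forall>q\<in>Q. (\<Sum>k\<in>?K. c (p,q) k * \<omega> k) \<le> - 1}"
        using p(1) \<omega> by blast
    qed
  qed
  finally show ?thesis using 1 by linarith
qed

section \<open>Finite nets and the comparison over infinite index sets\<close>

lemma inner_sum_le_L2_set: "(\<Sum>i\<in>I. a i * b i) \<le> L2_set a I * L2_set b I" for a b :: "'i \<Rightarrow> real"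
proof -
  have "(\<Sum>i\<in>I. a i * b i) \<le> (\<Sum>i\<in>I. \<bar>a i\<bar> * \<bar>b i\<bar>)"
    by (intro sum_mono) (metis abs_ge_self abs_mult)
  also have "\<dots> \<le> L2_set a I * L2_set b I" by (rule L2_set_mult_ineq)
  finally show ?thesis .
qed

text \<open>Rounding the coordinates down to a grid leaves finitely many cells, and one point of
  \<open>D\<close> is chosen in each occupied cell. Choosing inside \<open>D\<close> matters: net
  points must again be unit vectors, or unit vectors of the cone.\<close>

lemma finite_net_exists:
  fixes D :: "('i \<Rightarrow> real) set"
  assumes I: "finite I" and D: "\<And>p. p \<in> D \<Longrightarrow> (\<Sum>i\<in>I. (p i)\<^sup>2) \<le> 1" and \<eta>: "0 < \<eta>"
  obtains N where "finite N" "N \<subseteq> D" "\<And>p. p \<in> D \<Longrightarrow> \<exists>q\<in>N. L2_set (\<lambda>i. p i - q i) I \<le> \<eta>"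
proof -
  \<comment> \<open>Two points of a cell are at most \<open>card I * \<delta>\<close> apart in the
    l1 distance, hence also in the Euclidean one; the added 1 keeps the divisor positive for empty
    \<open>I\<close>.\<close>
  define \<delta> where "\<delta> = \<eta> / (card I + 1)"
  have \<delta>: "0 < \<delta>" "card I * \<delta> \<le> \<eta>" using \<eta> by (auto simp: \<delta>_def field_simps)
  define \<phi> where "\<phi> p = restrict (\<lambda>i. \<lfloor>p i / \<delta>\<rfloor>) I" for p :: "'i \<Rightarrow> real"
  define L where "L = \<lceil>1 / \<delta>\<rceil> + 1"
  have "\<phi> ` D \<subseteq> PiE I (\<lambda>_. {-L..L})"
  proof clarify
    fix p assume p: "p \<in> D"
    show "\<phi> p \<in> PiE I (\<lambda>_. {-L..L})"
      unfolding \<phi>_def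
    proof (rule restrict_PiE_iff[THEN iffD2], rule ballI)
      fix i assume i: "i \<in> I"
      have "(p i)\<^sup>2 \<le> (\<Sum>i\<in>I. (p i)\<^sup>2)" by (rule member_le_sum) (use i I in auto)
      then have "\<bar>p i\<bar> \<le> 1" using D[OF p] abs_square_le_1[of "p i"] by linarith
      then have "- (1 / \<delta>) \<le> p i / \<delta>" "p i / \<delta> \<le> 1 / \<delta>"
        using \<delta> by (auto simp: field_simps)
      then show "\<lfloor>p i / \<delta>\<rfloor> \<in> {-L..L}" unfolding L_def by (simp; linarith)
    qed
  qed
  then have fin: "finite (\<phi> ` D)" by (rule finite_subset) (intro finite_PiE I, simp)
  define r where "r c = (SOME p. p \<in> D \<and> \<phi> p = c)" for c
  have r: "r (\<phi> p) \<in> D \<and> \<phi> (r (\<phi> p)) = \<phi> p" if "p \<in> D" for p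
    unfolding r_def by (rule someI[of _ p]) (use that in simp)
  show ?thesis
  proof
    show "finite (r ` \<phi> ` D)" using fin by simp
    show "r ` \<phi> ` D \<subseteq> D" using r by auto
    fix p assume p: "p \<in> D"
    have "\<bar>p i - r (\<phi> p) i\<bar> \<le> \<delta>" if i: "i \<in> I" for i
    proof -
      have "\<lfloor>p i / \<delta>\<rfloor> = \<lfloor>r (\<phi> p) i / \<delta>\<rfloor>"
      proof -
        have "\<phi> x i = \<lfloor>x i / \<delta>\<rfloor>" for x using i by (simp add: \<phi>_def)
        moreover have "\<phi> (r (\<phi> p)) i = \<phi> p i" using r[OF p] by simp
        ultimately show ?thesis by metis
      qed
      then have "\<bar>p i / \<delta> - r (\<phi> p) i / \<delta>\<bar> \<le> 1" by linarith
      then show ?thesis using \<delta> by (simp add: diff_divide_distrib[symmetric] divide_le_eq)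
    qed
    then have "(\<Sum>i\<in>I. \<bar>p i - r (\<phi> p) i\<bar>) \<le> card I * \<delta>"
      by (rule sum_bounded_above)
    then have "L2_set (\<lambda>i. p i - r (\<phi> p) i) I \<le> \<eta>"
      using L2_set_le_sum_abs[of "\<lambda>i. p i - r (\<phi> p) i" I] \<delta> by linarith
    then show "\<exists>q\<in>r ` \<phi> ` D. L2_set (\<lambda>i. p i - q i) I \<le> \<eta>" using p by blast
  qed
qed

text \<open>Here \<open>P\<close> may be infinite. For a fixed matrix, moving \<open>p\<close> to a
  net point changes the form by at most the mesh times the norm of the image of \<open>q\<close>, so
  the level 0 in \<open>E\<close> becomes the level 1 once the net is fine enough for that matrix.
  The events for growing nets increase, and continuity from below yields the bound for
  \<open>E\<close>. The measurable set \<open>G\<close> covers the event over all of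
  \<open>P\<close>, which may be an uncountable union.\<close>

lemma gordon_bilinear:
  fixes P :: "('i \<Rightarrow> real) set" and Q :: "('j \<Rightarrow> real) set"
  assumes fin: "finite I" "finite J" "finite Q"
    and P: "\<And>p. p \<in> P \<Longrightarrow> (\<Sum>i\<in>I. (p i)\<^sup>2) = 1"
    and Q: "\<And>q. q \<in> Q \<Longrightarrow> (\<Sum>j\<in>J. (q j)\<^sup>2) = 1"
    and E: "E \<in> sets (std_gauss (I\<times>J))"
      "\<And>A. A \<in> E \<Longrightarrow> \<exists>p\<in>P. \<forall>q\<in>Q. (\<Sum>(i,j)\<in>I\<times>J. p i * q j * A (i,j)) \<le> 0"
    and G: "G \<in> sets (std_gauss (I <+> J))"
      "\<And>\<omega> p. \<omega> \<in> space (std_gauss (I <+> J)) \<Longrightarrow> p \<in> P \<Longrightarrow>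
         (\<And>q. q \<in> Q \<Longrightarrow> (\<Sum>i\<in>I. p i * \<omega> (Inl i)) + (\<Sum>j\<in>J. q j * \<omega> (Inr j)) < 1) \<Longrightarrow> \<omega> \<in> G"
  shows "measure (std_gauss (I\<times>J)) E * measure std_normal {..-2} \<le> measure (std_gauss (I <+> J)) G"
proof -
  let ?M' = "std_gauss (I <+> J)"
  let ?M = "std_gauss (I\<times>J)"
  interpret M: prob_space "?M" by (rule prob_space_std_gauss)
  interpret M': prob_space "?M'" by (rule prob_space_std_gauss)
  have "\<exists>N. finite N \<and> N \<subseteq> P \<and> (\<forall>p\<in>P. \<exists>q\<in>N. L2_set (\<lambda>i. p i - q i) I \<le> 1 / real (Suc k))" for k
    by (rule finite_net_exists[OF fin(1), of P "1 / real (Suc k)"]) (use P in auto)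
  then obtain N where N: "\<And>k. finite (N k)" "\<And>k. N k \<subseteq> P"
    "\<And>k p. p \<in> P \<Longrightarrow> \<exists>q\<in>N k. L2_set (\<lambda>i. p i - q i) I \<le> 1 / real (Suc k)" by metis
  \<comment> \<open>Accumulating the nets makes the events \<open>S k\<close> increasing.\<close>
  define R where "R k = (\<Union>l\<le>k. N l)" for k
  have R: "finite (R k)" "R k \<subseteq> P" for k using N by (auto simp: R_def)
  define S where "S k = {A \<in> space ?M. \<exists>p\<in>R k. \<forall>q\<in>Q. (\<Sum>(i,j)\<in>I\<times>J. p i * q j * A (i,j)) \<le> 1}" for k
  have [measurable]: "(\<lambda>A. \<Sum>(i,j)\<in>I\<times>J. p i * q j * A (i,j)) \<in> borel_measurable ?M" for p q
    using measurable_std_gauss_linear[of "\<lambda>(i,j). p i * q j" "I\<times>J"] by (simp add: split_def)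
  have mS: "S k \<in> sets ?M" for k
    unfolding S_def using fin R by measurable
  have incS: "incseq S"
    unfolding incseq_def S_def R_def by (blast intro: order_trans)
  have S_le: "measure ?M (S k) * measure std_normal {..-2} \<le> measure ?M' G" for k
  proof -
    have "measure ?M (S k) * measure std_normal {..-2} \<le>
      measure ?M' {\<omega> \<in> space ?M'. \<exists>p\<in>R k. \<forall>q\<in>Q.
        (\<Sum>i\<in>I. p i * \<omega> (Inl i)) + (\<Sum>j\<in>J. q j * \<omega> (Inr j)) < 1}"
      unfolding S_def by (rule gordon_bilinear_finite) (use fin R P Q in auto)
    also have "\<dots> \<le> measure ?M' G"
      by (rule M'.finite_measure_mono) (use G R in blast)+
    finally show ?thesis .
  qed
  have "E \<subseteq> (\<Union>k. S k)"
  proof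
    fix A assume A: "A \<in> E"
    then have Asp: "A \<in> space ?M" using sets.sets_into_space[OF E(1)] by auto
    obtain p where p: "p \<in> P" "\<And>q. q \<in> Q \<Longrightarrow> (\<Sum>(i,j)\<in>I\<times>J. p i * q j * A (i,j)) \<le> 0"
      using E(2)[OF A] by blast
    define T where "T q = L2_set (\<lambda>i. \<Sum>j\<in>J. q j * A (i,j)) I" for q
    \<comment> \<open>The mesh is adapted to the matrix: \<open>1 / Suc k\<close> times
      \<open>T q\<close> is at most 1 for all \<open>q\<close> in \<open>Q\<close>
      simultaneously.\<close>
    define k where "k = nat \<lceil>\<Sum>q\<in>Q. T q\<rceil>"
    obtain p' where p': "p' \<in> N k" "L2_set (\<lambda>i. p i - p' i) I \<le> 1 / real (Suc k)"
      using N(3)[OF p(1)] by blast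
    have eq: "(\<Sum>(i,j)\<in>I\<times>J. p i * q j * A (i,j)) = (\<Sum>i\<in>I. p i * (\<Sum>j\<in>J. q j * A (i,j)))" for p q
      by (simp add: sum.cartesian_product[symmetric] sum_distrib_left mult.assoc)
    have "(\<Sum>(i,j)\<in>I\<times>J. p' i * q j * A (i,j)) \<le> 1" if q: "q \<in> Q" for q
    proof -
      have "T q \<le> (\<Sum>q\<in>Q. T q)" by (rule member_le_sum) (use q fin in \<open>auto simp: T_def\<close>)
      then have Tq: "T q \<le> real (Suc k)" unfolding k_def by linarith
      have "(\<Sum>i\<in>I. (p' i - p i) * (\<Sum>j\<in>J. q j * A (i,j))) \<le> L2_set (\<lambda>i. p' i - p i) I * T q"
        unfolding T_def by (rule inner_sum_le_L2_set)
      also have "L2_set (\<lambda>i. p' i - p i) I = L2_set (\<lambda>i. p i - p' i) I"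
        by (simp add: L2_set_def power2_commute)
      also have "\<dots> * T q \<le> 1 / real (Suc k) * real (Suc k)"
        by (intro mult_mono p' Tq) (auto simp: T_def)
      finally have "(\<Sum>i\<in>I. (p' i - p i) * (\<Sum>j\<in>J. q j * A (i,j))) \<le> 1" by simp
      then show ?thesis using p(2)[OF q] unfolding eq left_diff_distrib sum_subtractf by linarith
    qed
    moreover have "p' \<in> R k" using p'(1) by (auto simp: R_def)
    ultimately have "A \<in> S k" using Asp unfolding S_def by blast
    then show "A \<in> (\<Union>k. S k)" by blast
  qed
  then have "measure ?M E \<le> measure ?M (\<Union>k. S k)"
    by (rule M.finite_measure_mono) (use mS in auto)
  moreover have "(\<lambda>k. measure ?M (S k)) \<longlonglongrightarrow> measure ?M (\<Union>k. S k)"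
    by (rule M.finite_Lim_measure_incseq[OF _ incS]) (use mS in auto)
  then have "(\<lambda>k. measure ?M (S k) * measure std_normal {..-2}) \<longlonglongrightarrow>
      measure ?M (\<Union>k. S k) * measure std_normal {..-2}"
    by (intro tendsto_intros)
  then have "measure ?M (\<Union>k. S k) * measure std_normal {..-2} \<le> measure ?M' G"
    by (rule LIMSEQ_le_const2) (use S_le in blast)
  ultimately show ?thesis
    by (meson measure_nonneg mult_right_mono order_trans)
qed

text \<open>A net point within \<eta> of the direction of \<open>g\<close> loses at most \<eta>
  times the norm of \<open>g\<close>, by Cauchy-Schwarz.\<close>

lemma sphere_net_gives_norm:
  fixes N :: "('i \<Rightarrow> real) set"
  assumes N: "\<And>p. (\<Sum>i\<in>I. (p i)\<^sup>2) = 1 \<Longrightarrow> \<exists>q\<in>N. L2_set (\<lambda>i. p i - q i) I \<le> \<eta>"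
    and g: "L2_set g I \<noteq> 0"
  obtains q where "q \<in> N" "(1 - \<eta>) * L2_set g I \<le> (\<Sum>i\<in>I. q i * g i)"
proof -
  let ?l = "L2_set g I"
  have l: "0 < ?l" using g by (simp add: less_le)
  have l2: "?l\<^sup>2 = (\<Sum>i\<in>I. (g i)\<^sup>2)" by (simp add: L2_set_def sum_nonneg)
  have "(\<Sum>i\<in>I. (g i / ?l)\<^sup>2) = 1"
    using l by (simp add: power_divide sum_divide_distrib[symmetric] l2[symmetric])
  from N[OF this] obtain q where q: "q \<in> N" "L2_set (\<lambda>i. g i / ?l - q i) I \<le> \<eta>" by blast
  have "(\<Sum>i\<in>I. (g i / ?l - q i) * g i) \<le> L2_set (\<lambda>i. g i / ?l - q i) I * ?l"
    by (rule inner_sum_le_L2_set)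
  also have "\<dots> \<le> \<eta> * ?l" using q l by (intro mult_right_mono) auto
  also have "(\<Sum>i\<in>I. (g i / ?l - q i) * g i) = ?l - (\<Sum>i\<in>I. q i * g i)"
  proof -
    have "(\<Sum>i\<in>I. g i / ?l * g i) = ?l\<^sup>2 / ?l"
      unfolding l2 by (simp add: sum_divide_distrib power2_eq_square)
    also have "\<dots> = ?l" using l by (simp add: power2_eq_square)
    finally show ?thesis by (simp add: left_diff_distrib sum_subtractf)
  qed
  finally show ?thesis using q(1) that by (simp add: algebra_simps)
qed

section \<open>Exponential concentration\<close>

text \<open>Lagrange remainder. The linear term is kept exact because it integrates to 0 for a
  centered variable, which leaves a term quadratic in the scaling.\<close>

lemma exp_le_quadratic: "exp y \<le> 1 + y + y\<^sup>2 * exp \<bar>y\<bar>" for y :: real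
proof -
  obtain t where t: "\<bar>t\<bar> \<le> \<bar>y\<bar>" "exp y = (\<Sum>m<2. y ^ m / fact m) + exp t / fact 2 * y ^ 2"
    using Maclaurin_exp_le[of y 2] by blast
  have "exp t / 2 * y\<^sup>2 \<le> exp \<bar>y\<bar> * y\<^sup>2"
  proof (intro mult_right_mono)
    have "exp t \<le> exp \<bar>y\<bar>" using t(1) by simp
    then show "exp t / 2 \<le> exp \<bar>y\<bar>" using exp_gt_zero[of t] by linarith
  qed simp
  then show ?thesis unfolding t(2) by (simp add: numeral_2_eq_2 mult.commute)
qed

text \<open>Multiplying the standard density by \<open>exp (x\<^sup>2 / 4)\<close> gives
  \<open>sqrt 2\<close> times the normal density of variance 2.\<close>

lemma std_normal_integrable_exp_square: "integrable std_normal (\<lambda>x. exp (x\<^sup>2 / 4))"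
proof -
  have "integrable lborel (\<lambda>x. sqrt 2 * normal_density 0 (sqrt 2) x)"
    by (intro integrable_mult_right integrable_normal_density) simp
  also have "(\<lambda>x. sqrt 2 * normal_density 0 (sqrt 2) x) = (\<lambda>x. std_normal_density x * exp (x\<^sup>2 / 4))"
  proof
    fix x :: real
    have "exp (- x\<^sup>2 / 4) = exp (- x\<^sup>2 / 2) * exp (x\<^sup>2 / 4)"
      by (simp flip: exp_add)
    then show "sqrt 2 * normal_density 0 (sqrt 2) x = std_normal_density x * exp (x\<^sup>2 / 4)"
      using real_div_sqrt[of 2] by (simp add: normal_density_def real_sqrt_mult field_simps)
  qed
  finally show ?thesis by (subst std_normal_integrable_iff) simp_all
qed

lemma std_normal_integrable_quadratic_bound:
  fixes f :: "real \<Rightarrow> real"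
  assumes "f \<in> borel_measurable borel" "\<And>x. \<bar>f x\<bar> \<le> a * (1 + x\<^sup>2)"
  shows "integrable std_normal f" "\<bar>LINT x|std_normal. f x\<bar> \<le> 2 * a"
proof -
  interpret N: prob_space std_normal by (rule prob_space_std_normal)
  have i: "integrable std_normal (\<lambda>x. a * (1 + x\<^sup>2))"
    by (intro integrable_mult_right Bochner_Integration.integrable_add N.integrable_const std_normal_integrable_power)
  show 1: "integrable std_normal f"
    by (rule Bochner_Integration.integrable_bound[OF i])
       (use assms in \<open>auto intro!: AE_I2 intro: order_trans[OF _ abs_ge_self]\<close>)
  have "\<bar>LINT x|std_normal. f x\<bar> \<le> (LINT x|std_normal. \<bar>f x\<bar>)" by (rule integral_abs_bound)
  also have "\<dots> \<le> (LINT x|std_normal. a * (1 + x\<^sup>2))"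
    by (rule integral_mono) (use 1 i assms in auto)
  also have "\<dots> = a * (1 + 1)"
    using std_normal_second_moment std_normal_integrable_power[of 2] N.integrable_const[of 1] N.prob_space by simp
  finally show "\<bar>LINT x|std_normal. f x\<bar> \<le> 2 * a" by simp
qed

text \<open>One \<open>C\<close> serves all \<open>f\<close> with the same quadratic bound, because
  the summands will vary with the coordinate and the dimension. After centering, the linear term
  integrates to 0 and the remainder is at most a multiple of
  \<open>\<eta>\<^sup>2 * exp (x\<^sup>2 / 4)\<close>.\<close>

lemma std_normal_mgf_bound:
  assumes a: "0 < a"
  shows "\<exists>C>0. \<forall>f \<eta>. f \<in> borel_measurable borel \<longrightarrow> (\<forall>x. \<bar>f x\<bar> \<le> a * (1 + x\<^sup>2)) \<longrightarrow>
     0 \<le> \<eta> \<longrightarrow> \<eta> \<le> 1 / (24 * a) \<longrightarrow>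
     integrable std_normal (\<lambda>x. exp (\<eta> * (f x - integral\<^sup>L std_normal f))) \<and>
     (LINT x|std_normal. exp (\<eta> * (f x - integral\<^sup>L std_normal f))) \<le> exp (C * \<eta>\<^sup>2)"
proof -
  interpret N: prob_space std_normal by (rule prob_space_std_normal)
  define M where "M = (LINT x|std_normal. exp (x\<^sup>2 / 4))"
  \<comment> \<open>The mean is at most \<open>2 * a\<close> in absolute value, so the centered
    function is at most \<open>3 * a * (1 + x\<^sup>2)\<close>.\<close>
  define b where "b = 3 * a"
  define C where "C = b\<^sup>2 * (128 * exp (1/4)) * M + 1"
  have M0: "0 \<le> M" unfolding M_def by (rule Bochner_Integration.integral_nonneg) simp
  then have "0 < C" unfolding C_def by (simp add: add_nonneg_pos)
  moreover have "integrable std_normal (\<lambda>x. exp (\<eta> * (f x - integral\<^sup>L std_normal f))) \<and>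
     (LINT x|std_normal. exp (\<eta> * (f x - integral\<^sup>L std_normal f))) \<le> exp (C * \<eta>\<^sup>2)"
    if f: "f \<in> borel_measurable borel" "\<And>x. \<bar>f x\<bar> \<le> a * (1 + x\<^sup>2)" and \<eta>: "0 \<le> \<eta>" "\<eta> \<le> 1 / (24 * a)"
    for f \<eta>
  proof -
  note [measurable] = f(1)
  let ?m = "integral\<^sup>L std_normal f"
  note fi = std_normal_integrable_quadratic_bound[OF f]
  define y where "y x = \<eta> * (f x - ?m)" for x
  have yb: "exp (y x) \<le> 1 + y x + \<eta>\<^sup>2 * (b\<^sup>2 * (128 * exp (1/4)) * exp (x\<^sup>2 / 4))" for x
  proof -
    define u where "u = 1 + x\<^sup>2"
    have u: "1 \<le> u" by (simp add: u_def)
    have "\<bar>f x - ?m\<bar> \<le> a * u + 2 * a" using f(2)[of x] fi(2) unfolding u_def by linarith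
    also have "\<dots> \<le> b * u" using u a by (simp add: b_def)
    finally have 1: "\<bar>f x - ?m\<bar> \<le> b * u" .
    then have y1: "\<bar>y x\<bar> \<le> \<eta> * (b * u)" unfolding y_def abs_mult using \<eta> by (simp add: mult_left_mono)
    \<comment> \<open>Here the cap \<open>1 / (24 * a)\<close> enters: it bounds the exponent by
      \<open>u / 8\<close>. A second \<open>u / 8\<close> pays for the factor
      \<open>u\<^sup>2\<close>, and the total \<open>u / 4\<close> is the exponent known to be
      integrable.\<close>
    have "\<eta> * b \<le> 1 / 8" using \<eta> a by (simp add: b_def field_simps)
    then have "\<eta> * b * u \<le> 1 / 8 * u" using u by (intro mult_right_mono) auto
    then have y2: "\<bar>y x\<bar> \<le> u / 8" using y1 by (simp add: mult.assoc)
    have "(y x)\<^sup>2 \<le> (\<eta> * (b * u))\<^sup>2" using y1 by (metis abs_ge_zero power2_abs power_mono)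
    then have "(y x)\<^sup>2 * exp \<bar>y x\<bar> \<le> (\<eta> * (b * u))\<^sup>2 * exp (u / 8)"
      using y2 by (intro mult_mono) auto
    also have "\<dots> = \<eta>\<^sup>2 * b\<^sup>2 * (u\<^sup>2 * exp (u / 8))" by (simp add: power_mult_distrib)
    also have "\<dots> \<le> \<eta>\<^sup>2 * b\<^sup>2 * (128 * exp (u / 8) * exp (u / 8))"
    proof (intro mult_left_mono mult_right_mono)
      have "1 + u / 8 + (u / 8)\<^sup>2 / 2 \<le> exp (u / 8)" using exp_lower_Taylor_quadratic[of "u / 8"] u by simp
      then have "(u / 8)\<^sup>2 / 2 \<le> exp (u / 8)" using u by linarith
      then show "u\<^sup>2 \<le> 128 * exp (u / 8)" by (simp add: power_divide)
    qed auto
    also have "128 * exp (u / 8) * exp (u / 8) = 128 * exp (1/4) * exp (x\<^sup>2 / 4)"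
      unfolding u_def by (simp add: mult.assoc flip: exp_add)
    finally show ?thesis using exp_le_quadratic[of "y x"] by (simp add: mult_ac)
  qed
  have int2: "integrable std_normal (\<lambda>x. 1 + y x + \<eta>\<^sup>2 * (b\<^sup>2 * (128 * exp (1/4)) * exp (x\<^sup>2 / 4)))"
    unfolding y_def
    by (intro Bochner_Integration.integrable_add integrable_mult_right Bochner_Integration.integrable_diff
        N.integrable_const fi std_normal_integrable_exp_square)
  have int1: "integrable std_normal (\<lambda>x. exp (y x))"
  proof (rule Bochner_Integration.integrable_bound[OF int2])
    show "(\<lambda>x. exp (y x)) \<in> borel_measurable std_normal" unfolding y_def by measurable
    show "AE x in std_normal. norm (exp (y x)) \<le> norm (1 + y x + \<eta>\<^sup>2 * (b\<^sup>2 * (128 * exp (1/4)) * exp (x\<^sup>2 / 4)))"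
    proof (rule AE_I2)
      fix x show "norm (exp (y x)) \<le> norm (1 + y x + \<eta>\<^sup>2 * (b\<^sup>2 * (128 * exp (1/4)) * exp (x\<^sup>2 / 4)))"
        using yb[of x] by simp
    qed
  qed
  have "(LINT x|std_normal. exp (y x)) \<le> (LINT x|std_normal. 1 + y x + \<eta>\<^sup>2 * (b\<^sup>2 * (128 * exp (1/4)) * exp (x\<^sup>2 / 4)))"
    by (rule integral_mono[OF int1 int2 yb])
  also have "\<dots> = 1 + (LINT x|std_normal. y x) + \<eta>\<^sup>2 * (b\<^sup>2 * (128 * exp (1/4)) * M)"
    unfolding M_def y_def using fi(1) std_normal_integrable_exp_square N.prob_space
    by simp
  also have "(LINT x|std_normal. y x) = 0"
    unfolding y_def using fi(1) N.prob_space by (simp add: Bochner_Integration.integral_diff)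
  also have "1 + 0 + \<eta>\<^sup>2 * (b\<^sup>2 * (128 * exp (1/4)) * M) \<le> 1 + C * \<eta>\<^sup>2"
    unfolding C_def by (simp add: algebra_simps)
  also have "\<dots> \<le> exp (C * \<eta>\<^sup>2)" by (rule exp_ge_add_one_self)
  finally show "integrable std_normal (\<lambda>x. exp (\<eta> * (f x - ?m))) \<and>
     (LINT x|std_normal. exp (\<eta> * (f x - ?m))) \<le> exp (C * \<eta>\<^sup>2)"
    using int1 unfolding y_def by simp
  qed
  ultimately show ?thesis by blast
qed

text \<open>Exponential Markov inequality and independence. The rate depends on \<open>a\<close> and
  \<epsilon> alone; \<open>r\<close> selects the coordinates that enter, and \<open>N\<close> is an
  upper bound for their number.\<close>

lemma chernoff_bound_quadratic:
  fixes a \<epsilon> :: real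
  assumes a: "0 < a" and \<epsilon>: "0 < \<epsilon>"
  shows "\<exists>c>0. \<forall>(J :: 'j set) (K :: 'k set) r f N. finite J \<longrightarrow> inj_on r J \<longrightarrow> r \<in> J \<rightarrow> K \<longrightarrow>
    real (card J) \<le> N \<longrightarrow> (\<forall>j\<in>J. f j \<in> borel_measurable borel) \<longrightarrow>
    (\<forall>j\<in>J. \<forall>x. \<bar>f j x\<bar> \<le> a * (1 + x\<^sup>2)) \<longrightarrow>
    {\<omega> \<in> space (std_gauss K). (\<Sum>j\<in>J. integral\<^sup>L std_normal (f j)) + \<epsilon> * N \<le> (\<Sum>j\<in>J. f j (\<omega> (r j)))} \<in> sets (std_gauss K) \<and>
    measure (std_gauss K) {\<omega> \<in> space (std_gauss K).
      (\<Sum>j\<in>J. integral\<^sup>L std_normal (f j)) + \<epsilon> * N \<le> (\<Sum>j\<in>J. f j (\<omega> (r j)))} \<le> exp (- c * N)"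
proof -
  obtain C where C: "0 < C" "\<And>f \<eta>. f \<in> borel_measurable borel \<Longrightarrow> (\<And>x. \<bar>f x\<bar> \<le> a * (1 + x\<^sup>2)) \<Longrightarrow>
     0 \<le> \<eta> \<Longrightarrow> \<eta> \<le> 1 / (24 * a) \<Longrightarrow>
     integrable std_normal (\<lambda>x. exp (\<eta> * (f x - integral\<^sup>L std_normal f))) \<and>
     (LINT x|std_normal. exp (\<eta> * (f x - integral\<^sup>L std_normal f))) \<le> exp (C * \<eta>\<^sup>2)"
    using std_normal_mgf_bound[OF a] by metis
  \<comment> \<open>The first entry keeps the moment bound applicable; the second makes the loss
    \<open>C * \<eta>\<^sup>2\<close> per coordinate at most half of the gain
    \<open>\<eta> * \<epsilon>\<close>.\<close>
  define \<eta> where "\<eta> = min (1 / (24 * a)) (\<epsilon> / (2 * C))"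
  have \<eta>: "0 < \<eta>" "\<eta> \<le> 1 / (24 * a)" "C * \<eta> \<le> \<epsilon> / 2"
    using a \<epsilon> C(1) by (auto simp: \<eta>_def min_def field_simps)
  define c where "c = \<eta> * \<epsilon> / 2"
  show ?thesis
  proof (intro exI[of _ c] conjI allI impI)
    show "0 < c" using \<eta> \<epsilon> by (simp add: c_def)
  next
    fix J :: "'j set" and K :: "'k set" and r f and N :: real
    assume J: "finite J" "inj_on r J" "r \<in> J \<rightarrow> K" "real (card J) \<le> N"
      and f_meas: "\<forall>j\<in>J. f j \<in> borel_measurable borel" and f_le: "\<forall>j\<in>J. \<forall>x. \<bar>f j x\<bar> \<le> a * (1 + x\<^sup>2)"
    from f_meas f_le have f: "\<And>j. j \<in> J \<Longrightarrow> f j \<in> borel_measurable borel" "\<And>j x. j \<in> J \<Longrightarrow> \<bar>f j x\<bar> \<le> a * (1 + x\<^sup>2)"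
      by auto
    interpret product_sigma_finite "\<lambda>_::'j. std_normal" by (rule product_sigma_finite_std_normal)
    interpret PJ: prob_space "std_gauss J" by (rule prob_space_std_gauss)
    let ?m = "\<lambda>j. integral\<^sup>L std_normal (f j)"
    let ?S = "{\<omega> \<in> space (std_gauss J). (\<Sum>j\<in>J. ?m j) + \<epsilon> * N \<le> (\<Sum>j\<in>J. f j (\<omega> j))}"
    let ?S' = "{\<omega> \<in> space (std_gauss K). (\<Sum>j\<in>J. ?m j) + \<epsilon> * N \<le> (\<Sum>j\<in>J. f j (\<omega> (r j)))}"
    have "(\<lambda>\<omega>. \<Sum>j\<in>J. f j (\<omega> j)) \<in> borel_measurable (std_gauss J)"
      by (intro borel_measurable_sum measurable_compose[OF measurable_std_gauss_component f(1)])
    then have mS: "?S \<in> sets (std_gauss J)" by measurable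
    have "(\<lambda>\<omega>. \<Sum>j\<in>J. f j (\<omega> (r j))) \<in> borel_measurable (std_gauss K)"
      by (intro borel_measurable_sum measurable_compose[OF measurable_std_gauss_component f(1)]) (use J in auto)
    then have mS': "?S' \<in> sets (std_gauss K)" by measurable
    have "?S' = {\<omega> \<in> space (std_gauss K). (\<lambda>j\<in>J. \<omega> (r j)) \<in> ?S}"
      by (auto simp: space_PiM)
    then have "measure (std_gauss K) ?S' = measure (std_gauss J) ?S"
      using measure_std_gauss_reindex[OF J(2,3) mS] by simp
    also have "\<dots> = (LINT \<omega>|std_gauss J. indicator ?S \<omega>)" using mS by simp
    also have "\<dots> \<le> (LINT \<omega>|std_gauss J. exp (- \<eta> * \<epsilon> * N) * (\<Prod>j\<in>J. exp (\<eta> * (f j (\<omega> j) - ?m j))))"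
    proof (rule integral_mono)
      show "integrable (std_gauss J) (indicator ?S :: _ \<Rightarrow> real)"
        using mS by (simp add: PJ.emeasure_eq_measure)
      show "integrable (std_gauss J) (\<lambda>\<omega>. exp (- \<eta> * \<epsilon> * N) * (\<Prod>j\<in>J. exp (\<eta> * (f j (\<omega> j) - ?m j))))"
        by (intro integrable_mult_right product_integrable_prod J) (use C(2) f \<eta> in auto)
      fix \<omega> assume "\<omega> \<in> space (std_gauss J)"
      have eq: "exp (- \<eta> * \<epsilon> * N) * (\<Prod>j\<in>J. exp (\<eta> * (f j (\<omega> j) - ?m j)))
          = exp (\<eta> * ((\<Sum>j\<in>J. f j (\<omega> j)) - ((\<Sum>j\<in>J. ?m j) + \<epsilon> * N)))"
        using J by (simp add: exp_sum[symmetric] exp_add[symmetric] sum_subtractf sum_distrib_left[symmetric] algebra_simps)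
      show "indicator ?S \<omega> \<le> exp (- \<eta> * \<epsilon> * N) * (\<Prod>j\<in>J. exp (\<eta> * (f j (\<omega> j) - ?m j)))"
        unfolding eq using \<eta> by (auto simp: indicator_def)
    qed
    also have "\<dots> = exp (- \<eta> * \<epsilon> * N) * (\<Prod>j\<in>J. LINT x|std_normal. exp (\<eta> * (f j x - ?m j)))"
      by (subst integral_mult_right_zero, subst product_integral_prod[OF J(1)]) (use C(2) f \<eta> in auto)
    also have "\<dots> \<le> exp (- \<eta> * \<epsilon> * N) * (\<Prod>j\<in>J. exp (C * \<eta>\<^sup>2))"
      by (intro mult_left_mono prod_mono conjI Bochner_Integration.integral_nonneg) (use C(2) f \<eta> in auto)
    also have "\<dots> = exp (- \<eta> * \<epsilon> * N + real (card J) * (C * \<eta>\<^sup>2))"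
      by (simp only: prod_constant exp_of_nat_mult[symmetric] exp_add[symmetric])
    also have "\<dots> \<le> exp (- c * N)"
    proof -
      have N0: "0 \<le> N" using J(4) of_nat_0_le_iff order_trans by blast
      have key: "C * \<eta>\<^sup>2 \<le> \<eta> * (\<epsilon> / 2)"
        using mult_left_mono[OF \<eta>(3), of \<eta>] \<eta> by (simp add: power2_eq_square mult_ac)
      have "real (card J) * (C * \<eta>\<^sup>2) \<le> N * (\<eta> * (\<epsilon> / 2))"
        by (intro mult_mono J(4) N0 key) (simp add: C(1) less_imp_le)
      then show ?thesis by (simp add: c_def algebra_simps)
    qed
    finally show "measure (std_gauss K) ?S' \<le> exp (- c * N)" .
    show "?S' \<in> sets (std_gauss K)" by (rule mS')
  qed
qed

section \<open>Truncated Gaussian moments and the error function\<close>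

definition upper_tail :: "real \<Rightarrow> real" where
  "upper_tail l = (LINT x|std_normal. indicator {l<..} x)"

lemma std_normal_integral_Ioi_FTC:
  fixes F f :: "real \<Rightarrow> real"
  assumes F: "\<And>x. (F has_real_derivative std_normal_density x * f x) (at x)"
    and f: "\<And>x. isCont f x" and int: "integrable std_normal f"
    and top: "(F \<longlongrightarrow> b) at_top"
  shows "(LINT x|std_normal. indicator {l<..} x * f x) = b - F l"
proof -
  have [measurable]: "f \<in> borel_measurable borel"
    by (intro borel_measurable_continuous_onI continuous_at_imp_continuous_on ballI f)
  have i: "integrable lborel (\<lambda>x. std_normal_density x * f x)"
    using int by (subst (asm) std_normal_integrable_iff) simp_all
  have "(LBINT x=ereal l..\<infinity>. std_normal_density x * f x) = b - F l"
  proof (rule interval_integral_FTC_integrable)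
    show "set_integrable lborel (einterval (ereal l) \<infinity>) (\<lambda>x. std_normal_density x * f x)"
      unfolding set_integrable_def by (intro integrable_mult_indicator i) simp
    show "((F \<circ> real_of_ereal) \<longlongrightarrow> F l) (at_right (ereal l))"
      using DERIV_isCont[OF F, of l] by (simp add: ereal_tendsto_simps isCont_def filterlim_at_split)
    show "isCont (\<lambda>x. std_normal_density x * f x) x" for x
      using f DERIV_isCont[OF std_normal_density_has_derivative] by (intro continuous_intros)
  qed (use F top in \<open>auto simp: ereal_tendsto_simps has_real_derivative_iff_has_vector_derivative\<close>)
  moreover have "einterval (ereal l) \<infinity> = {l<..}" by (auto simp: einterval_def)
  ultimately have "(LINT x|lborel. indicator {l<..} x * (std_normal_density x * f x)) = b - F l"
    by (simp add: interval_lebesgue_integral_def set_lebesgue_integral_def)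
  then show ?thesis by (simp add: std_normal_integral mult_ac)
qed

lemma integrable_std_normal_indicator_mult:
  "integrable std_normal f \<Longrightarrow> integrable std_normal (\<lambda>x. indicator {l<..} x * f x)" for f :: "real \<Rightarrow> real"
  using integrable_mult_indicator[of "{l<..}" std_normal f] by simp

lemma std_normal_Ioi_first_moment:
  "(LINT x|std_normal. indicator {l<..} x * x) = std_normal_density l"
proof -
  have "(LINT x|std_normal. indicator {l<..} x * x) = 0 - (- std_normal_density l)"
    by (rule std_normal_integral_Ioi_FTC)
       (use std_normal_integrable_id tendsto_minus[OF std_normal_density_tendsto_at_top] in
        \<open>auto intro!: derivative_eq_intros std_normal_density_has_derivative\<close>)
  then show ?thesis by simp
qed

text \<open>The density times \<open>x\<^sup>2 - 1\<close> has the elementary antiderivative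
  \<open>- x * std_normal_density x\<close>; this is why 1 is subtracted.\<close>

lemma std_normal_Ioi_second_moment:
  "(LINT x|std_normal. indicator {l<..} x * (x\<^sup>2 - 1)) = l * std_normal_density l"
proof -
  interpret N: prob_space std_normal by (rule prob_space_std_normal)
  have "((\<lambda>x::real. x * exp (- x\<^sup>2 / 2)) \<longlongrightarrow> 0) at_top" by real_asymp
  from tendsto_mult_left[OF this, of "- (1 / sqrt (2 * pi))"]
  have lim: "((\<lambda>x. - x * std_normal_density x) \<longlongrightarrow> 0) at_top"
    unfolding std_normal_density_def by (simp add: mult_ac)
  have "(LINT x|std_normal. indicator {l<..} x * (x\<^sup>2 - 1)) = 0 - (- l * std_normal_density l)"
  proof (rule std_normal_integral_Ioi_FTC[OF _ _ _ lim])
    show "((\<lambda>x. - x * std_normal_density x) has_real_derivative std_normal_density x * (x\<^sup>2 - 1)) (at x)" for x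
      by (rule derivative_eq_intros std_normal_density_has_derivative refl)+ (simp add: algebra_simps power2_eq_square)
    show "integrable std_normal (\<lambda>x. x\<^sup>2 - 1)"
      by (intro Bochner_Integration.integrable_diff N.integrable_const std_normal_integrable_power)
  qed auto
  then show ?thesis by simp
qed

lemma integrable_shifted_parts:
  "integrable std_normal (\<lambda>x. max 0 (x - l))" "integrable std_normal (\<lambda>x. x * max 0 (x - l))"
  "integrable std_normal (\<lambda>x. x - l)" "integrable std_normal (\<lambda>x. x * (x - l))"
  "integrable std_normal (\<lambda>x. min 0 (x - l))" "integrable std_normal (\<lambda>x. x * min 0 (x - l))"
proof -
  interpret N: prob_space std_normal by (rule prob_space_std_normal)
  show 1: "integrable std_normal (\<lambda>x. x - l)"
    by (intro Bochner_Integration.integrable_diff N.integrable_const std_normal_integrable_id)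
  have "integrable std_normal (\<lambda>x. x\<^sup>2 - l * x)"
    by (intro Bochner_Integration.integrable_diff integrable_mult_right std_normal_integrable_power std_normal_integrable_id)
  then show 2: "integrable std_normal (\<lambda>x. x * (x - l))" by (simp add: algebra_simps power2_eq_square)
  have 3: "max 0 (x - l) = indicator {l<..} x * (x - l)" for x by (auto simp: indicator_def)
  have 4: "x * max 0 (x - l) = indicator {l<..} x * (x * (x - l))" for x by (auto simp: indicator_def)
  show 5: "integrable std_normal (\<lambda>x. max 0 (x - l))" unfolding 3 by (rule integrable_std_normal_indicator_mult[OF 1])
  show 6: "integrable std_normal (\<lambda>x. x * max 0 (x - l))" unfolding 4 by (rule integrable_std_normal_indicator_mult[OF 2])
  have 7: "min 0 (x - l) = (x - l) - max 0 (x - l)" for x by (auto simp: min_def max_def)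
  show "integrable std_normal (\<lambda>x. min 0 (x - l))" unfolding 7 by (intro Bochner_Integration.integrable_diff 1 5)
  have 8: "x * min 0 (x - l) = x * (x - l) - x * max 0 (x - l)" for x by (auto simp: min_def max_def)
  show "integrable std_normal (\<lambda>x. x * min 0 (x - l))" unfolding 8 by (intro Bochner_Integration.integrable_diff 2 6)
qed

text \<open>The \<open>min\<close> part is \<open>x - l\<close> minus the \<open>max\<close> part,
  so all formulas reduce to truncated moments of order at most 2. In the second formula the terms
  \<open>l * std_normal_density l\<close> cancel.\<close>

lemma shifted_part_integrals:
  shows "(LINT x|std_normal. max 0 (x - l)) = std_normal_density l - l * upper_tail l" (is ?a)
    and "(LINT x|std_normal. x * max 0 (x - l)) = upper_tail l" (is ?b)
    and "(LINT x|std_normal. x - l) = - l" (is ?c)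
    and "(LINT x|std_normal. x * (x - l)) = 1" (is ?d)
    and "(LINT x|std_normal. min 0 (x - l)) = - l - (std_normal_density l - l * upper_tail l)" (is ?e)
    and "(LINT x|std_normal. x * min 0 (x - l)) = 1 - upper_tail l" (is ?f)
proof -
  interpret N: prob_space std_normal by (rule prob_space_std_normal)
  have i0: "integrable std_normal (\<lambda>x. indicator {l<..} x :: real)"
    using integrable_std_normal_indicator_mult[OF N.integrable_const[of 1]] by simp
  have i1: "integrable std_normal (\<lambda>x. indicator {l<..} x * x)"
    by (rule integrable_std_normal_indicator_mult[OF std_normal_integrable_id])
  have i2: "integrable std_normal (\<lambda>x. indicator {l<..} x * (x\<^sup>2 - 1))"
    by (intro integrable_std_normal_indicator_mult Bochner_Integration.integrable_diff N.integrable_const std_normal_integrable_power)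
  have "max 0 (x - l) = indicator {l<..} x * x - l * indicator {l<..} x" for x
    by (auto simp: indicator_def)
  then show a: ?a using i0 i1 by (simp add: std_normal_Ioi_first_moment upper_tail_def)
  have "x * max 0 (x - l) = indicator {l<..} x * (x\<^sup>2 - 1) - l * (indicator {l<..} x * x) + indicator {l<..} x" for x
    by (auto simp: indicator_def power2_eq_square algebra_simps)
  then show b: ?b using i0 i1 i2 by (simp add: std_normal_Ioi_first_moment std_normal_Ioi_second_moment upper_tail_def)
  show c: ?c using std_normal_integrable_id N.integrable_const[of l] N.prob_space by (simp add: std_normal_mean)
  have "x * (x - l) = x\<^sup>2 - l * x" for x by (simp add: power2_eq_square algebra_simps)
  then show d: ?d using std_normal_integrable_id std_normal_integrable_power[of 2]
    by (simp add: std_normal_mean std_normal_second_moment)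
  have "min 0 (x - l) = (x - l) - max 0 (x - l)" for x by (auto simp: min_def max_def)
  then show ?e using integrable_shifted_parts[of l] a c by simp
  have "x * min 0 (x - l) = x * (x - l) - x * max 0 (x - l)" for x by (auto simp: min_def max_def)
  then show ?f using integrable_shifted_parts[of l] b d by simp
qed

section \<open>The error function as the normal distribution function\<close>

lemma erf_has_derivative: "(erf has_real_derivative 2 / sqrt pi * exp (- t\<^sup>2)) (at t)"
proof -
  have "((\<lambda>u. LBINT s=ereal 0..ereal u. exp (- (s\<^sup>2))) has_vector_derivative exp (- t\<^sup>2))
     (at t within {min 0 t - 1..max 0 t + 1})"
    by (rule interval_integral_FTC2) (auto intro!: continuous_intros)
  then have "((\<lambda>u. LBINT s=ereal 0..ereal u. exp (- (s\<^sup>2))) has_real_derivative exp (- t\<^sup>2)) (at t)"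
    by (subst (asm) at_within_interior) (auto simp: has_real_derivative_iff_has_vector_derivative)
  from DERIV_cmult[OF this, of "2 / sqrt pi"] show ?thesis
    unfolding erf_def[abs_def] by simp
qed

lemma scaled_erf_has_derivative:
  "((\<lambda>x. erf (x / sqrt 2) / 2) has_real_derivative std_normal_density x) (at x)"
proof -
  have "((\<lambda>x. erf (x / sqrt 2)) has_real_derivative (2 / sqrt pi * exp (- (x / sqrt 2)\<^sup>2)) * (1 / sqrt 2)) (at x)"
    by (rule DERIV_chain2[where f=erf, OF erf_has_derivative DERIV_cdivide[OF DERIV_ident]])
  from DERIV_cdivide[OF this, of "2::real"] show ?thesis
    by (simp add: std_normal_density_def real_sqrt_mult power_divide mult.commute)
qed

lemma erf_0 [simp]: "erf 0 = 0"
  by (simp add: erf_def)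

lemma erf_strict_mono: "x < y \<Longrightarrow> erf x < erf y"
  by (rule DERIV_pos_imp_increasing) (use erf_has_derivative in \<open>auto intro!: exI\<close>)

lemma erf_minus: "erf (- t) = - erf t"
proof -
  have "((\<lambda>t. erf (- t) + erf t) has_real_derivative 0) (at t)" for t
    by (rule derivative_eq_intros DERIV_chain2[where f=erf, OF erf_has_derivative] erf_has_derivative refl)+ simp
  then have "erf (- t) + erf t = erf (- 0) + erf 0"
    using DERIV_isconst_all[of "\<lambda>t. erf (- t) + erf t" t 0] by blast
  then show ?thesis by simp
qed

lemma upper_tail_diff:
  assumes "a \<le> b"
  shows "upper_tail a - upper_tail b = erf (b / sqrt 2) / 2 - erf (a / sqrt 2) / 2"
proof -
  interpret N: prob_space std_normal by (rule prob_space_std_normal)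
  let ?F = "\<lambda>x. erf (x / sqrt 2) / 2"
  have "(LINT x|lborel. std_normal_density x * indicator {a..b} x) = ?F b - ?F a"
    by (rule integral_FTC_Icc_real)
       (use assms scaled_erf_has_derivative DERIV_isCont[OF std_normal_density_has_derivative] in auto)
  then have "(LINT x|std_normal. indicator {a..b} x) = ?F b - ?F a"
    by (subst std_normal_integral) simp_all
  moreover have "(LINT x|std_normal. indicator {a..b} x) = (LINT x|std_normal. indicator {a<..b} x :: real)"
  proof (rule integral_cong_AE)
    have "AE x in lborel. x \<noteq> a" by (rule AE_lborel_singleton)
    then have "AE x in std_normal. x \<noteq> a"
      unfolding std_normal_def by (subst AE_density) (auto elim: eventually_mono)
    then show "AE x in std_normal. indicator {a..b} x = (indicator {a<..b} x :: real)"
      by eventually_elim (auto simp: indicator_def)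
  qed auto
  moreover have "(LINT x|std_normal. indicator {a<..b} x) = upper_tail a - upper_tail b"
  proof -
    have "(LINT x|std_normal. indicator {a<..b} x) = (LINT x|std_normal. indicator {a<..} x - indicator {b<..} x :: real)"
      using assms by (intro Bochner_Integration.integral_cong) (auto simp: indicator_def)
    also have "\<dots> = upper_tail a - upper_tail b"
      unfolding upper_tail_def
      by (intro Bochner_Integration.integral_diff) (simp_all add: N.emeasure_eq_measure)
    finally show ?thesis .
  qed
  ultimately show ?thesis by simp
qed

lemma upper_tail_limits:
  "(\<lambda>n. upper_tail (real n)) \<longlonglongrightarrow> 0" "(\<lambda>n. upper_tail (- real n)) \<longlonglongrightarrow> 1"
proof -
  interpret N: prob_space std_normal by (rule prob_space_std_normal)
  have ut: "upper_tail l = measure std_normal {l<..}" for l by (simp add: upper_tail_def)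
  have "(\<lambda>n. measure std_normal {real n<..}) \<longlonglongrightarrow> measure std_normal (\<Inter>n. {real n<..})"
    by (rule N.finite_Lim_measure_decseq) (auto simp: decseq_def)
  moreover have "(\<Inter>n. {real n<..}) = {}"
    by auto (meson less_asym reals_Archimedean2)
  ultimately show "(\<lambda>n. upper_tail (real n)) \<longlonglongrightarrow> 0" by (simp add: ut)
  have "(\<lambda>n. measure std_normal {- real n<..}) \<longlonglongrightarrow> measure std_normal (\<Union>n. {- real n<..})"
    by (rule N.finite_Lim_measure_incseq) (auto simp: incseq_def)
  moreover have "(\<Union>n. {- real n<..}) = UNIV"
    by auto (metis minus_less_iff reals_Archimedean2)
  ultimately show "(\<lambda>n. upper_tail (- real n)) \<longlonglongrightarrow> 1"
    using N.prob_space by (simp add: ut)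
qed

text \<open>The normalization comes from total mass 1: by oddness, the normal mass between
  \<open>- n\<close> and \<open>n\<close> is \<open>erf (n / sqrt 2)\<close>.\<close>

lemma erf_limit: "(\<lambda>n. erf (real n / sqrt 2)) \<longlonglongrightarrow> 1"
proof -
  have "(\<lambda>n. upper_tail (- real n) - upper_tail (real n)) \<longlonglongrightarrow> 1 - 0"
    by (intro tendsto_intros upper_tail_limits)
  moreover have "upper_tail (- real n) - upper_tail (real n) = erf (real n / sqrt 2)" for n
    using upper_tail_diff[of "- real n" "real n"] by (simp add: erf_minus)
  ultimately show ?thesis by simp
qed

lemma upper_tail_erf: "upper_tail l = (1 - erf (l / sqrt 2)) / 2"
proof -
  have "(\<lambda>n. upper_tail (real n) + erf (real n / sqrt 2) / 2 - erf (l / sqrt 2) / 2) \<longlonglongrightarrow> 0 + 1 / 2 - erf (l / sqrt 2) / 2"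
    by (intro tendsto_intros upper_tail_limits erf_limit) simp_all
  moreover have "\<forall>\<^sub>F n in sequentially. upper_tail (real n) + erf (real n / sqrt 2) / 2 - erf (l / sqrt 2) / 2 = upper_tail l"
  proof -
    obtain m where "l \<le> real m" using real_arch_simple by blast
    then show ?thesis
      using upper_tail_diff[of l] by (intro eventually_sequentiallyI[of m]) (smt (verit) of_nat_mono)
  qed
  ultimately have "(\<lambda>n::nat. upper_tail l) \<longlonglongrightarrow> 0 + 1 / 2 - erf (l / sqrt 2) / 2"
    by (rule Lim_transform_eventually)
  then show ?thesis by (simp add: LIMSEQ_const_iff diff_divide_distrib)
qed

text \<open>The intermediate value theorem gives a preimage and strict monotonicity its uniqueness,
  so the definite description in \<open>erfinv\<close> denotes.\<close>

lemma erf_erfinv: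
  assumes "\<bar>y\<bar> < 1"
  shows "erf (erfinv y) = y"
proof -
  have "\<forall>\<^sub>F n in sequentially. \<bar>y\<bar> < erf (real n / sqrt 2)"
    using order_tendstoD(1)[OF erf_limit assms] .
  then obtain n :: nat where n: "\<bar>y\<bar> < erf (real n / sqrt 2)" by (auto simp: eventually_sequentially)
  let ?r = "real n / sqrt 2"
  have "\<exists>t. - ?r \<le> t \<and> t \<le> ?r \<and> erf t = y"
    using n DERIV_isCont[OF erf_has_derivative] erf_minus[of ?r]
    by (intro IVT) auto
  then obtain t where t: "erf t = y" by blast
  have "t' = t" if "erf t' = y" for t'
    using erf_strict_mono[of t t'] erf_strict_mono[of t' t] that t by linarith
  then show ?thesis unfolding erfinv_def using theI[of "\<lambda>t. erf t = y" t] t by blast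
qed

section \<open>The box program and its descent cone\<close>

text \<open>Feasible directions that do not raise the objective: zeros may only grow, ones may only
  shrink, and on the box the l1 norm is the coordinate sum. Fixing the coordinates from
  \<open>n\<close> on at 0 makes closed bounded parts compact as sets of functions on all
  naturals.\<close>

definition descent_cone :: "nat \<Rightarrow> nat \<Rightarrow> nat \<Rightarrow> (nat \<Rightarrow> real) set" where
  "descent_cone n z l = {w. (\<forall>i\<ge>n. w i = 0) \<and> (\<forall>i<z. 0 \<le> w i) \<and> (\<forall>i. z \<le> i \<longrightarrow> i < l \<longrightarrow> w i \<le> 0)
     \<and> (\<Sum>i<n. w i) \<le> 0}"

definition unit_descent :: "nat \<Rightarrow> nat \<Rightarrow> nat \<Rightarrow> (nat \<Rightarrow> real) set" where
  "unit_descent n z l = {w \<in> descent_cone n z l. (\<Sum>i<n. (w i)\<^sup>2) = 1}"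

lemma matvec_add: "matvec n A (\<lambda>j. v j + w j) i = matvec n A v i + matvec n A w i"
  by (simp add: matvec_def ring_distribs sum.distrib)

lemma matvec_diff: "matvec n A (\<lambda>j. v j - w j) i = matvec n A v i - matvec n A w i"
  by (simp add: matvec_def ring_distribs sum_subtractf)

lemma matvec_scale: "matvec n A (\<lambda>j. c * w j) i = c * matvec n A w i"
  by (simp add: matvec_def sum_distrib_left mult_ac)

lemma matvec_cong: "(\<And>j. j < n \<Longrightarrow> v j = w j) \<Longrightarrow> matvec n A v i = matvec n A w i"
  by (simp add: matvec_def)

lemma descent_cone_add:
  assumes "v \<in> descent_cone n z l" "w \<in> descent_cone n z l"
  shows "(\<lambda>i. v i + w i) \<in> descent_cone n z l"
  using assms unfolding descent_cone_def
  by (auto simp: sum.distrib intro: add_nonneg_nonneg add_nonpos_nonpos)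

lemma descent_cone_scale:
  assumes "w \<in> descent_cone n z l" "0 \<le> c"
  shows "(\<lambda>i. c * w i) \<in> descent_cone n z l"
  using assms unfolding descent_cone_def
  by (auto simp: sum_distrib_left[symmetric] mult_nonneg_nonpos)

lemma unit_descent_normalize:
  assumes w: "w \<in> descent_cone n z l" and nz: "L2_set w {..<n} \<noteq> 0"
  shows "(\<lambda>i. 1 / L2_set w {..<n} * w i) \<in> unit_descent n z l"
proof -
  have pos: "0 < L2_set w {..<n}" using nz by (simp add: less_le)
  have "(\<Sum>i<n. (1 / L2_set w {..<n} * w i)\<^sup>2) = (\<Sum>i<n. (w i)\<^sup>2) / (L2_set w {..<n})\<^sup>2"
    by (simp add: power_divide sum_divide_distrib)
  also have "(\<Sum>i<n. (w i)\<^sup>2) = (L2_set w {..<n})\<^sup>2" by (simp add: L2_set_def sum_nonneg)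
  finally show ?thesis
    using descent_cone_scale[OF w, of "1 / L2_set w {..<n}"] pos unfolding unit_descent_def by simp
qed

text \<open>A kernel vector in the cone, scaled down, can be added without leaving the box or
  raising the norm. Conversely, the difference to a feasible competitor of no larger norm lies in
  the kernel and in the cone, and can be normalized.\<close>

lemma box_unique_iff:
  assumes zl: "z \<le> l" "l \<le> n" and x0: "\<And>i. i < z \<Longrightarrow> x i = 0" and x1: "\<And>i. z \<le> i \<Longrightarrow> i < l \<Longrightarrow> x i = 1"
    and xf: "\<And>i. l \<le> i \<Longrightarrow> i < n \<Longrightarrow> 0 < x i \<and> x i < 1"
  shows "box_l1_unique_solution m n A (matvec n A x) x \<longleftrightarrow> \<not> (\<exists>w\<in>unit_descent n z l. \<forall>i<m. matvec n A w i = 0)"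
proof
  assume u: "box_l1_unique_solution m n A (matvec n A x) x"
  show "\<not> (\<exists>w\<in>unit_descent n z l. \<forall>i<m. matvec n A w i = 0)"
  proof
    assume "\<exists>w\<in>unit_descent n z l. \<forall>i<m. matvec n A w i = 0"
    then obtain w where w: "w \<in> unit_descent n z l" and Aw: "\<And>i. i < m \<Longrightarrow> matvec n A w i = 0" by blast
    have w2: "(\<Sum>i<n. (w i)\<^sup>2) = 1" and wc: "w \<in> descent_cone n z l" using w by (auto simp: unit_descent_def)
    have w1: "\<bar>w i\<bar> \<le> 1" if "i < n" for i
    proof -
      have "(w i)\<^sup>2 \<le> (\<Sum>i<n. (w i)\<^sup>2)" by (rule member_le_sum) (use that in auto)
      then show ?thesis using w2 abs_square_le_1[of "w i"] by simp
    qed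
    \<comment> \<open>The step length is the least distance of a fractional coordinate to 0 or 1.
      The entry 1 makes the minimum exist without such coordinates and keeps the moves away from 0
      and 1 inside the box.\<close>
    define M where "M = insert 1 ((\<lambda>i. min (x i) (1 - x i)) ` {l..<n})"
    define t where "t = Min M"
    have M: "finite M" "M \<noteq> {}" by (auto simp: M_def)
    have t0: "0 < t" unfolding t_def using M xf by (subst Min_gr_iff) (auto simp: M_def)
    have t1: "t \<le> 1" unfolding t_def by (rule Min_le) (auto simp: M_def)
    have tx: "t \<le> x i" "t \<le> 1 - x i" if "l \<le> i" "i < n" for i
    proof -
      have "t \<le> min (x i) (1 - x i)" unfolding t_def by (rule Min_le) (use that in \<open>auto simp: M_def\<close>)
      then show "t \<le> x i" "t \<le> 1 - x i" by auto
    qed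
    define v where "v i = x i + t * w i" for i
    have tw: "\<bar>t * w i\<bar> \<le> t" if "i < n" for i
      using w1[OF that] t0 by (simp add: abs_mult mult_left_le)
    have v01: "0 \<le> v i \<and> v i \<le> 1" if i: "i < n" for i
    proof -
      consider "i < z" | "z \<le> i" "i < l" | "l \<le> i" by linarith
      then show ?thesis
      proof cases
        case 1
        then have "0 \<le> t * w i" using wc t0 by (auto simp: descent_cone_def)
        then show ?thesis using tw[OF i] t1 x0[OF 1] by (auto simp: v_def)
      next
        case 2
        then have "t * w i \<le> 0" using wc t0 by (auto simp: descent_cone_def mult_nonneg_nonpos)
        then show ?thesis using tw[OF i] t1 x1[OF 2] by (auto simp: v_def)
      next
        case 3
        then show ?thesis using tw[OF i] tx[OF 3 i] by (auto simp: v_def abs_le_iff)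
      qed
    qed
    have x01: "0 \<le> x i" if "i < n" for i
      using that x0[of i] x1[of i] xf[of i] by (metis less_imp_le not_le order_refl zero_le_one)
    have "box_feasible m n A (matvec n A x) v"
      using v01 Aw unfolding box_feasible_def v_def by (auto simp: matvec_add matvec_scale)
    moreover have "\<exists>i<n. v i \<noteq> x i"
    proof (rule ccontr)
      assume "\<not> (\<exists>i<n. v i \<noteq> x i)"
      then have "\<forall>i<n. w i = 0" using t0 by (auto simp: v_def)
      then show False using w2 by simp
    qed
    ultimately have "l1norm n x < l1norm n v" using u unfolding box_l1_unique_solution_def by blast
    also have "l1norm n v = (\<Sum>i<n. x i) + t * (\<Sum>i<n. w i)"
      using v01 unfolding l1norm_def by (simp add: v_def sum.distrib sum_distrib_left)
    also have "\<dots> \<le> (\<Sum>i<n. x i)" using wc t0 by (auto simp: descent_cone_def mult_nonneg_nonpos)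
    also have "\<dots> = l1norm n x" using x01 unfolding l1norm_def by simp
    finally show False by simp
  qed
next
  assume nk: "\<not> (\<exists>w\<in>unit_descent n z l. \<forall>i<m. matvec n A w i = 0)"
  have x01: "0 \<le> x i \<and> x i \<le> 1" if "i < n" for i
    using that x0[of i] x1[of i] xf[of i] by (metis less_imp_le not_le order_refl zero_le_one)
  show "box_l1_unique_solution m n A (matvec n A x) x"
    unfolding box_l1_unique_solution_def
  proof (intro conjI allI impI)
    show "box_feasible m n A (matvec n A x) x" using x01 by (auto simp: box_feasible_def)
    fix v assume "box_feasible m n A (matvec n A x) v \<and> (\<exists>i<n. v i \<noteq> x i)"
    then have v01: "\<And>i. i < n \<Longrightarrow> 0 \<le> v i \<and> v i \<le> 1" and Av: "\<And>i. i < m \<Longrightarrow> matvec n A v i = matvec n A x i"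
      and ne: "\<exists>i<n. v i \<noteq> x i" by (auto simp: box_feasible_def)
    show "l1norm n x < l1norm n v"
    proof (rule ccontr)
      assume "\<not> l1norm n x < l1norm n v"
      moreover have "l1norm n v = (\<Sum>i<n. v i)" "l1norm n x = (\<Sum>i<n. x i)"
        unfolding l1norm_def using v01 x01 by simp_all
      ultimately have le: "(\<Sum>i<n. v i) \<le> (\<Sum>i<n. x i)" by simp
      define w where "w i = (if i < n then v i - x i else 0)" for i
      have "(\<Sum>i<n. w i) \<le> 0" using le by (simp add: w_def sum_subtractf)
      then have wc: "w \<in> descent_cone n z l"
        using v01 x0 x1 zl unfolding descent_cone_def w_def by auto
      have "L2_set w {..<n} \<noteq> 0" using ne by (auto simp: L2_set_eq_0_iff w_def)
      from unit_descent_normalize[OF wc this] nk obtain i where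
        "i < m" "matvec n A (\<lambda>j. 1 / L2_set w {..<n} * w j) i \<noteq> 0" by blast
      moreover have "matvec n A w i = matvec n A (\<lambda>j. v j - x j) i"
        by (rule matvec_cong) (simp add: w_def)
      ultimately show False using Av by (simp only: matvec_scale matvec_diff) simp
    qed
  qed
qed

section \<open>Compactness of the unit slice of the cone, measurability and separation\<close>

lemma continuous_on_coordinate: "continuous_on S (\<lambda>w::nat \<Rightarrow> real. w i)"
  by (rule continuous_on_subset[OF continuous_on_product_coordinates]) simp

lemma continuous_on_matvec: "continuous_on S (\<lambda>w. matvec n A w i)"
  unfolding matvec_def by (intro continuous_intros continuous_on_coordinate)

lemma compact_descent_ball:
  "compact {w \<in> descent_cone n z l. (\<Sum>i<n. (w i)\<^sup>2) \<le> R\<^sup>2}"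
proof -
  let ?B = "PiE UNIV (\<lambda>i::nat. {-\<bar>R\<bar>..\<bar>R\<bar>})"
  have "compactin (product_topology (\<lambda>i::nat. euclidean) UNIV) ?B"
    by (subst compactin_PiE) auto
  then have "compact ?B" by (simp only: euclidean_product_topology compactin_euclidean_iff)
  moreover have "closed {w \<in> descent_cone n z l. (\<Sum>i<n. (w i)\<^sup>2) \<le> R\<^sup>2}"
    unfolding descent_cone_def
    by (auto intro!: closed_Collect_conj closed_Collect_all closed_Collect_imp closed_Collect_le closed_Collect_eq
        continuous_intros continuous_on_coordinate simp: imp_conjL)
  ultimately have "compact (?B \<inter> {w \<in> descent_cone n z l. (\<Sum>i<n. (w i)\<^sup>2) \<le> R\<^sup>2})"
    by (rule compact_Int_closed)
  moreover have "{w \<in> descent_cone n z l. (\<Sum>i<n. (w i)\<^sup>2) \<le> R\<^sup>2} \<subseteq> ?B"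
  proof
    fix w assume w: "w \<in> {w \<in> descent_cone n z l. (\<Sum>i<n. (w i)\<^sup>2) \<le> R\<^sup>2}"
    have "\<bar>w i\<bar> \<le> \<bar>R\<bar>" for i
    proof (cases "i < n")
      case True
      then have "(w i)\<^sup>2 \<le> (\<Sum>i<n. (w i)\<^sup>2)" by (intro member_le_sum) auto
      then have "(w i)\<^sup>2 \<le> R\<^sup>2" using w by simp
      then show ?thesis by (simp add: abs_le_square_iff)
    next
      case False
      then show ?thesis using w by (simp add: descent_cone_def)
    qed
    then show "w \<in> ?B" by (auto simp: abs_le_iff minus_le_iff)
  qed
  ultimately show ?thesis by (simp add: Int_absorb1)
qed

lemma compact_unit_descent: "compact (unit_descent n z l)"
proof -
  have "closed {w :: nat \<Rightarrow> real. (\<Sum>i<n. (w i)\<^sup>2) = 1}"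
    by (intro closed_Collect_eq continuous_intros continuous_on_coordinate)
  from compact_Int_closed[OF compact_descent_ball[of n z l 1] this] show ?thesis
    by (rule back_subst[of compact]) (auto simp: unit_descent_def)
qed

lemma unit_descent_net:
  assumes "0 < \<eta>"
  obtains N where "finite N" "N \<subseteq> unit_descent n z l"
    "\<And>w. w \<in> unit_descent n z l \<Longrightarrow> \<exists>q\<in>N. L2_set (\<lambda>i. w i - q i) {..<n} \<le> \<eta>"
  by (rule finite_net_exists[of "{..<n}" "unit_descent n z l" \<eta>]) (use assms in \<open>auto simp: unit_descent_def\<close>)

lemma matvec_norm_le:
  "(\<Sum>i<m. (matvec n A w i)\<^sup>2) \<le> (\<Sum>i<m. \<Sum>j<n. (A (i,j))\<^sup>2) * (L2_set w {..<n})\<^sup>2"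
proof -
  have "(matvec n A w i)\<^sup>2 \<le> (\<Sum>j<n. (A (i,j))\<^sup>2) * (L2_set w {..<n})\<^sup>2" for i
  proof -
    have "\<bar>matvec n A w i\<bar> \<le> L2_set (\<lambda>j. A (i,j)) {..<n} * L2_set w {..<n}"
      unfolding matvec_def
      using inner_sum_le_L2_set[of "\<lambda>j. A (i,j)" w "{..<n}"] inner_sum_le_L2_set[of "\<lambda>j. - A (i,j)" w "{..<n}"]
      by (simp add: abs_le_iff sum_negf L2_set_def)
    then have "(matvec n A w i)\<^sup>2 \<le> (L2_set (\<lambda>j. A (i,j)) {..<n} * L2_set w {..<n})\<^sup>2"
      by (metis abs_ge_zero power2_abs power_mono)
    also have "\<dots> = (\<Sum>j<n. (A (i,j))\<^sup>2) * (L2_set w {..<n})\<^sup>2"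
      by (simp add: power_mult_distrib L2_set_def sum_nonneg)
    finally show ?thesis .
  qed
  then show ?thesis unfolding sum_distrib_right by (rule sum_mono)
qed

text \<open>The uncountable existential becomes countable: by compactness and continuity, the kernel
  meets the slice iff the squared norm of the image takes arbitrarily small values on the points of
  a sequence of finite nets.\<close>

lemma kernel_meets_measurable:
  "{A \<in> space (std_gauss ({..<m} \<times> {..<n})). \<exists>w\<in>unit_descent n z l. \<forall>i<m. matvec n A w i = 0}
    \<in> sets (std_gauss ({..<m} \<times> {..<n}))"
proof -
  let ?T = "unit_descent n z l" and ?M = "std_gauss ({..<m} \<times> {..<n})"
  have "\<exists>N. finite N \<and> N \<subseteq> ?T \<and> (\<forall>w\<in>?T. \<exists>q\<in>N. L2_set (\<lambda>i. w i - q i) {..<n} \<le> 1 / real (Suc k))" for k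
    by (rule unit_descent_net[of "1 / real (Suc k)" n z l]) auto
  then obtain N where N: "\<And>k. finite (N k)" "\<And>k. N k \<subseteq> ?T"
    "\<And>k w. w \<in> ?T \<Longrightarrow> \<exists>q\<in>N k. L2_set (\<lambda>i. w i - q i) {..<n} \<le> 1 / real (Suc k)" by metis
  let ?f = "\<lambda>A w. \<Sum>i<m. (matvec n A w i)\<^sup>2"
  have "{A \<in> space ?M. \<exists>w\<in>?T. \<forall>i<m. matvec n A w i = 0} =
      {A \<in> space ?M. \<forall>k. \<exists>k'. \<exists>w\<in>N k'. ?f A w \<le> 1 / real (Suc k)}" (is "?L = ?R")
  proof (intro set_eqI iffI)
    fix A assume "A \<in> ?L"
    then obtain w where A: "A \<in> space ?M" and w: "w \<in> ?T" "\<And>i. i < m \<Longrightarrow> matvec n A w i = 0" by blast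
    have "\<exists>k'. \<exists>w\<in>N k'. ?f A w \<le> 1 / real (Suc k)" for k
    proof -
      define S where "S = (\<Sum>i<m. \<Sum>j<n. (A (i,j))\<^sup>2)"
      have S0: "0 \<le> S" unfolding S_def by (intro sum_nonneg) auto
      define k' where "k' = nat \<lceil>S * real (Suc k)\<rceil>"
      have k': "S * real (Suc k) \<le> real (Suc k')" unfolding k'_def by linarith
      obtain q where q: "q \<in> N k'" "L2_set (\<lambda>i. w i - q i) {..<n} \<le> 1 / real (Suc k')" using N(3)[OF w(1)] by blast
      have "?f A q = ?f A (\<lambda>i. w i - q i)"
        by (rule sum.cong) (use w(2) in \<open>auto simp: matvec_diff\<close>)
      also have "\<dots> \<le> S * (L2_set (\<lambda>i. w i - q i) {..<n})\<^sup>2"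
        unfolding S_def by (rule matvec_norm_le)
      also have "\<dots> \<le> S * (1 / real (Suc k'))"
      proof (intro mult_left_mono S0)
        have "(L2_set (\<lambda>i. w i - q i) {..<n})\<^sup>2 \<le> (1 / real (Suc k'))\<^sup>2" by (intro power_mono q) simp
        also have "\<dots> \<le> 1 / real (Suc k')" using power_decreasing[of 1 2 "1 / real (Suc k')"] by simp
        finally show "(L2_set (\<lambda>i. w i - q i) {..<n})\<^sup>2 \<le> 1 / real (Suc k')" .
      qed
      also have "\<dots> \<le> 1 / real (Suc k)" using k' by (simp add: field_simps)
      finally show ?thesis using q(1) by blast
    qed
    then show "A \<in> ?R" using A by blast
  next
    fix A assume "A \<in> ?R"
    then have A: "A \<in> space ?M" and R: "\<And>k. \<exists>w\<in>?T. ?f A w \<le> 1 / real (Suc k)" using N(2) by blast+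
    have ne: "?T \<noteq> {}" using R[of 0] by blast
    have "continuous_on ?T (?f A)" by (intro continuous_intros continuous_on_matvec)
    then obtain w where w: "w \<in> ?T" "\<And>v. v \<in> ?T \<Longrightarrow> ?f A w \<le> ?f A v"
      using continuous_attains_inf[OF compact_unit_descent ne] by blast
    have "?f A w \<le> 0"
    proof (rule field_le_epsilon)
      fix e :: real assume "0 < e"
      then obtain k where "1 / real (Suc k) < e" using nat_approx_posE by blast
      moreover obtain v where "v \<in> ?T" "?f A v \<le> 1 / real (Suc k)" using R by blast
      ultimately show "?f A w \<le> 0 + e" using w(2)[of v] by simp
    qed
    then have "?f A w = 0" by (simp add: order_antisym sum_nonneg)
    then have "\<forall>i<m. matvec n A w i = 0" by (subst (asm) sum_nonneg_eq_0_iff) auto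
    then show "A \<in> ?L" using A w(1) by blast
  qed
  moreover have "(\<lambda>A. ?f A w) \<in> borel_measurable ?M" for w
    unfolding matvec_def
    by (intro borel_measurable_sum borel_measurable_power borel_measurable_times borel_measurable_const
        measurable_std_gauss_component) auto
  then have "?R \<in> sets ?M" using N(1) by measurable
  ultimately show ?thesis by simp
qed

text \<open>If the kernel misses the cone, then the image of the cone is closed, and it is not the whole space: otherwise
  \<open>- A w0\<close> would be in it. The vector is normal to the image at the nearest point to \<open>- A w0\<close>.\<close>

lemma separating_vector:
  assumes nk: "\<not> (\<exists>w\<in>unit_descent n z l. \<forall>i<m. matvec n A w i = 0)"
    and w0: "w0 \<in> descent_cone n z l" "(\<Sum>i<n. w0 i) < 0"
  obtains u where "(\<Sum>i<m. (u i)\<^sup>2) = 1" "\<And>w. w \<in> unit_descent n z l \<Longrightarrow> (\<Sum>i<m. u i * matvec n A w i) \<le> 0"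
proof -
  let ?T = "unit_descent n z l" and ?C = "descent_cone n z l"
  let ?f = "\<lambda>w. L2_set (matvec n A w) {..<m}"
  have normw: "L2_set w {..<n} \<noteq> 0" if "(\<Sum>i<n. w i) < 0" for w
  proof
    assume "L2_set w {..<n} = 0"
    then have "\<forall>i<n. w i = 0" by (simp add: L2_set_eq_0_iff)
    then show False using that by simp
  qed
  have neT: "?T \<noteq> {}" using unit_descent_normalize[OF w0(1) normw[OF w0(2)]] by blast
  have cf: "continuous_on S ?f" for S
    unfolding L2_set_def by (intro continuous_intros continuous_on_matvec)
  obtain w1 where w1: "w1 \<in> ?T" "\<And>v. v \<in> ?T \<Longrightarrow> ?f w1 \<le> ?f v"
    using continuous_attains_inf[OF compact_unit_descent neT cf] by blast
  define c where "c = ?f w1"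
  have c: "0 < c"
  proof -
    have "c \<noteq> 0" using nk w1(1) unfolding c_def by (auto simp: L2_set_eq_0_iff)
    then show ?thesis unfolding c_def by (simp add: less_le)
  qed
  \<comment> \<open>By homogeneity the positive minimum over the slice controls the whole unbounded
    cone; this makes a nearest point exist.\<close>
  have coercive: "c * L2_set w {..<n} \<le> ?f w" if w: "w \<in> ?C" for w
  proof (cases "L2_set w {..<n} = 0")
    case False
    then have pos: "0 < L2_set w {..<n}" by (simp add: less_le)
    have "c \<le> ?f (\<lambda>i. 1 / L2_set w {..<n} * w i)"
      unfolding c_def by (rule w1(2)[OF unit_descent_normalize[OF w False]])
    also have "\<dots> = 1 / L2_set w {..<n} * ?f w"
      using pos by (simp only: matvec_scale[abs_def]) (subst L2_set_right_distrib[symmetric], auto)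
    finally show ?thesis using pos by (simp add: field_simps)
  qed simp
  define y where "y i = - matvec n A w0 i" for i
  let ?g = "\<lambda>w. L2_set (\<lambda>i. y i - matvec n A w i) {..<m}"
  \<comment> \<open>Beyond this radius the image has norm above twice that of \<open>y\<close>, so
    it is farther from \<open>y\<close> than the image of 0. The nearest point can be sought in a
    compact ball.\<close>
  define R where "R = 2 * L2_set y {..<m} / c"
  let ?K = "{w \<in> ?C. (\<Sum>i<n. (w i)\<^sup>2) \<le> R\<^sup>2}"
  have zC: "(\<lambda>i. 0) \<in> ?C" by (simp add: descent_cone_def)
  then have "(\<lambda>i. 0) \<in> ?K" by simp
  then have neK: "?K \<noteq> {}" by blast
  have cg: "continuous_on S ?g" for S
    unfolding L2_set_def by (intro continuous_intros continuous_on_matvec)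
  obtain ws where ws: "ws \<in> ?K" "\<And>v. v \<in> ?K \<Longrightarrow> ?g ws \<le> ?g v"
    using continuous_attains_inf[OF compact_descent_ball neK cg] by blast
  have R0: "0 \<le> R" unfolding R_def using c by simp
  have min: "?g ws \<le> ?g v" if v: "v \<in> ?C" for v
  proof (cases "v \<in> ?K")
    case False
    then have "R\<^sup>2 < (\<Sum>i<n. (v i)\<^sup>2)" using v by auto
    then have "R < L2_set v {..<n}" unfolding L2_set_def using R0 by (simp add: real_less_rsqrt)
    then have "2 * L2_set y {..<m} < c * L2_set v {..<n}" using c by (simp add: R_def field_simps)
    also have "\<dots> \<le> ?f v" by (rule coercive[OF v])
    also have "?f v \<le> L2_set y {..<m} + ?g v"
      using L2_set_triangle_ineq[of y "\<lambda>i. - (y i - matvec n A v i)" "{..<m}"]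
      by (simp add: L2_set_def power2_commute)
    finally have "L2_set y {..<m} < ?g v" by simp
    moreover have "?g ws \<le> ?g (\<lambda>i. 0)" by (rule ws(2)) (use zC in simp)
    moreover have "?g (\<lambda>i. 0) = L2_set y {..<m}" by (simp add: matvec_def)
    ultimately show ?thesis by linarith
  qed (rule ws(2))
  define r where "r i = y i - matvec n A ws i" for i
  have rw: "(\<Sum>i<m. r i * matvec n A w i) \<le> 0" if w: "w \<in> ?C" for w
  proof -
    \<comment> \<open>First-order condition at the nearest point: moving by \<open>t * w\<close>
      stays in the cone and cannot shorten the distance, and the quadratic term disappears as
      \<open>t\<close> tends to 0.\<close>
    have le: "2 * (\<Sum>i<m. r i * matvec n A w i) \<le> t * (\<Sum>i<m. (matvec n A w i)\<^sup>2)" if t: "0 < t" for t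
    proof -
      have "(\<lambda>i. ws i + t * w i) \<in> ?C" using ws w t by (intro descent_cone_add descent_cone_scale) auto
      from min[OF this] have "(\<Sum>i<m. (r i)\<^sup>2) \<le> (\<Sum>i<m. (y i - (matvec n A ws i + t * matvec n A w i))\<^sup>2)"
        unfolding L2_set_def r_def matvec_add matvec_scale by simp
      also have "\<dots> = (\<Sum>i<m. (r i)\<^sup>2 + t * (t * (matvec n A w i)\<^sup>2 - 2 * (r i * matvec n A w i)))"
        by (rule sum.cong) (auto simp: r_def power2_eq_square algebra_simps)
      also have "\<dots> = (\<Sum>i<m. (r i)\<^sup>2) + t * (t * (\<Sum>i<m. (matvec n A w i)\<^sup>2) - 2 * (\<Sum>i<m. r i * matvec n A w i))"
        by (simp only: sum.distrib sum_distrib_left[symmetric] sum_subtractf)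
      finally have "0 \<le> t * (t * (\<Sum>i<m. (matvec n A w i)\<^sup>2) - 2 * (\<Sum>i<m. r i * matvec n A w i))" by simp
      then show ?thesis using t by (simp add: zero_le_mult_iff)
    qed
    have "2 * (\<Sum>i<m. r i * matvec n A w i) \<le> 0"
    proof (rule field_le_epsilon)
      fix e :: real assume e: "0 < e"
      define S where "S = (\<Sum>i<m. (matvec n A w i)\<^sup>2)"
      have S: "0 \<le> S" unfolding S_def by (rule sum_nonneg) simp
      have "2 * (\<Sum>i<m. r i * matvec n A w i) \<le> e / (S + 1) * S"
        using le[of "e / (S + 1)"] e S unfolding S_def by simp
      also have "\<dots> \<le> e" using e S by (simp add: field_simps)
      finally show "2 * (\<Sum>i<m. r i * matvec n A w i) \<le> 0 + e" by simp
    qed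
    then show ?thesis by simp
  qed
  have r0: "L2_set r {..<m} \<noteq> 0"
  proof
    assume "L2_set r {..<m} = 0"
    then have rz: "\<And>i. i < m \<Longrightarrow> r i = 0" by (simp add: L2_set_eq_0_iff)
    let ?w = "\<lambda>i. w0 i + ws i"
    have wC: "?w \<in> ?C" using ws w0 by (intro descent_cone_add) auto
    have "(\<Sum>i<n. ws i) \<le> 0" using ws by (simp add: descent_cone_def)
    then have "(\<Sum>i<n. ?w i) < 0" using w0(2) by (simp add: sum.distrib)
    from unit_descent_normalize[OF wC normw[OF this]] nk obtain i where
      "i < m" "matvec n A (\<lambda>j. 1 / L2_set ?w {..<n} * ?w j) i \<noteq> 0" by blast
    moreover have "matvec n A ?w i = - r i" by (simp add: matvec_add r_def y_def)
    ultimately show False using rz by (simp only: matvec_scale)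
  qed
  show ?thesis
  proof
    have "(\<Sum>i<m. (r i / L2_set r {..<m})\<^sup>2) = (\<Sum>i<m. (r i)\<^sup>2) / (L2_set r {..<m})\<^sup>2"
      by (simp add: power_divide sum_divide_distrib)
    also have "(\<Sum>i<m. (r i)\<^sup>2) = (L2_set r {..<m})\<^sup>2" by (simp add: L2_set_def sum_nonneg)
    finally show "(\<Sum>i<m. (r i / L2_set r {..<m})\<^sup>2) = 1" using r0 by simp
    fix w assume "w \<in> ?T"
    then have "(\<Sum>i<m. r i * matvec n A w i) / L2_set r {..<m} \<le> 0"
      by (intro divide_nonpos_nonneg rw) (auto simp: unit_descent_def)
    then show "(\<Sum>i<m. r i / L2_set r {..<m} * matvec n A w i) \<le> 0"
      by (simp add: sum_divide_distrib)
  qed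
qed

section \<open>Projection of a Gaussian vector onto the descent cone\<close>

abbreviation tail_event :: "'k set \<Rightarrow> nat \<Rightarrow> (nat \<Rightarrow> 'k) \<Rightarrow> (nat \<Rightarrow> real \<Rightarrow> real) \<Rightarrow> real \<Rightarrow> ('k \<Rightarrow> real) set" where
  "tail_event K N r f b \<equiv> {\<omega> \<in> space (std_gauss K). b \<le> (\<Sum>i<N. f i (\<omega> (r i)))}"

text \<open>Lower tails are covered as upper tails of the negated functions. All embeddings
  \<open>r\<close> are treated at once because the two halves place the index ranges in opposite
  summands of a disjoint sum. Measurability is included because \<open>measure\<close> is 0 by
  default on a nonmeasurable set.\<close>

abbreviation tails_decay :: "(nat \<Rightarrow> nat) \<Rightarrow> (nat \<Rightarrow> nat \<Rightarrow> real \<Rightarrow> real) \<Rightarrow> real \<Rightarrow> real \<Rightarrow> bool" where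
  "tails_decay N f \<tau> c \<equiv> \<forall>\<^sub>F n in sequentially. \<forall>(K :: (nat + nat) set) r. inj_on r {..<N n} \<longrightarrow> r \<in> {..<N n} \<rightarrow> K \<longrightarrow>
    tail_event K (N n) r (f n) (\<tau> * real n) \<in> sets (std_gauss K) \<and>
    measure (std_gauss K) (tail_event K (N n) r (f n) (\<tau> * real n)) \<le> exp (- c * real n)"

text \<open>Half of the gap \<open>\<tau> - v\<close> absorbs the distance of the finite means from
  their limit, the other half is the allowed deviation. As \<open>M\<close> eventually bounds
  \<open>N n / n\<close>, the deviation \<open>\<epsilon> / M\<close> per coordinate adds up to
  \<open>\<epsilon> * n\<close>.\<close>

lemma chernoff_eventually:
  fixes f :: "nat \<Rightarrow> nat \<Rightarrow> real \<Rightarrow> real" and N :: "nat \<Rightarrow> nat"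
  assumes a: "0 < a" and N: "(\<lambda>n. real (N n) / real n) \<longlonglongrightarrow> \<nu>"
    and meas: "\<And>n i. f n i \<in> borel_measurable borel" and le: "\<And>n i x. \<bar>f n i x\<bar> \<le> a * (1 + x\<^sup>2)"
    and mean: "(\<lambda>n. (\<Sum>i<N n. integral\<^sup>L std_normal (f n i)) / real n) \<longlonglongrightarrow> v" and \<tau>: "v < \<tau>"
  shows "\<exists>c>0. tails_decay N f \<tau> c"
proof -
  define \<epsilon> where "\<epsilon> = (\<tau> - v) / 2"
  have \<epsilon>: "0 < \<epsilon>" using \<tau> by (simp add: \<epsilon>_def)
  define M where "M = \<bar>\<nu>\<bar> + 1"
  have M: "0 < M" "\<nu> < M" by (auto simp: M_def)
  obtain c where c: "0 < c" and ch: "\<forall>(J :: nat set) (K :: (nat + nat) set) r f N. finite J \<longrightarrow> inj_on r J \<longrightarrow> r \<in> J \<rightarrow> K \<longrightarrow>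
    real (card J) \<le> N \<longrightarrow> (\<forall>j\<in>J. f j \<in> borel_measurable borel) \<longrightarrow>
    (\<forall>j\<in>J. \<forall>x. \<bar>f j x\<bar> \<le> a * (1 + x\<^sup>2)) \<longrightarrow>
    {\<omega> \<in> space (std_gauss K). (\<Sum>j\<in>J. integral\<^sup>L std_normal (f j)) + \<epsilon> / M * N \<le> (\<Sum>j\<in>J. f j (\<omega> (r j)))} \<in> sets (std_gauss K) \<and>
    measure (std_gauss K) {\<omega> \<in> space (std_gauss K).
      (\<Sum>j\<in>J. integral\<^sup>L std_normal (f j)) + \<epsilon> / M * N \<le> (\<Sum>j\<in>J. f j (\<omega> (r j)))} \<le> exp (- c * N)"
    using chernoff_bound_quadratic[OF a divide_pos_pos[OF \<epsilon> M(1)], where 'j=nat and 'k="nat + nat"] by (elim exE conjE) (rule that)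
  have e1: "\<forall>\<^sub>F n in sequentially. real (N n) / real n < M" by (rule order_tendstoD(2)[OF N M(2)])
  have e2: "\<forall>\<^sub>F n in sequentially. (\<Sum>i<N n. integral\<^sup>L std_normal (f n i)) / real n < v + \<epsilon>"
    by (rule order_tendstoD(2)[OF mean]) (use \<epsilon> in simp)
  show ?thesis
  proof (intro exI[of _ "c * M"] conjI)
    show "0 < c * M" using c M by simp
    show "tails_decay N f \<tau> (c * M)"
      using e1 e2 eventually_gt_at_top[of 0]
    proof eventually_elim
      case (elim n)
      show ?case
      proof (intro allI impI)
        fix K :: "(nat + nat) set" and r assume r: "inj_on r {..<N n}" "r \<in> {..<N n} \<rightarrow> K"
        interpret P: prob_space "std_gauss K" by (rule prob_space_std_gauss)
        have card: "real (card {..<N n}) \<le> M * real n" using elim by (simp add: field_simps)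
        have sm: "(\<Sum>i<N n. integral\<^sup>L std_normal (f n i)) + \<epsilon> / M * (M * real n) \<le> \<tau> * real n"
        proof -
          have "(\<Sum>i<N n. integral\<^sup>L std_normal (f n i)) \<le> (v + \<epsilon>) * real n"
            using elim by (simp add: divide_less_eq less_imp_le)
          moreover have "\<epsilon> / M * (M * real n) = \<epsilon> * real n" using M by simp
          moreover have "(v + \<epsilon>) * real n + \<epsilon> * real n = \<tau> * real n"
          proof -
            have "v + \<epsilon> + \<epsilon> = \<tau>" by (simp add: \<epsilon>_def field_simps)
            then show ?thesis by (simp only: distrib_right[symmetric])
          qed
          ultimately show ?thesis by linarith
        qed
        let ?B = "tail_event K (N n) r (f n) (\<tau> * real n)"
        let ?B' = "{\<omega> \<in> space (std_gauss K). (\<Sum>i<N n. integral\<^sup>L std_normal (f n i)) + \<epsilon> / M * (M * real n) \<le> (\<Sum>i<N n. f n i (\<omega> (r i)))}"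
        have B': "?B' \<in> sets (std_gauss K) \<and> measure (std_gauss K) ?B' \<le> exp (- c * (M * real n))"
          by (rule ch[THEN spec, of "{..<N n}", THEN spec, of K, THEN spec, of r, THEN spec, of "f n", THEN spec, of "M * real n",
                THEN mp, THEN mp, THEN mp, THEN mp, THEN mp, THEN mp])
             (intro r card ballI allI meas le finite_lessThan)+
        have "(\<lambda>\<omega>. \<Sum>i<N n. f n i (\<omega> (r i))) \<in> borel_measurable (std_gauss K)"
          by (intro borel_measurable_sum measurable_compose[OF measurable_std_gauss_component meas]) (use r in auto)
        then have B: "?B \<in> sets (std_gauss K)" by measurable
        have "?B \<subseteq> ?B'" by (blast intro: order_trans[OF sm])
        then have "measure (std_gauss K) ?B \<le> measure (std_gauss K) ?B'"
          by (rule P.finite_measure_mono[OF _ conjunct1[OF B']])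
        also have "\<dots> \<le> exp (- c * (M * real n))" by (rule conjunct2[OF B'])
        also have "- c * (M * real n) = - (c * M) * real n" by (simp only: mult.assoc mult_minus_left)
        finally show "?B \<in> sets (std_gauss K) \<and> measure (std_gauss K) ?B \<le> exp (- (c * M) * real n)"
          by (rule conjI[OF B])
      qed
    qed
  qed
qed

text \<open>Half of the rate pays for a constant, later the number of exceptional events divided by
  the tail probability of the auxiliary Gaussian.\<close>

lemma eventually_const_times_exp_le:
  assumes "0 < c"
  shows "\<forall>\<^sub>F n in sequentially. C * exp (- c * real n) \<le> exp (- (c / 2) * real n)"
proof -
  have "filterlim (\<lambda>n. exp (c / 2 * real n)) at_top sequentially"
    using assms by real_asymp
  then have "\<forall>\<^sub>F n in sequentially. C \<le> exp (c / 2 * real n)"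
    by (simp add: filterlim_at_top)
  then show ?thesis
  proof eventually_elim
    case (elim n)
    have "C * exp (- c * real n) \<le> exp (c / 2 * real n) * exp (- c * real n)"
      by (rule mult_right_mono[OF elim]) simp
    also have "\<dots> = exp (- (c / 2) * real n)" by (simp add: exp_add[symmetric] field_simps)
    finally show ?case .
  qed
qed

text \<open>Let \<open>S\<close> be the cone of the sign conditions in the definition of \<^const>\<open>descent_cone\<close>. The map \<open>soft t\<close> sends
  \<open>x\<close> to \<open>x\<close> minus its nearest point in the polar cone of \<open>S\<close> shifted by the constant vector \<open>t\<close>. When \<open>t\<close>
  is the optimal multiplier of the constraint on the sum, this is the projection of \<open>x\<close> onto the descent cone.\<close>

definition soft :: "real \<Rightarrow> nat \<Rightarrow> nat \<Rightarrow> nat \<Rightarrow> real \<Rightarrow> real" where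
  "soft t z l i x = (if i < z then max 0 (x - t) else if i < l then min 0 (x - t) else x - t)"

text \<open>The value is always 0 or \<open>x - t\<close>, so its square is its product with
  \<open>x - t\<close>. The mean squared norm thereby follows from the means of \<open>soft\<close>
  and of \<open>x * soft\<close>.\<close>

lemma soft_square: "(soft t z l i x)\<^sup>2 = x * soft t z l i x - t * soft t z l i x"
  by (auto simp: soft_def max_def min_def power2_eq_square algebra_simps)

lemma soft_measurable [measurable]: "soft t z l i \<in> borel_measurable borel"
  unfolding soft_def[abs_def] by measurable

text \<open>One constant for all three functions, so that the same concentration bound applies to
  each.\<close>

lemma soft_bounds:
  "\<bar>soft t z l i x\<bar> \<le> (4 * (1 + t\<^sup>2)) * (1 + x\<^sup>2)"
  "\<bar>x * soft t z l i x\<bar> \<le> (4 * (1 + t\<^sup>2)) * (1 + x\<^sup>2)"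
  "\<bar>(soft t z l i x)\<^sup>2\<bar> \<le> (4 * (1 + t\<^sup>2)) * (1 + x\<^sup>2)"
proof -
  have s: "\<bar>soft t z l i x\<bar> \<le> \<bar>x - t\<bar>" by (auto simp: soft_def)
  have 1: "\<bar>x - t\<bar> \<le> \<bar>x\<bar> + \<bar>t\<bar>" by simp
  have x: "2 * \<bar>x\<bar> \<le> 1 + x\<^sup>2" "2 * \<bar>t\<bar> \<le> 1 + t\<^sup>2" "2 * (\<bar>x\<bar> * \<bar>t\<bar>) \<le> x\<^sup>2 + t\<^sup>2"
    using sum_squares_bound[of 1 "\<bar>x\<bar>"] sum_squares_bound[of 1 "\<bar>t\<bar>"] sum_squares_bound[of "\<bar>x\<bar>" "\<bar>t\<bar>"] by simp_all
  have e: "(4 * (1 + t\<^sup>2)) * (1 + x\<^sup>2) = 4 + 4 * x\<^sup>2 + 4 * t\<^sup>2 + 4 * (t\<^sup>2 * x\<^sup>2)" by (simp add: algebra_simps)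
  have nn: "0 \<le> t\<^sup>2 * x\<^sup>2" "0 \<le> x\<^sup>2" "0 \<le> t\<^sup>2" by simp_all
  show "\<bar>soft t z l i x\<bar> \<le> (4 * (1 + t\<^sup>2)) * (1 + x\<^sup>2)" unfolding e using s 1 x nn by linarith
  have "\<bar>x * soft t z l i x\<bar> \<le> \<bar>x\<bar> * (\<bar>x\<bar> + \<bar>t\<bar>)"
    unfolding abs_mult using s 1 by (intro mult_left_mono) auto
  also have "\<dots> = x\<^sup>2 + \<bar>x\<bar> * \<bar>t\<bar>" by (simp add: power2_eq_square algebra_simps flip: abs_mult)
  finally show "\<bar>x * soft t z l i x\<bar> \<le> (4 * (1 + t\<^sup>2)) * (1 + x\<^sup>2)" unfolding e using x nn by linarith
  have "\<bar>(soft t z l i x)\<^sup>2\<bar> \<le> (\<bar>x\<bar> + \<bar>t\<bar>)\<^sup>2"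
    using power_mono[of "\<bar>soft t z l i x\<bar>" "\<bar>x\<bar> + \<bar>t\<bar>" 2] s 1 by simp
  also have "\<dots> = x\<^sup>2 + t\<^sup>2 + 2 * (\<bar>x\<bar> * \<bar>t\<bar>)" by (simp add: power2_sum)
  finally show "\<bar>(soft t z l i x)\<^sup>2\<bar> \<le> (4 * (1 + t\<^sup>2)) * (1 + x\<^sup>2)" unfolding e using x nn by linarith
qed

lemma soft_integrals:
  "(LINT x|std_normal. soft t z l i x) = (if i < z then std_normal_density t - t * upper_tail t
     else if i < l then - t - (std_normal_density t - t * upper_tail t) else - t)"
  "(LINT x|std_normal. x * soft t z l i x) = (if i < z then upper_tail t else if i < l then 1 - upper_tail t else 1)"
  by (auto simp: soft_def shifted_part_integrals)

lemma soft_integrable: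
  "integrable std_normal (soft t z l i)" "integrable std_normal (\<lambda>x. x * soft t z l i x)"
  unfolding soft_def[abs_def] by (cases "i < z"; cases "i < l"; simp add: integrable_shifted_parts)+

text \<open>Weak duality for the projection onto the descent cone: the multiplier \<open>t\<close> need not be optimal here.\<close>

lemma inner_unit_descent_le:
  assumes w: "w \<in> unit_descent n z l" and t: "0 \<le> t"
  shows "(\<Sum>i<n. w i * x i) \<le> L2_set (\<lambda>i. soft t z l i (x i)) {..<n}"
proof -
  have wc: "w \<in> descent_cone n z l" and w2: "(\<Sum>i<n. (w i)\<^sup>2) = 1" using w by (auto simp: unit_descent_def)
  have "(\<Sum>i<n. w i * x i) \<le> (\<Sum>i<n. w i * soft t z l i (x i) + t * w i)"
  proof (rule sum_mono)
    fix i
    have "w i * (x i - soft t z l i (x i)) \<le> w i * t"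
    proof -
      consider "i < z" | "\<not> i < z" "i < l" | "\<not> i < z" "\<not> i < l" by blast
      then show ?thesis
      proof cases
        case 1
        then show ?thesis using wc t by (intro mult_left_mono) (auto simp: soft_def descent_cone_def)
      next
        case 2
        then show ?thesis using wc t by (intro mult_left_mono_neg) (auto simp: soft_def descent_cone_def)
      qed (simp add: soft_def)
    qed
    then show "w i * x i \<le> w i * soft t z l i (x i) + t * w i" by (simp add: algebra_simps)
  qed
  also have "\<dots> = (\<Sum>i<n. w i * soft t z l i (x i)) + t * (\<Sum>i<n. w i)"
    by (simp add: sum.distrib sum_distrib_left)
  also have "\<dots> \<le> (\<Sum>i<n. w i * soft t z l i (x i))" using wc t by (auto simp: descent_cone_def mult_nonneg_nonpos)
  also have "\<dots> \<le> L2_set w {..<n} * L2_set (\<lambda>i. soft t z l i (x i)) {..<n}" by (rule inner_sum_le_L2_set)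
  also have "L2_set w {..<n} = 1" by (simp add: L2_set_def w2)
  finally show ?thesis by simp
qed

lemma soft_in_descent_cone:
  assumes "z \<le> l" "l \<le> n" "(\<Sum>i<n. soft t z l i (x i)) \<le> 0"
  shows "(\<lambda>i. if i < n then soft t z l i (x i) else 0) \<in> descent_cone n z l"
  using assms unfolding descent_cone_def by (auto simp: soft_def)

text \<open>The existential runs over descent vectors, so these form the first index set and the
  matrix is transposed. Off the two tail events every \<open>w\<close> has inner product at most
  \<open>sqrt a\<close> with the \<open>n\<close>-dimensional Gaussian vector, while some net vector
  reaches \<open>(1 - \<eta>) * sqrt (- b)\<close> against the other one; by \<open>num\<close> the
  comparison event fails.\<close>

lemma kernel_meets_bound:
  fixes n m z l :: nat
  defines "T \<equiv> unit_descent n z l" and "K \<equiv> {..<n} <+> {..<m}"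
  assumes t: "0 \<le> t" and \<eta>: "0 < \<eta>" "\<eta> < 1" and num: "1 + sqrt a \<le> (1 - \<eta>) * sqrt (- b)"
    and b: "b \<le> 0"
    and B1: "tail_event K m Inr (\<lambda>i x. - x\<^sup>2) b \<in> sets (std_gauss K)" (is "?B1 \<in> _")
    and B2: "tail_event K n Inl (\<lambda>i x. (soft t z l i x)\<^sup>2) a \<in> sets (std_gauss K)" (is "?B2 \<in> _")
  shows "measure (std_gauss ({..<m} \<times> {..<n})) {A \<in> space (std_gauss ({..<m} \<times> {..<n})). \<exists>w\<in>T. \<forall>i<m. matvec n A w i = 0}
      * measure std_normal {..-2} \<le>
    measure (std_gauss K) (tail_event K m Inr (\<lambda>i x. - x\<^sup>2) b)
    + measure (std_gauss K) (tail_event K n Inl (\<lambda>i x. (soft t z l i x)\<^sup>2) a)"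
proof -
  let ?E = "{A \<in> space (std_gauss ({..<m} \<times> {..<n})). \<exists>w\<in>T. \<forall>i<m. matvec n A w i = 0}"
  let ?E' = "{B \<in> space (std_gauss ({..<n} \<times> {..<m})). (\<lambda>ij\<in>{..<m}\<times>{..<n}. B (prod.swap ij)) \<in> ?E}"
  have E: "?E \<in> sets (std_gauss ({..<m} \<times> {..<n}))" unfolding T_def by (rule kernel_meets_measurable)
  have sw: "inj_on prod.swap ({..<m}\<times>{..<n})" "prod.swap \<in> {..<m}\<times>{..<n} \<rightarrow> {..<n} \<times> {..<m}" by auto
  have E': "?E' \<in> sets (std_gauss ({..<n} \<times> {..<m}))"
    using measurable_sets[OF measurable_std_gauss_reindex[OF sw(2)] E] by (simp add: vimage_def Int_def conj_commute)
  obtain Q where Q: "finite Q" "Q \<subseteq> {q. (\<Sum>i<m. (q i)\<^sup>2) = 1}"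
    "\<And>p. p \<in> {q. (\<Sum>i<m. (q i)\<^sup>2) = 1} \<Longrightarrow> \<exists>q\<in>Q. L2_set (\<lambda>i. p i - q i) {..<m} \<le> \<eta>"
    by (rule finite_net_exists[of "{..<m}" "{q. (\<Sum>i<m. (q i)\<^sup>2) = 1}" \<eta>]) (use \<eta> in auto)
  have "measure (std_gauss ({..<n} \<times> {..<m})) ?E' * measure std_normal {..-2} \<le> measure (std_gauss ({..<n} <+> {..<m})) (?B1 \<union> ?B2)"
  \<comment> \<open>Replacing \<open>w\<close> by \<open>- w\<close> preserves the kernel condition
    and gives the Gaussian term the sign for which an upper bound on its inner product with
    \<open>w\<close> is the useful one.\<close>
  proof (rule gordon_bilinear[where P="(\<lambda>w i. - w i) ` T" and Q=Q])
    show "(\<Sum>i<n. (p i)\<^sup>2) = 1" if "p \<in> (\<lambda>w i. - w i) ` T" for p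
      using that by (auto simp: T_def unit_descent_def)
    show "(\<Sum>j<m. (q j)\<^sup>2) = 1" if "q \<in> Q" for q using that Q by auto
    show "?E' \<in> sets (std_gauss ({..<n} \<times> {..<m}))" by (rule E')
    show "?B1 \<union> ?B2 \<in> sets (std_gauss ({..<n} <+> {..<m}))" using B1 B2 unfolding K_def by (rule sets.Un)
    fix B assume "B \<in> ?E'"
    then obtain w where w: "w \<in> T" "\<And>i. i < m \<Longrightarrow> matvec n (\<lambda>ij\<in>{..<m}\<times>{..<n}. B (prod.swap ij)) w i = 0" by blast
    have 0: "(\<Sum>j<n. B (j,i) * w j) = 0" if i: "i < m" for i
      using w(2)[OF i] i by (simp add: matvec_def)
    have "(\<Sum>(i,j)\<in>{..<n}\<times>{..<m}. - w i * q j * B (i,j)) = 0" for q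
    proof -
      have "(\<Sum>(i,j)\<in>{..<n}\<times>{..<m}. - w i * q j * B (i,j)) = (\<Sum>j<m. \<Sum>i<n. - w i * q j * B (i,j))"
        by (simp only: sum.cartesian_product[symmetric]) (rule sum.swap)
      also have "\<dots> = (\<Sum>j<m. - q j * (\<Sum>i<n. B (i,j) * w i))"
        unfolding sum_distrib_left by (intro sum.cong refl) (simp add: mult_ac)
      also have "\<dots> = 0" using 0 by simp
      finally show ?thesis .
    qed
    then show "\<exists>p\<in>(\<lambda>w i. - w i) ` T. \<forall>q\<in>Q. (\<Sum>(i,j)\<in>{..<n}\<times>{..<m}. p i * q j * B (i,j)) \<le> 0"
      using w(1) by (intro bexI[of _ "\<lambda>i. - w i"]) auto
  next
    fix \<omega> p assume \<omega>: "\<omega> \<in> space (std_gauss ({..<n} <+> {..<m}))" and p: "p \<in> (\<lambda>w i. - w i) ` T"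
      and less: "\<And>q. q \<in> Q \<Longrightarrow> (\<Sum>i<n. p i * \<omega> (Inl i)) + (\<Sum>j<m. q j * \<omega> (Inr j)) < 1"
    obtain w where w: "w \<in> T" "p = (\<lambda>i. - w i)" using p by blast
    define g where "g j = \<omega> (Inr j)" for j
    show "\<omega> \<in> ?B1 \<union> ?B2"
    proof (rule ccontr)
      assume "\<omega> \<notin> ?B1 \<union> ?B2"
      then have g: "- b < (\<Sum>i<m. (g i)\<^sup>2)" and s: "(\<Sum>i<n. (soft t z l i (\<omega> (Inl i)))\<^sup>2) < a"
        using \<omega> by (auto simp: K_def g_def not_le sum_negf)
      have g': "sqrt (- b) < L2_set g {..<m}" unfolding L2_set_def using g by simp
      then have "L2_set g {..<m} \<noteq> 0" using b real_sqrt_ge_zero[of "- b"] by linarith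
      then obtain q where q: "q \<in> Q" "(1 - \<eta>) * L2_set g {..<m} \<le> (\<Sum>i<m. q i * g i)"
        using sphere_net_gives_norm[of "{..<m}" Q \<eta> g] Q(3) by blast
      have "(\<Sum>i<n. w i * \<omega> (Inl i)) \<le> L2_set (\<lambda>i. soft t z l i (\<omega> (Inl i))) {..<n}"
        using w(1) t unfolding T_def by (rule inner_unit_descent_le)
      also have "\<dots> \<le> sqrt a" unfolding L2_set_def using s by simp
      finally have "(\<Sum>i<n. w i * \<omega> (Inl i)) \<le> sqrt a" .
      moreover have "- (\<Sum>i<n. w i * \<omega> (Inl i)) + (\<Sum>j<m. q j * g j) < 1"
        using less[OF q(1)] by (simp add: w(2) sum_negf g_def)
      moreover have "(1 - \<eta>) * sqrt (- b) \<le> (1 - \<eta>) * L2_set g {..<m}"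
        using g' \<eta> by (intro mult_left_mono) auto
      ultimately show False using q(2) num by linarith
    qed
  qed (use Q in auto)
  also have "measure (std_gauss ({..<n} <+> {..<m})) (?B1 \<union> ?B2) = measure (std_gauss K) (?B1 \<union> ?B2)"
    by (simp only: K_def)
  also have "\<dots> \<le> measure (std_gauss K) ?B1 + measure (std_gauss K) ?B2"
    using B1 B2 by (rule measure_Un_le)
  also have "measure (std_gauss ({..<n} \<times> {..<m})) ?E' = measure (std_gauss ({..<m} \<times> {..<n})) ?E"
    by (rule measure_std_gauss_reindex[OF sw E])
  finally show ?thesis .
qed

text \<open>The separating vector is a point of the sphere, so the sphere is now the first index
  set. Off the five tail events the truncated vector lies in the cone and its normalization has
  inner product at least \<open>- b / sqrt a_e\<close> with \<open>h\<close>. A nearby net point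
  loses at most \<open>\<eta> * sqrt a_h\<close>, and \<open>g\<close> cancels at most
  \<open>sqrt a_g\<close>; by \<open>num\<close> the comparison event fails.\<close>

lemma kernel_misses_bound:
  fixes n m z l :: nat
  defines "T \<equiv> unit_descent n z l" and "K \<equiv> {..<m} <+> {..<n}"
  assumes zl: "z \<le> l" "l < n" and \<eta>: "0 < \<eta>" and num: "1 + sqrt a_g + \<eta> * sqrt a_h \<le> - b / sqrt a_e" and b: "b < 0"
    and B1: "tail_event K m Inl (\<lambda>i x. x\<^sup>2) a_g \<in> sets (std_gauss K)" (is "?B1 \<in> _")
    and B2: "tail_event K n Inr (\<lambda>i x. x\<^sup>2) a_h \<in> sets (std_gauss K)" (is "?B2 \<in> _")
    and B3: "tail_event K n Inr (soft t z l) 0 \<in> sets (std_gauss K)" (is "?B3 \<in> _")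
    and B4: "tail_event K n Inr (\<lambda>i x. - (x * soft t z l i x)) b \<in> sets (std_gauss K)" (is "?B4 \<in> _")
    and B5: "tail_event K n Inr (\<lambda>i x. (soft t z l i x)\<^sup>2) a_e \<in> sets (std_gauss K)" (is "?B5 \<in> _")
  shows "measure (std_gauss ({..<m} \<times> {..<n})) {A \<in> space (std_gauss ({..<m} \<times> {..<n})). \<not> (\<exists>w\<in>T. \<forall>i<m. matvec n A w i = 0)}
      * measure std_normal {..-2} \<le>
    measure (std_gauss K) (tail_event K m Inl (\<lambda>i x. x\<^sup>2) a_g)
    + measure (std_gauss K) (tail_event K n Inr (\<lambda>i x. x\<^sup>2) a_h)
    + measure (std_gauss K) (tail_event K n Inr (soft t z l) 0)
    + measure (std_gauss K) (tail_event K n Inr (\<lambda>i x. - (x * soft t z l i x)) b)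
    + measure (std_gauss K) (tail_event K n Inr (\<lambda>i x. (soft t z l i x)\<^sup>2) a_e)"
proof -
  let ?M0 = "std_gauss ({..<m} \<times> {..<n})"
  let ?U = "{A \<in> space ?M0. \<not> (\<exists>w\<in>T. \<forall>i<m. matvec n A w i = 0)}"
  let ?G = "?B1 \<union> ?B2 \<union> ?B3 \<union> ?B4 \<union> ?B5"
  have "?U = space ?M0 - {A \<in> space ?M0. \<exists>w\<in>T. \<forall>i<m. matvec n A w i = 0}" by blast
  then have U: "?U \<in> sets ?M0"
    using kernel_meets_measurable[of m n z l] unfolding T_def by auto
  obtain Q where Q: "finite Q" "Q \<subseteq> T" "\<And>w. w \<in> T \<Longrightarrow> \<exists>q\<in>Q. L2_set (\<lambda>i. w i - q i) {..<n} \<le> \<eta>"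
    unfolding T_def by (rule unit_descent_net[where n=n and z=z and l=l, OF \<eta>]) blast
  have mG: "?G \<in> sets (std_gauss K)" by (intro sets.Un B1 B2 B3 B4 B5)
  have "measure ?M0 ?U * measure std_normal {..-2} \<le> measure (std_gauss ({..<m} <+> {..<n})) ?G"
  proof (rule gordon_bilinear[where P="{u. (\<Sum>i<m. (u i)\<^sup>2) = 1}" and Q=Q])
    show "(\<Sum>j<n. (q j)\<^sup>2) = 1" if "q \<in> Q" for q using that Q(2) by (auto simp: T_def unit_descent_def)
    show "?U \<in> sets ?M0" by (rule U)
    show "?G \<in> sets (std_gauss ({..<m} <+> {..<n}))" using mG unfolding K_def .
    fix A assume "A \<in> ?U"
    then have nk: "\<not> (\<exists>w\<in>unit_descent n z l. \<forall>i<m. matvec n A w i = 0)" by (simp add: T_def)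
    \<comment> \<open>Since \<open>l < n\<close>, the last coordinate carries no sign condition, so
      its negative unit vector is in the cone and has negative sum, as the separation
      requires.\<close>
    define w0 :: "nat \<Rightarrow> real" where "w0 i = (if i = n - 1 then - 1 else 0)" for i
    have sum0: "(\<Sum>i<n. w0 i) = - 1" using zl by (simp add: w0_def)
    have "w0 \<in> descent_cone n z l" using zl sum0 unfolding descent_cone_def by (auto simp: w0_def)
    then obtain u where u: "(\<Sum>i<m. (u i)\<^sup>2) = 1" "\<And>w. w \<in> unit_descent n z l \<Longrightarrow> (\<Sum>i<m. u i * matvec n A w i) \<le> 0"
      using separating_vector[OF nk, of w0] sum0 by auto
    have "(\<Sum>(i,j)\<in>{..<m}\<times>{..<n}. u i * q j * A (i,j)) \<le> 0" if q: "q \<in> Q" for q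
    proof -
      have "(\<Sum>(i,j)\<in>{..<m}\<times>{..<n}. u i * q j * A (i,j)) = (\<Sum>i<m. u i * matvec n A q i)"
        unfolding matvec_def sum_distrib_left sum.cartesian_product[symmetric]
        by (intro sum.cong refl) (simp add: mult_ac)
      then show ?thesis using u(2)[of q] q Q(2) unfolding T_def by auto
    qed
    then show "\<exists>p\<in>{u. (\<Sum>i<m. (u i)\<^sup>2) = 1}. \<forall>q\<in>Q. (\<Sum>(i,j)\<in>{..<m}\<times>{..<n}. p i * q j * A (i,j)) \<le> 0"
      using u(1) by blast
  next
    fix \<omega> p assume \<omega>: "\<omega> \<in> space (std_gauss ({..<m} <+> {..<n}))" and p: "p \<in> {u. (\<Sum>i<m. (u i)\<^sup>2) = 1}"
      and less: "\<And>q. q \<in> Q \<Longrightarrow> (\<Sum>i<m. p i * \<omega> (Inl i)) + (\<Sum>j<n. q j * \<omega> (Inr j)) < 1"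
    define g where "g i = \<omega> (Inl i)" for i
    define h where "h i = \<omega> (Inr i)" for i
    define s where "s i = (if i < n then soft t z l i (h i) else 0)" for i
    show "\<omega> \<in> ?G"
    proof (rule ccontr)
      assume "\<omega> \<notin> ?G"
      then have 1: "(\<Sum>i<m. (g i)\<^sup>2) < a_g" and 2: "(\<Sum>i<n. (h i)\<^sup>2) < a_h" and 3: "(\<Sum>i<n. soft t z l i (h i)) < 0"
        and 4: "- b < (\<Sum>i<n. h i * soft t z l i (h i))" and 5: "(\<Sum>i<n. (soft t z l i (h i))\<^sup>2) < a_e"
        using \<omega> by (auto simp: g_def h_def not_le K_def sum_negf)
      have sC: "s \<in> descent_cone n z l"
        unfolding s_def using soft_in_descent_cone[of z l n t h] zl 3 by (simp add: less_imp_le)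
      have s4: "- b < (\<Sum>i<n. s i * h i)" using 4 by (simp add: s_def mult.commute)
      let ?s = "L2_set s {..<n}"
      have "?s \<noteq> 0"
      proof
        assume "?s = 0"
        then have "\<forall>i<n. s i = 0" by (simp add: L2_set_eq_0_iff)
        then show False using s4 b by simp
      qed
      then have s0: "0 < ?s" by (simp add: less_le)
      have s5: "?s < sqrt a_e" unfolding L2_set_def using 5 by (simp add: s_def)
      obtain q where q: "q \<in> Q" "L2_set (\<lambda>i. 1 / ?s * s i - q i) {..<n} \<le> \<eta>"
        using Q(3)[of "\<lambda>i. 1 / ?s * s i"] unit_descent_normalize[OF sC \<open>?s \<noteq> 0\<close>] unfolding T_def by blast
      have "(\<Sum>i<n. (1 / ?s * s i - q i) * h i) \<le> L2_set (\<lambda>i. 1 / ?s * s i - q i) {..<n} * L2_set h {..<n}"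
        by (rule inner_sum_le_L2_set)
      also have "\<dots> \<le> \<eta> * sqrt a_h"
      proof (intro mult_mono q(2))
        show "L2_set h {..<n} \<le> sqrt a_h" unfolding L2_set_def using 2 by simp
      qed (use \<eta> in auto)
      finally have A: "(\<Sum>i<n. (1 / ?s * s i - q i) * h i) \<le> \<eta> * sqrt a_h" .
      have B: "(\<Sum>i<n. (1 / ?s * s i - q i) * h i) = 1 / ?s * (\<Sum>i<n. s i * h i) - (\<Sum>i<n. q i * h i)"
        unfolding sum_distrib_left sum_subtractf[symmetric] by (intro sum.cong refl) (simp only: left_diff_distrib mult.assoc)
      have C: "- b / sqrt a_e \<le> 1 / ?s * (\<Sum>i<n. s i * h i)"
      proof -
        have "- b / sqrt a_e \<le> - b / ?s" using s5 s0 b less_trans[OF s0 s5] by (intro divide_left_mono mult_pos_pos) auto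
        also have "\<dots> \<le> (\<Sum>i<n. s i * h i) / ?s" using s4 s0 by (intro divide_right_mono) auto
        finally show ?thesis by simp
      qed
      have "(\<Sum>i<m. - p i * g i) \<le> L2_set (\<lambda>i. - p i) {..<m} * L2_set g {..<m}" by (rule inner_sum_le_L2_set)
      also have "L2_set (\<lambda>i. - p i) {..<m} = 1" using p by (simp add: L2_set_def)
      also have "1 * L2_set g {..<m} \<le> sqrt a_g" using 1 by (simp add: L2_set_def)
      finally have D: "- (\<Sum>i<m. p i * g i) \<le> sqrt a_g" by (simp add: sum_negf)
      have E: "(\<Sum>i<m. p i * g i) + (\<Sum>i<n. q i * h i) < 1" using less[OF q(1)] unfolding g_def h_def .
      show False using A B C D E num by linarith
    qed
  qed (use Q in auto)
  also have "measure (std_gauss ({..<m} <+> {..<n})) ?G = measure (std_gauss K) ?G" by (simp only: K_def)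
  also have "\<dots> \<le> measure (std_gauss K) ?B1 + measure (std_gauss K) ?B2 + measure (std_gauss K) ?B3 + measure (std_gauss K) ?B4 + measure (std_gauss K) ?B5"
    using measure_Un_le[of "?B1 \<union> ?B2 \<union> ?B3 \<union> ?B4" "std_gauss K" ?B5] measure_Un_le[of "?B1 \<union> ?B2 \<union> ?B3" "std_gauss K" ?B4]
      measure_Un_le[of "?B1 \<union> ?B2" "std_gauss K" ?B3] measure_Un_le[of "?B1" "std_gauss K" ?B2] B1 B2 B3 B4 B5
    by (meson add_mono order_refl order_trans sets.Un)
  finally show ?thesis .
qed

section \<open>The phase transition\<close>

lemma upper_tail_bounds: "0 \<le> upper_tail t" "upper_tail t \<le> 1"
proof -
  interpret N: prob_space std_normal by (rule prob_space_std_normal)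
  have "upper_tail t = measure std_normal {t<..}" by (simp add: upper_tail_def)
  then show "0 \<le> upper_tail t" "upper_tail t \<le> 1" by auto
qed

lemma upper_tail_has_derivative: "(upper_tail has_real_derivative - std_normal_density t) (at t)"
  using DERIV_diff[OF DERIV_const[of "1/2"] scaled_erf_has_derivative[of t]]
  unfolding upper_tail_erf[abs_def] by (simp add: diff_divide_distrib)

lemma sum_blocks:
  assumes "z \<le> l" "l \<le> n"
  shows "(\<Sum>i<n. if i < z then a else if i < l then b else c) =
    real z * a + real (l - z) * b + real (n - l) * (c :: real)"
proof -
  let ?f = "\<lambda>i. if i < z then a else if i < l then b else c"
  have A: "(\<Sum>i=0..<z. ?f i) + (\<Sum>i=z..<l. ?f i) = (\<Sum>i=0..<l. ?f i)"
    by (rule sum.atLeastLessThan_concat) (use assms in auto)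
  have B: "(\<Sum>i=0..<l. ?f i) + (\<Sum>i=l..<n. ?f i) = (\<Sum>i=0..<n. ?f i)"
    by (rule sum.atLeastLessThan_concat) (use assms in auto)
  have "(\<Sum>i<n. ?f i) = (\<Sum>i=0..<z. ?f i) + (\<Sum>i=z..<l. ?f i) + (\<Sum>i=l..<n. ?f i)"
    by (simp only: lessThan_atLeast0 A B)
  also have "(\<Sum>i=0..<z. ?f i) = (\<Sum>i=0..<z. a)" by (rule sum.cong) auto
  also have "(\<Sum>i=z..<l. ?f i) = (\<Sum>i=z..<l. b)" by (rule sum.cong) auto
  also have "(\<Sum>i=l..<n. ?f i) = (\<Sum>i=l..<n. c)" using assms by (intro sum.cong) auto
  finally show ?thesis by simp
qed

locale box_l1_regime =
  fixes \<mu> \<beta> \<alpha>w :: real and k z :: "nat \<Rightarrow> nat" and xt :: "nat \<Rightarrow> nat \<Rightarrow> real"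
  assumes mu: "1/2 < \<mu>" "\<mu> \<le> 1"
    and beta: "0 < \<beta>" "\<beta> < 1"
    and k_le: "\<And>n. k n \<le> n"
    and k_lim: "(\<lambda>n. real (k n) / real n) \<longlonglongrightarrow> \<beta>"
    and z_le: "\<And>n. z n \<le> n - k n"
    and z_lim: "(\<lambda>n. real (z n) / real (n - k n)) \<longlonglongrightarrow> \<mu>"
    and xt_zero: "\<And>n i. i < z n \<Longrightarrow> xt n i = 0"
    and xt_one: "\<And>n i. z n \<le> i \<Longrightarrow> i < n - k n \<Longrightarrow> xt n i = 1"
    and xt_frac: "\<And>n i. n - k n \<le> i \<Longrightarrow> i < n \<Longrightarrow> 0 < xt n i \<and> xt n i < 1"
    and aw_dom: "\<bar>(1 + \<beta> - 2 * \<alpha>w) / ((2 * \<mu> - 1) * (1 - \<beta>))\<bar> < 1"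
    and aw_eq: "(2 * \<mu> - 1) * (1 - \<beta>) * sqrt (1 / (2 * pi))
                 * exp (- (erfinv ((1 + \<beta> - 2 * \<alpha>w) / ((2 * \<mu> - 1) * (1 - \<beta>))))\<^sup>2)
               / (\<alpha>w * sqrt 2 * erfinv ((1 + \<beta> - 2 * \<alpha>w) / ((2 * \<mu> - 1) * (1 - \<beta>)))) = 1"
begin

abbreviation "l n \<equiv> n - k n"

text \<open>The limiting expected fraction of coordinates on which \<open>soft t\<close> is nonzero:
  by symmetry the zeros contribute an upper tail, the ones its complement, and the fractional
  coordinates are always active. It is also the limiting mean of \<open>x * soft\<close>.\<close>

definition active_fraction :: "real \<Rightarrow> real" where
  "active_fraction t = (1 - \<beta>) * (\<mu> * upper_tail t + (1 - \<mu>) * (1 - upper_tail t)) + \<beta>"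

text \<open>The limiting mean of \<open>soft t\<close> per coordinate, with the contributions of the
  three blocks collected.\<close>

definition mean_soft :: "real \<Rightarrow> real" where
  "mean_soft t = (2 * \<mu> - 1) * (1 - \<beta>) * std_normal_density t - t * active_fraction t"

text \<open>The factor \<open>sqrt 2\<close> passes from the scale of \<open>erf\<close> to that of
  the standard normal distribution.\<close>

definition opt_mult :: real where
  "opt_mult = sqrt 2 * erfinv ((1 + \<beta> - 2 * \<alpha>w) / ((2 * \<mu> - 1) * (1 - \<beta>)))"

lemma scale_pos: "0 < (2 * \<mu> - 1) * (1 - \<beta>)"
  using mu beta by simp

lemma upper_tail_opt: "(2 * \<mu> - 1) * (1 - \<beta>) * upper_tail opt_mult = ((2 * \<mu> - 1) * (1 - \<beta>) - (1 + \<beta> - 2 * \<alpha>w)) / 2"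
proof -
  have "erf (opt_mult / sqrt 2) = (1 + \<beta> - 2 * \<alpha>w) / ((2 * \<mu> - 1) * (1 - \<beta>))"
    unfolding opt_mult_def by (simp add: erf_erfinv[OF aw_dom])
  moreover have "D * ((1 - y / D) / 2) = (D - y) / 2" if "0 < D" for D y :: real
    using that by (simp add: field_simps)
  ultimately show ?thesis unfolding upper_tail_erf using scale_pos by simp
qed

lemma active_fraction_alt: "active_fraction t = (2 * \<mu> - 1) * (1 - \<beta>) * upper_tail t + (1 - \<beta>) * (1 - \<mu>) + \<beta>"
  by (simp add: active_fraction_def algebra_simps)

text \<open>The argument of \<open>erfinv\<close> is what one gets by solving
  \<open>active_fraction t = \<alpha>w\<close> for the error function; \<open>1 + \<beta>\<close>
  arises because the part of \<open>active_fraction\<close> without \<open>erf\<close> is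
  \<open>(1 + \<beta>) / 2\<close>.\<close>

lemma active_fraction_opt: "active_fraction opt_mult = \<alpha>w"
  unfolding active_fraction_alt upper_tail_opt by (simp add: field_simps)

lemma active_fraction_ge: "\<beta> \<le> active_fraction t"
  unfolding active_fraction_def using mu beta upper_tail_bounds[of t] by (auto intro!: mult_nonneg_nonneg add_nonneg_nonneg)

lemma aw_pos: "0 < \<alpha>w"
  using active_fraction_ge[of opt_mult] beta unfolding active_fraction_opt by simp

text \<open>The remaining factor \<open>sqrt (1 / (2 * pi))\<close> times the exponential is the
  normal density at \<open>opt_mult\<close>, so the equation for \<alpha>w says that
  \<open>mean_soft\<close> vanishes there.\<close>

lemma opt_mult_equation: "(2 * \<mu> - 1) * (1 - \<beta>) * std_normal_density opt_mult = \<alpha>w * opt_mult" "opt_mult \<noteq> 0"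
proof -
  let ?e = "erfinv ((1 + \<beta> - 2 * \<alpha>w) / ((2 * \<mu> - 1) * (1 - \<beta>)))"
  have t: "\<alpha>w * sqrt 2 * ?e = \<alpha>w * opt_mult" by (simp add: opt_mult_def)
  have "opt_mult\<^sup>2 / 2 = ?e\<^sup>2" by (simp add: opt_mult_def power_mult_distrib)
  then have d: "sqrt (1 / (2 * pi)) * exp (- ?e\<^sup>2) = std_normal_density opt_mult"
    by (simp add: std_normal_density_def real_sqrt_divide)
  have eq: "(2 * \<mu> - 1) * (1 - \<beta>) * std_normal_density opt_mult / (\<alpha>w * opt_mult) = 1"
    using aw_eq unfolding t d[symmetric] by (simp only: mult.assoc)
  \<comment> \<open>Division by 0 gives 0, so a quotient equal to 1 excludes a zero
    denominator.\<close>
  then show "opt_mult \<noteq> 0" by auto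
  then show "(2 * \<mu> - 1) * (1 - \<beta>) * std_normal_density opt_mult = \<alpha>w * opt_mult"
    using eq aw_pos by (simp add: divide_eq_eq)
qed

text \<open>The sign comes from \<open>\<mu> > 1/2\<close>. Weak duality needs a nonnegative
  multiplier, since the sum is constrained by an inequality.\<close>

lemma opt_mult_pos: "0 < opt_mult"
proof -
  have "0 < \<alpha>w * opt_mult" unfolding opt_mult_equation(1)[symmetric] using scale_pos by (simp add: normal_density_pos)
  then show ?thesis using aw_pos by (simp add: zero_less_mult_iff)
qed

lemma mean_soft_opt: "mean_soft opt_mult = 0"
  unfolding mean_soft_def active_fraction_opt opt_mult_equation(1) by simp

lemma active_fraction_has_derivative: "(active_fraction has_real_derivative - ((2 * \<mu> - 1) * (1 - \<beta>) * std_normal_density t)) (at t)"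
  unfolding active_fraction_alt[abs_def] by (rule derivative_eq_intros upper_tail_has_derivative refl)+ simp

text \<open>The terms with \<open>t\<close> times the density cancel. As
  \<open>active_fraction\<close> is at least \<beta>, \<open>mean_soft\<close> is strictly
  decreasing and \<open>opt_mult\<close> is its only zero.\<close>

lemma mean_soft_has_derivative: "(mean_soft has_real_derivative - active_fraction t) (at t)"
  unfolding mean_soft_def[abs_def]
  by (rule derivative_eq_intros std_normal_density_has_derivative active_fraction_has_derivative refl)+ (simp add: algebra_simps)

lemma mean_soft_neg:
  assumes "opt_mult < t"
  shows "mean_soft t < 0"
proof -
  have "mean_soft t < mean_soft opt_mult"
  proof (rule DERIV_neg_imp_decreasing[OF assms])
    show "\<exists>y. (mean_soft has_real_derivative y) (at x) \<and> y < 0" for x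
      using mean_soft_has_derivative[of x] active_fraction_ge[of x] beta by (intro exI[of _ "- active_fraction x"]) auto
  qed
  then show ?thesis by (simp add: mean_soft_opt)
qed

text \<open>The share of \<open>z n\<close> is given relative to \<open>n - k n\<close>, so its
  share of \<open>n\<close> is a product of two convergent ratios.\<close>

lemma block_means:
  "(\<lambda>n. (\<Sum>i<n. if i < z n then a else if i < l n then b else c) / real n)
    \<longlonglongrightarrow> (1 - \<beta>) * (\<mu> * a + (1 - \<mu>) * b) + \<beta> * c"
proof -
  have l: "(\<lambda>n. 1 - real (k n) / real n) \<longlonglongrightarrow> 1 - \<beta>" by (intro tendsto_intros k_lim)
  have "(\<lambda>n. real (z n) / real (l n) * (1 - real (k n) / real n) * a
      + ((1 - real (k n) / real n) - real (z n) / real (l n) * (1 - real (k n) / real n)) * b + real (k n) / real n * c)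
     \<longlonglongrightarrow> \<mu> * (1 - \<beta>) * a + ((1 - \<beta>) - \<mu> * (1 - \<beta>)) * b + \<beta> * c"
    by (intro tendsto_intros z_lim l k_lim)
  moreover have "\<forall>\<^sub>F n in sequentially. real (z n) / real (l n) * (1 - real (k n) / real n) * a
      + ((1 - real (k n) / real n) - real (z n) / real (l n) * (1 - real (k n) / real n)) * b + real (k n) / real n * c
      = (\<Sum>i<n. if i < z n then a else if i < l n then b else c) / real n"
    using eventually_gt_at_top[of 0]
  proof eventually_elim
    case (elim n)
    have e1: "1 - real (k n) / real n = real (l n) / real n"
      using elim k_le[of n] by (simp add: of_nat_diff field_simps)
    \<comment> \<open>If \<open>l n = 0\<close>, then \<open>z n = 0\<close> and both sides are 0 by
      the convention for division by 0.\<close>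
    have e2: "real (z n) / real (l n) * (real (l n) / real n) = real (z n) / real n"
      using z_le[of n] by (cases "l n = 0") auto
    have e3: "real (l n - z n) = real (l n) - real (z n)" using z_le[of n] by (simp add: of_nat_diff)
    have e4: "n - l n = k n" using k_le[of n] by simp
    show ?case
      unfolding e1 e2 sum_blocks[OF z_le diff_le_self] e3 e4
      using elim by (simp add: field_simps)
  qed
  ultimately have "(\<lambda>n. (\<Sum>i<n. if i < z n then a else if i < l n then b else c) / real n)
     \<longlonglongrightarrow> \<mu> * (1 - \<beta>) * a + ((1 - \<beta>) - \<mu> * (1 - \<beta>)) * b + \<beta> * c"
    by (rule Lim_transform_eventually)
  also have "\<mu> * (1 - \<beta>) * a + ((1 - \<beta>) - \<mu> * (1 - \<beta>)) * b + \<beta> * c = (1 - \<beta>) * (\<mu> * a + (1 - \<mu>) * b) + \<beta> * c"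
    by (simp add: algebra_simps)
  finally show ?thesis .
qed

lemma soft_means:
  "(\<lambda>n. (\<Sum>i<n. integral\<^sup>L std_normal (soft t (z n) (l n) i)) / real n) \<longlonglongrightarrow> mean_soft t"
  "(\<lambda>n. (\<Sum>i<n. LINT x|std_normal. x * soft t (z n) (l n) i x) / real n) \<longlonglongrightarrow> active_fraction t"
  "(\<lambda>n. (\<Sum>i<n. LINT x|std_normal. (soft t (z n) (l n) i x)\<^sup>2) / real n) \<longlonglongrightarrow> active_fraction t - t * mean_soft t"
proof -
  show 1: "(\<lambda>n. (\<Sum>i<n. integral\<^sup>L std_normal (soft t (z n) (l n) i)) / real n) \<longlonglongrightarrow> mean_soft t"
    unfolding soft_integrals(1)
    by (rule back_subst[where P="\<lambda>v. _ \<longlonglongrightarrow> v", OF block_means]) (simp add: mean_soft_def active_fraction_def algebra_simps)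
  show 2: "(\<lambda>n. (\<Sum>i<n. LINT x|std_normal. x * soft t (z n) (l n) i x) / real n) \<longlonglongrightarrow> active_fraction t"
    unfolding soft_integrals(2)
    by (rule back_subst[where P="\<lambda>v. _ \<longlonglongrightarrow> v", OF block_means]) (simp add: active_fraction_def)
  have "(LINT x|std_normal. (soft t (z n) (l n) i x)\<^sup>2) =
      (LINT x|std_normal. x * soft t (z n) (l n) i x) - t * integral\<^sup>L std_normal (soft t (z n) (l n) i)" for n i
    unfolding soft_square using soft_integrable[of t "z n" "l n" i] by simp
  then have "(\<Sum>i<n. LINT x|std_normal. (soft t (z n) (l n) i x)\<^sup>2) / real n =
      (\<Sum>i<n. LINT x|std_normal. x * soft t (z n) (l n) i x) / real n
      - t * ((\<Sum>i<n. integral\<^sup>L std_normal (soft t (z n) (l n) i)) / real n)" for n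
    by (simp add: sum_subtractf sum_distrib_left[symmetric] diff_divide_distrib)
  then show "(\<lambda>n. (\<Sum>i<n. LINT x|std_normal. (soft t (z n) (l n) i x)\<^sup>2) / real n) \<longlonglongrightarrow> active_fraction t - t * mean_soft t"
    by (simp only:) (intro tendsto_intros 1 2)
qed

lemma unique_event_eq:
  "unique_event m n (xt n) = {A \<in> space (std_gauss ({..<m} \<times> {..<n})).
     \<not> (\<exists>w\<in>unit_descent n (z n) (l n). \<forall>i<m. matvec n A w i = 0)}"
  unfolding unique_event_def gaussian_matrix_def std_normal_def[symmetric]
  by (subst box_unique_iff[where z="z n" and l="l n"]) (use z_le xt_zero xt_one xt_frac in auto)

lemma unique_event_sets: "unique_event m n (xt n) \<in> sets (std_gauss ({..<m} \<times> {..<n}))"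
proof -
  have "unique_event m n (xt n) = space (std_gauss ({..<m} \<times> {..<n})) -
    {A \<in> space (std_gauss ({..<m} \<times> {..<n})). \<exists>w\<in>unit_descent n (z n) (l n). \<forall>i<m. matvec n A w i = 0}"
    unfolding unique_event_eq by blast
  then show ?thesis using kernel_meets_measurable by (simp only:) (rule sets.compl_sets)
qed

lemma gaussian_matrix_eq: "gaussian_matrix m n = std_gauss ({..<m} \<times> {..<n})"
  by (simp add: gaussian_matrix_def std_normal_def)

text \<open>With the optimal multiplier the truncated vector has squared norm near
  \<open>\<alpha>w * n\<close>, below the value near \<open>\<alpha> * n\<close> for the Gaussian
  vector of dimension \<open>m n\<close>. Both concentrate, and the norms stay apart by a multiple
  of \<open>sqrt n\<close>.\<close>

lemma uniquely_recovers:
  assumes \<alpha>: "\<alpha>w < \<alpha>" and m: "(\<lambda>n. real (m n) / real n) \<longlonglongrightarrow> \<alpha>"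
  shows "\<exists>c>0. \<forall>\<^sub>F n in sequentially.
    measure (gaussian_matrix (m n) n) (unique_event (m n) n (xt n)) \<ge> 1 - exp (- c * real n)"
proof -
  define e where "e = (\<alpha> - \<alpha>w) / 4"
  \<comment> \<open>A quarter of the gap on either side leaves the two thresholds strictly
    separated.\<close>
  have e: "0 < e" "\<alpha>w + e < \<alpha> - e" "0 < \<alpha>w + e" using \<alpha> aw_pos by (auto simp: e_def field_simps)
  define a where "a = sqrt (\<alpha> - e)"
  define b where "b = sqrt (\<alpha>w + e)"
  have sq: "b < a" "0 < b" using e by (auto simp: a_def b_def)
  \<comment> \<open>The net on the sphere costs half of \<open>a - b\<close>. The other half is
    \<open>gap\<close>, and \<open>gap * sqrt n\<close> eventually exceeds the additive 1 of the
    comparison.\<close>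
  define \<eta> where "\<eta> = (a - b) / (2 * a)"
  define gap where "gap = (1 - \<eta>) * a - b"
  have \<eta>: "0 < \<eta>" "\<eta> < 1" using sq by (auto simp: \<eta>_def divide_simps)
  have gap: "0 < gap"
  proof -
    have "\<eta> * a = (a - b) / 2" using sq by (simp add: \<eta>_def)
    then have "gap = (a - b) / 2" by (simp add: gap_def left_diff_distrib)
    then show ?thesis using sq by simp
  qed
  have mean1: "(\<lambda>n. (\<Sum>i<m n. LINT x|std_normal. - x\<^sup>2) / real n) \<longlonglongrightarrow> - \<alpha>"
    using tendsto_minus[OF m] by (simp add: std_normal_second_moment)
  have meas1: "(\<lambda>x::real. - x\<^sup>2) \<in> borel_measurable borel" by measurable
  have le1: "\<bar>- x\<^sup>2\<bar> \<le> 1 * (1 + x\<^sup>2)" for x :: real by simp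
  have \<tau>1: "- \<alpha> < - (\<alpha> - e)" using e by simp
  obtain c1 where c1: "0 < c1" "tails_decay m (\<lambda>n i x. - x\<^sup>2) (- (\<alpha> - e)) c1"
    using chernoff_eventually[where a=1 and N=m and \<nu>=\<alpha> and f="\<lambda>n i x. - x\<^sup>2" and v="- \<alpha>" and \<tau>="- (\<alpha> - e)",
      OF zero_less_one m meas1 le1 mean1 \<tau>1] by (elim exE conjE) (rule that)
  have pos: "0 < 4 * (1 + opt_mult\<^sup>2)" by (simp add: add_pos_nonneg)
  have N1: "(\<lambda>n. real n / real n) \<longlonglongrightarrow> 1"
    by (rule tendsto_eventually) (use eventually_gt_at_top[of 0] in eventually_elim, simp)
  have mean2: "(\<lambda>n. (\<Sum>i<n. LINT x|std_normal. (soft opt_mult (z n) (l n) i x)\<^sup>2) / real n) \<longlonglongrightarrow> \<alpha>w"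
    using soft_means(3)[of opt_mult] by (simp add: mean_soft_opt active_fraction_opt)
  have meas2: "(\<lambda>x. (soft opt_mult (z n) (l n) i x)\<^sup>2) \<in> borel_measurable borel" for n i by measurable
  have \<tau>2: "\<alpha>w < \<alpha>w + e" using e by simp
  obtain c2 where c2: "0 < c2" "tails_decay (\<lambda>n. n) (\<lambda>n i x. (soft opt_mult (z n) (l n) i x)\<^sup>2) (\<alpha>w + e) c2"
    using chernoff_eventually[where N="\<lambda>n. n" and \<nu>=1 and f="\<lambda>n i x. (soft opt_mult (z n) (l n) i x)\<^sup>2" and v=\<alpha>w and \<tau>="\<alpha>w + e",
      OF pos N1 meas2 soft_bounds(3) mean2 \<tau>2] by (elim exE conjE) (rule that)
  define c where "c = min c1 c2"
  have c: "0 < c" "c \<le> c1" "c \<le> c2" using c1(1) c2(1) by (auto simp: c_def)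
  define \<tau>0 where "\<tau>0 = measure std_normal {..- 2}"
  have \<tau>0: "0 < \<tau>0" unfolding \<tau>0_def by (rule std_normal_lower_tail_pos)
  have big: "\<forall>\<^sub>F n in sequentially. 1 \<le> gap * sqrt (real n)"
    using gap by real_asymp
  have "\<forall>\<^sub>F n in sequentially. measure (gaussian_matrix (m n) n) (unique_event (m n) n (xt n)) \<ge> 1 - exp (- (c / 2) * real n)"
    using c1(2) c2(2) big eventually_const_times_exp_le[OF c(1), of "2 / \<tau>0"]
  proof eventually_elim
    case (elim n)
    let ?K = "{..<n} <+> {..<m n}"
    let ?M0 = "std_gauss ({..<m n} \<times> {..<n})"
    let ?E = "{A \<in> space ?M0. \<exists>w\<in>unit_descent n (z n) (l n). \<forall>i<m n. matvec n A w i = 0}"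
    interpret P: prob_space ?M0 by (rule prob_space_std_gauss)
    have inj: "inj_on Inr {..<m n}" "Inr \<in> {..<m n} \<rightarrow> ?K" "inj_on Inl {..<n}" "Inl \<in> {..<n} \<rightarrow> ?K"
      by auto
    note B1 = elim(1)[THEN spec, of ?K, THEN spec, of Inr, THEN mp, OF inj(1), THEN mp, OF inj(2)]
    note B2 = elim(2)[THEN spec, of ?K, THEN spec, of Inl, THEN mp, OF inj(3), THEN mp, OF inj(4)]
    have num: "1 + sqrt ((\<alpha>w + e) * real n) \<le> (1 - \<eta>) * sqrt (- (- (\<alpha> - e) * real n))"
    proof -
      have "sqrt ((\<alpha>w + e) * real n) = b * sqrt (real n)" "sqrt (- (- (\<alpha> - e) * real n)) = a * sqrt (real n)"
        by (simp_all only: a_def b_def real_sqrt_mult mult_minus_left minus_minus)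
      then show ?thesis using elim(3) by (simp add: gap_def algebra_simps)
    qed
    have "measure ?M0 ?E * \<tau>0 \<le> exp (- c1 * real n) + exp (- c2 * real n)"
      unfolding \<tau>0_def
      by (rule order_trans[OF kernel_meets_bound[OF less_imp_le[OF opt_mult_pos] \<eta> num _ conjunct1[OF B1] conjunct1[OF B2]]
            add_mono[OF conjunct2[OF B1] conjunct2[OF B2]]])
         (use e aw_pos in \<open>simp add: mult_nonpos_nonneg\<close>)
    also have "\<dots> \<le> 2 * exp (- c * real n)"
    proof -
      have "exp (- c1 * real n) \<le> exp (- c * real n)" "exp (- c2 * real n) \<le> exp (- c * real n)"
        using c by (auto intro!: mult_right_mono)
      then show ?thesis by linarith
    qed
    finally have "measure ?M0 ?E \<le> 2 / \<tau>0 * exp (- c * real n)"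
      using \<tau>0 by (simp add: field_simps)
    then have le: "measure ?M0 ?E \<le> exp (- (c / 2) * real n)" using elim(4) by linarith
    have "unique_event (m n) n (xt n) = space ?M0 - ?E" unfolding unique_event_eq by blast
    then have "measure ?M0 (unique_event (m n) n (xt n)) = 1 - measure ?M0 ?E"
      using P.prob_compl[OF kernel_meets_measurable] by simp
    then show ?case unfolding gaussian_matrix_eq using le by simp
  qed
  then show ?thesis using c by (intro exI[of _ "c / 2"]) simp
qed

text \<open>For a multiplier slightly above the optimum, the normalized truncated vector has inner
  product close to \<open>sqrt (\<alpha>w * n)\<close> with \<open>h\<close>, which exceeds the norm
  of \<open>g\<close>, close to \<open>sqrt (\<alpha> * n)\<close>.\<close>

lemma not_uniquely_recovers:
  assumes \<alpha>: "\<alpha> < \<alpha>w" and m: "(\<lambda>n. real (m n) / real n) \<longlonglongrightarrow> \<alpha>"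
  shows "\<exists>c>0. \<forall>\<^sub>F n in sequentially.
    measure (gaussian_matrix (m n) n) (space (gaussian_matrix (m n) n) - unique_event (m n) n (xt n)) \<ge> 1 - exp (- c * real n)"
proof -
  have \<alpha>0: "0 \<le> \<alpha>" by (rule LIMSEQ_le_const[OF m]) auto
  \<comment> \<open>The margin per \<open>sqrt n\<close> when all limits are off by multiples of
    \<open>e\<close>. At \<open>e = 0\<close> it is \<open>sqrt \<alpha>w - sqrt \<alpha>\<close>,
    which is positive.\<close>
  define \<phi> where "\<phi> e = (\<alpha>w - 2 * e) / sqrt (\<alpha>w + 3 * e) - sqrt (\<alpha> + e)" for e
  have "(\<phi> \<longlongrightarrow> (\<alpha>w - 2 * 0) / sqrt (\<alpha>w + 3 * 0) - sqrt (\<alpha> + 0)) (at_right 0)"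
    unfolding \<phi>_def[abs_def] using aw_pos by (intro tendsto_intros) auto
  moreover have "0 < (\<alpha>w - 2 * 0) / sqrt (\<alpha>w + 3 * 0) - sqrt (\<alpha> + 0)"
    using \<alpha> aw_pos by (simp add: real_div_sqrt)
  ultimately have "\<forall>\<^sub>F e in at_right 0. 0 < \<phi> e" by (rule order_tendstoD(1))
  moreover have "\<forall>\<^sub>F e in at_right 0. 0 < e \<and> e < \<alpha>w / 4"
    using aw_pos by (intro eventually_conj eventually_at_right_less eventually_at_rightI[of 0 "\<alpha>w / 4"]) auto
  ultimately have "\<forall>\<^sub>F e in at_right 0. 0 < \<phi> e \<and> 0 < e \<and> e < \<alpha>w / 4" by (rule eventually_conj)
  then obtain e where e: "0 < \<phi> e" "0 < e" "e < \<alpha>w / 4"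
    using eventually_happens'[OF trivial_limit_at_right_real] by blast
  have cp: "isCont active_fraction t" "isCont mean_soft t" for t
    using DERIV_isCont[OF active_fraction_has_derivative] DERIV_isCont[OF mean_soft_has_derivative] by auto
  have "(active_fraction \<longlongrightarrow> active_fraction opt_mult) (at_right opt_mult)" "(mean_soft \<longlongrightarrow> mean_soft opt_mult) (at_right opt_mult)"
    using cp[of opt_mult] by (auto simp: isCont_def filterlim_at_split)
  then have "\<forall>\<^sub>F t in at_right opt_mult. \<alpha>w - 2 * e < active_fraction t" "\<forall>\<^sub>F t in at_right opt_mult. active_fraction t - t * mean_soft t < \<alpha>w + 3 * e"
  proof -
    assume ps: "(active_fraction \<longlongrightarrow> active_fraction opt_mult) (at_right opt_mult)" "(mean_soft \<longlongrightarrow> mean_soft opt_mult) (at_right opt_mult)"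
    show "\<forall>\<^sub>F t in at_right opt_mult. \<alpha>w - 2 * e < active_fraction t"
      by (rule order_tendstoD(1)[OF ps(1)]) (use e active_fraction_opt in simp)
    have "((\<lambda>t. active_fraction t - t * mean_soft t) \<longlongrightarrow> active_fraction opt_mult - opt_mult * mean_soft opt_mult) (at_right opt_mult)"
      by (intro tendsto_intros ps)
    then show "\<forall>\<^sub>F t in at_right opt_mult. active_fraction t - t * mean_soft t < \<alpha>w + 3 * e"
      by (rule order_tendstoD(2)) (use e active_fraction_opt mean_soft_opt in simp)
  qed
  then have "\<forall>\<^sub>F t in at_right opt_mult. opt_mult < t \<and> \<alpha>w - 2 * e < active_fraction t \<and> active_fraction t - t * mean_soft t < \<alpha>w + 3 * e"
    by (intro eventually_conj eventually_at_right_less)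
  \<comment> \<open>Strictness of \<open>opt_mult < t\<close> makes \<open>mean_soft t\<close>
    negative; continuity keeps the inner product and the squared norm near \<alpha>w, their common
    value at the optimum.\<close>
  then obtain t where t: "opt_mult < t" "\<alpha>w - 2 * e < active_fraction t" "active_fraction t - t * mean_soft t < \<alpha>w + 3 * e"
    using eventually_happens'[OF trivial_limit_at_right_real] by blast
  \<comment> \<open>As the squared norm of \<open>h\<close> is below \<open>2 * n\<close> up to
    small probability, the net costs at most \<open>\<phi> e / 2 * sqrt n\<close>; the other half of
    the margin covers the additive 1.\<close>
  define \<eta> where "\<eta> = \<phi> e / 4"
  have \<eta>: "0 < \<eta>" using e by (simp add: \<eta>_def)
  have pos: "0 < 4 * (1 + t\<^sup>2)" by (simp add: add_pos_nonneg)
  have N1: "(\<lambda>n. real n / real n) \<longlonglongrightarrow> 1"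
    by (rule tendsto_eventually) (use eventually_gt_at_top[of 0] in eventually_elim, simp)
  have mean1: "(\<lambda>n. (\<Sum>i<m n. LINT x|std_normal. x\<^sup>2) / real n) \<longlonglongrightarrow> \<alpha>"
    using m by (simp add: std_normal_second_moment)
  have mean2: "(\<lambda>n. (\<Sum>i<n. LINT x|std_normal. x\<^sup>2) / real n) \<longlonglongrightarrow> 1"
    using N1 by (simp add: std_normal_second_moment)
  have mean4: "(\<lambda>n. (\<Sum>i<n. LINT x|std_normal. - (x * soft t (z n) (l n) i x)) / real n) \<longlonglongrightarrow> - active_fraction t"
    using tendsto_minus[OF soft_means(2)[of t]] by (simp add: sum_negf)
  have meas1: "(\<lambda>x::real. x\<^sup>2) \<in> borel_measurable borel" by measurable
  have meas4: "(\<lambda>x. - (x * soft t (z n) (l n) i x)) \<in> borel_measurable borel" for n i by measurable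
  have meas5: "(\<lambda>x. (soft t (z n) (l n) i x)\<^sup>2) \<in> borel_measurable borel" for n i by measurable
  have le1: "\<bar>x\<^sup>2\<bar> \<le> 1 * (1 + x\<^sup>2)" for x :: real by simp
  have le4: "\<bar>- (x * soft t (z n) (l n) i x)\<bar> \<le> 4 * (1 + t\<^sup>2) * (1 + x\<^sup>2)" for n i x
    unfolding abs_minus_cancel by (rule soft_bounds(2))
  have \<tau>1: "\<alpha> < \<alpha> + e" and \<tau>2: "1 < (2::real)" and \<tau>4: "- active_fraction t < - (\<alpha>w - 2 * e)" and \<tau>5: "active_fraction t - t * mean_soft t < \<alpha>w + 3 * e"
    using e t by auto
  obtain c1 where c1: "0 < c1" "tails_decay m (\<lambda>n i x. x\<^sup>2) (\<alpha> + e) c1"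
    using chernoff_eventually[where a="1" and N="m" and \<nu>="\<alpha>" and f="\<lambda>n i x. x\<^sup>2" and v="\<alpha>" and \<tau>="\<alpha> + e",
      OF zero_less_one m meas1 le1 mean1 \<tau>1] by (elim exE conjE) (rule that)
  obtain c2 where c2: "0 < c2" "tails_decay (\<lambda>n. n) (\<lambda>n i x. x\<^sup>2) 2 c2"
    using chernoff_eventually[where a="1" and N="\<lambda>n. n" and \<nu>="1" and f="\<lambda>n i x. x\<^sup>2" and v="1" and \<tau>="2",
      OF zero_less_one N1 meas1 le1 mean2 \<tau>2] by (elim exE conjE) (rule that)
  obtain c3 where c3: "0 < c3" "tails_decay (\<lambda>n. n) (\<lambda>n. soft t (z n) (l n)) 0 c3"
    using chernoff_eventually[where a="4 * (1 + t\<^sup>2)" and N="\<lambda>n. n" and \<nu>="1" and f="\<lambda>n i x. soft t (z n) (l n) i x" and v="mean_soft t" and \<tau>="0",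
      OF pos N1 soft_measurable soft_bounds(1) soft_means(1) mean_soft_neg[OF t(1)]] by (elim exE conjE) (rule that)
  obtain c4 where c4: "0 < c4" "tails_decay (\<lambda>n. n) (\<lambda>n i x. - (x * soft t (z n) (l n) i x)) (- (\<alpha>w - 2 * e)) c4"
    using chernoff_eventually[where a="4 * (1 + t\<^sup>2)" and N="\<lambda>n. n" and \<nu>="1" and f="\<lambda>n i x. - (x * soft t (z n) (l n) i x)" and v="- active_fraction t" and \<tau>="- (\<alpha>w - 2 * e)",
      OF pos N1 meas4 le4 mean4 \<tau>4] by (elim exE conjE) (rule that)
  obtain c5 where c5: "0 < c5" "tails_decay (\<lambda>n. n) (\<lambda>n i x. (soft t (z n) (l n) i x)\<^sup>2) (\<alpha>w + 3 * e) c5"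
    using chernoff_eventually[where a="4 * (1 + t\<^sup>2)" and N="\<lambda>n. n" and \<nu>="1" and f="\<lambda>n i x. (soft t (z n) (l n) i x)\<^sup>2" and v="active_fraction t - t * mean_soft t" and \<tau>="\<alpha>w + 3 * e",
      OF pos N1 meas5 soft_bounds(3) soft_means(3) \<tau>5] by (elim exE conjE) (rule that)
  define c where "c = Min {c1, c2, c3, c4, c5}"
  have c: "c \<le> c1" "c \<le> c2" "c \<le> c3" "c \<le> c4" "c \<le> c5" "0 < c"
    using c1(1) c2(1) c3(1) c4(1) c5(1) by (auto simp: c_def)
  define \<tau>0 where "\<tau>0 = measure std_normal {..- 2}"
  have \<tau>0: "0 < \<tau>0" unfolding \<tau>0_def by (rule std_normal_lower_tail_pos)
  define gap where "gap = \<phi> e / 2"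
  have gap: "0 < gap" using e by (simp add: gap_def)
  have big: "\<forall>\<^sub>F n in sequentially. 1 \<le> gap * sqrt (real n)"
    using gap by real_asymp
  \<comment> \<open>Eventually there is a fractional coordinate, which gives \<open>l n < n\<close>
    below.\<close>
  have k0: "\<forall>\<^sub>F n in sequentially. 0 < real (k n) / real n"
    by (rule order_tendstoD(1)[OF k_lim beta(1)])
  have "\<forall>\<^sub>F n in sequentially. measure (gaussian_matrix (m n) n)
      (space (gaussian_matrix (m n) n) - unique_event (m n) n (xt n)) \<ge> 1 - exp (- (c / 2) * real n)"
    using c1(2) c2(2) c3(2) c4(2) c5(2) big eventually_const_times_exp_le[OF c(6), of "5 / \<tau>0"] k0
  proof eventually_elim
    case (elim n)
    let ?K = "{..<m n} <+> {..<n}"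
    let ?M0 = "std_gauss ({..<m n} \<times> {..<n})"
    let ?U = "unique_event (m n) n (xt n)"
    interpret P: prob_space ?M0 by (rule prob_space_std_gauss)
    have inj: "inj_on Inl {..<m n}" "Inl \<in> {..<m n} \<rightarrow> ?K" "inj_on Inr {..<n}" "Inr \<in> {..<n} \<rightarrow> ?K"
      by auto
    note B1 = elim(1)[THEN spec, of ?K, THEN spec, of Inl, THEN mp, OF inj(1), THEN mp, OF inj(2)]
    note B2 = elim(2)[THEN spec, of ?K, THEN spec, of Inr, THEN mp, OF inj(3), THEN mp, OF inj(4)]
    note B3 = elim(3)[THEN spec, of ?K, THEN spec, of Inr, THEN mp, OF inj(3), THEN mp, OF inj(4), unfolded mult_zero_left]
    note B4 = elim(4)[THEN spec, of ?K, THEN spec, of Inr, THEN mp, OF inj(3), THEN mp, OF inj(4)]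
    note B5 = elim(5)[THEN spec, of ?K, THEN spec, of Inr, THEN mp, OF inj(3), THEN mp, OF inj(4)]
    have "0 < k n" "0 < n" using elim(8) by (auto simp: zero_less_divide_iff)
    then have ln: "l n < n" by simp
    have num: "1 + sqrt ((\<alpha> + e) * real n) + \<eta> * sqrt (2 * real n) \<le> - (- (\<alpha>w - 2 * e) * real n) / sqrt ((\<alpha>w + 3 * e) * real n)"
    proof -
      have "real n / sqrt (real n) = sqrt (real n)" by (simp add: real_div_sqrt)
      then have 1: "(\<alpha>w - 2 * e) * real n / sqrt ((\<alpha>w + 3 * e) * real n) = (\<alpha>w - 2 * e) / sqrt (\<alpha>w + 3 * e) * sqrt (real n)"
        by (metis real_sqrt_mult times_divide_times_eq)
      have "sqrt 2 \<le> (2::real)" by (rule real_le_lsqrt) auto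
      then have "\<eta> * sqrt (2 * real n) \<le> \<eta> * (2 * sqrt (real n))"
        unfolding real_sqrt_mult using \<eta> by (intro mult_left_mono mult_right_mono) auto
      also have "\<dots> = gap * sqrt (real n)" by (simp add: \<eta>_def gap_def)
      finally have "1 + \<eta> * sqrt (2 * real n) \<le> \<phi> e * sqrt (real n)"
        using elim(6) by (simp add: gap_def)
      then show ?thesis unfolding mult_minus_left minus_minus 1 by (simp only: \<phi>_def left_diff_distrib real_sqrt_mult)
    qed
    have ad: "- (\<alpha>w - 2 * e) * real n < 0" using e \<open>0 < n\<close> by (simp add: mult_neg_pos)
    have "measure ?M0 ?U * \<tau>0 \<le> exp (- c1 * real n) + exp (- c2 * real n) + exp (- c3 * real n) + exp (- c4 * real n) + exp (- c5 * real n)"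
      unfolding \<tau>0_def unique_event_eq
      by (rule order_trans[OF kernel_misses_bound[OF z_le ln \<eta> num ad conjunct1[OF B1] conjunct1[OF B2] conjunct1[OF B3] conjunct1[OF B4] conjunct1[OF B5]]])
         (intro add_mono conjunct2[OF B1] conjunct2[OF B2] conjunct2[OF B3] conjunct2[OF B4] conjunct2[OF B5])
    also have "\<dots> \<le> 5 * exp (- c * real n)"
    proof -
      have "exp (- c' * real n) \<le> exp (- c * real n)" if "c \<le> c'" for c'
        using that by (auto intro!: mult_right_mono)
      from this[OF c(1)] this[OF c(2)] this[OF c(3)] this[OF c(4)] this[OF c(5)] show ?thesis by linarith
    qed
    finally have "measure ?M0 ?U \<le> 5 / \<tau>0 * exp (- c * real n)"
      using \<tau>0 by (simp add: field_simps)
    then have "measure ?M0 ?U \<le> exp (- (c / 2) * real n)" using elim(7) by linarith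
    then show ?case unfolding gaussian_matrix_eq P.prob_compl[OF unique_event_sets] by simp
  qed
  then show ?thesis using c by (intro exI[of _ "c / 2"]) simp
qed

end

theorem theorem17:
  fixes \<mu> \<beta> \<alpha>w :: real
    and k m z :: "nat \<Rightarrow> nat"
    and xt :: "nat \<Rightarrow> nat \<Rightarrow> real"
  assumes mu: "1/2 < \<mu>" "\<mu> \<le> 1"
    and beta: "0 < \<beta>" "\<beta> < 1"
    and k_le: "\<And>n. k n \<le> n"
    and k_lim: "(\<lambda>n. real (k n) / real n) \<longlonglongrightarrow> \<beta>"
    and z_le: "\<And>n. z n \<le> n - k n"
    and z_lim: "(\<lambda>n. real (z n) / real (n - k n)) \<longlonglongrightarrow> \<mu>"
    and xt_zero: "\<And>n i. i < z n \<Longrightarrow> xt n i = 0"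
    and xt_one: "\<And>n i. z n \<le> i \<Longrightarrow> i < n - k n \<Longrightarrow> xt n i = 1"
    and xt_frac: "\<And>n i. n - k n \<le> i \<Longrightarrow> i < n \<Longrightarrow> 0 < xt n i \<and> xt n i < 1"
    and aw_dom: "\<bar>(1 + \<beta> - 2 * \<alpha>w) / ((2 * \<mu> - 1) * (1 - \<beta>))\<bar> < 1"
    and aw_eq: "(2 * \<mu> - 1) * (1 - \<beta>) * sqrt (1 / (2 * pi))
                 * exp (- (erfinv ((1 + \<beta> - 2 * \<alpha>w) / ((2 * \<mu> - 1) * (1 - \<beta>))))\<^sup>2)
               / (\<alpha>w * sqrt 2 * erfinv ((1 + \<beta> - 2 * \<alpha>w) / ((2 * \<mu> - 1) * (1 - \<beta>)))) = 1"
  shows "(\<forall>\<alpha>. \<alpha> > \<alpha>w \<longrightarrow> (\<lambda>n. real (m n) / real n) \<longlonglongrightarrow> \<alpha> \<longrightarrow>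
           (\<exists>c>0. \<forall>\<^sub>F n in sequentially.
              measure (gaussian_matrix (m n) n) (unique_event (m n) n (xt n)) \<ge> 1 - exp (- c * real n)))
       \<and> (\<forall>\<alpha>. \<alpha> < \<alpha>w \<longrightarrow> (\<lambda>n. real (m n) / real n) \<longlonglongrightarrow> \<alpha> \<longrightarrow>
           (\<exists>c>0. \<forall>\<^sub>F n in sequentially.
              measure (gaussian_matrix (m n) n)
                (space (gaussian_matrix (m n) n) - unique_event (m n) n (xt n)) \<ge> 1 - exp (- c * real n)))"
proof -
  interpret box_l1_regime \<mu> \<beta> \<alpha>w k z xt
    by (rule box_l1_regime.intro) (fact assms)+
  show ?thesis
    using uniquely_recovers not_uniquely_recovers by blast
qed

end
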